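(* Let $\mathcal{H}$ be a separable real Hilbert space with Borel $\sigma$-algebra $\mathcal{B}(\mathcal{H})$, and let $C\colon\mathcal{H}\to\mathcal{H}$ be a non-singular covariance operator defining the Gaussian measure $\mu_0=\mathcal{N}(0,C)$. Let $\rho\colon\mathcal{H}\to(0,\infty)$ be lower semicontinuous with $Z:=\int_{\mathcal{H}}\rho(x)\,\mu_0(\mathrm{d}x)<\infty$, and let $\mu(\mathrm{d}x)=\frac1Z\rho(x)\,\mu_0(\mathrm{d}x)$. Let $H$ be the transition kernel of the elliptical slice sampler, i.e. for $x\in\mathcal{H}$ and $A\in\mathcal{B}(\mathcal{H})$, $$H(x,A)=\frac{1}{\rho(x)}\int_0^{\rho(x)}\int_{\mathcal{H}}Q_{S(x,w,t)}\bigl(0,\,p_{x,w}^{-1}(\mathcal{H}(t)\cap A)\bigr)\,\mu_0(\mathrm{d}w)\,\mathrm{d}t .$$ Then $H$ is reversible with respect to $\mu$, i.e. $\int_B H(x,A)\,\mu(\mathrm{d}x)=\int_A H(x,B)\,\mu(\mathrm{d}x)$ for all $A,B\in\mathcal{B}(\mathcal{H})$. Moreover, the linear operator $\mathrm{H}\colon L^2_\mu\to L^2_\mu$, $(\mathrm{H}f)(x)=\int_{\mathcal{H}}f(y)\,H(x,\mathrm{d}y)$, is positive semi-definite, i.e. $\langle\mathrm{H}f,f\rangle_\mu\ge0$ for all $f\in L^2_\mu$.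
   Context: A non-singular covariance operator is a bounded linear, self-adjoint, positive definite trace class operator $C$ with $\ker C=\{0\}$. $L^2_\mu$ is the space of functions $f\colon\mathcal{H}\to\mathbb{R}$ with $\int f^2\,\mathrm{d}\mu<\infty$, with inner product $\langle f,g\rangle_\mu=\int_{\mathcal{H}}fg\,\mathrm{d}\mu$. Level sets and ellipses: for $t\ge0$, $\mathcal{H}(t)=\{x\in\mathcal{H}:\rho(x)>t\}$. For $x,w\in\mathcal{H}$, $p_{x,w}\colon[0,2\pi)\to\mathcal{H}$, $p_{x,w}(\theta)=\cos(\theta)x+\sin(\theta)w$, with pre-image $p_{x,w}^{-1}(A)=\{\theta\in[0,2\pi):p_{x,w}(\theta)\in A\}$. Put $S(x,w,t)=p_{x,w}^{-1}(\mathcal{H}(t))$. Generalized intervals: for $\alpha,\beta\in[0,2\pi)$, $I(\alpha,\beta)=[\alpha,\beta)$ if $\alpha<\beta$, $I(\alpha,\beta)=[0,\beta)\cup[\alpha,2\pi)$ if $\alpha>\beta$, $I(\alpha,\alpha)=[0,2\pi)$; and $J(\alpha,\beta)=I(\alpha,\beta)$ if $\alpha\ne\beta$, $J(\alpha,\alpha)=\emptyset$. $\mathcal{U}_I$ denotes the uniform distribution on a bounded Borel set $I\subset\mathbb{R}$ of positive Lebesgue measure, and $\delta_v$ the Dirac measure at $v$. Shrinkage chain: for $\theta\in[0,2\pi)$ let $\Lambda_\theta=\{(\gamma,\gamma^{\min},\gamma^{\max})\in[0,2\pi)^3:\gamma,\theta\in I(\gamma^{\min},\gamma^{\max}),\ \gamma\ne\theta\}$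 and, for $z=(\gamma,\gamma^{\min},\gamma^{\max})\in\Lambda_\theta$ and $D\in\mathcal{B}([0,2\pi)^3)$, $$R_\theta(z,D)=\mathbf{1}_{J(\gamma^{\min},\theta)}(\gamma)\,\bigl(\mathcal{U}_{I(\gamma,\gamma^{\max})}\otimes\delta_{(\gamma,\gamma^{\max})}\bigr)(D)+\mathbf{1}_{I(\theta,\gamma^{\max})}(\gamma)\,\bigl(\mathcal{U}_{I(\gamma^{\min},\gamma)}\otimes\delta_{(\gamma^{\min},\gamma)}\bigr)(D).$$ This is a Markov kernel with $R_\theta(z,\Lambda_\theta)=1$. Let $\mathbb{P}(\cdot\mid\Theta=\theta)$ be the law under which $(Z_n)_{n\in\mathbb{N}}$, $Z_n=(\Gamma_n,\Gamma_n^{\min},\Gamma_n^{\max})$, is the Markov chain with transition kernel $R_\theta$ and initial law $\mathbb{P}_{Z_1}(D)=\int_0^{2\pi}\delta_{(\gamma,\gamma,\gamma)}(D)\frac{\mathrm{d}\gamma}{2\pi}$ (so $Z_1\in\Lambda_\theta$ almost surely). For $S\in\mathcal{B}([0,2\pi))$ let $\tau_S=\inf\{n\in\mathbb{N}:\Gamma_n\in S\}$ ($\inf\emptyset=\infty$). Shrinkage kernel: for $\theta\in S$ and Borel $F\subseteq S$, $Q_S(\theta,F)=\mathbb{P}(\Gamma_{\tau_S}\in F,\ \tau_S<\infty\mid\Theta=\theta)$. *)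

theory Defs
  imports "HOL-Probability.Probability"
begin

definition self_adjoint :: "('a::real_inner \<Rightarrow> 'a) \<Rightarrow> bool" where
  "self_adjoint T \<longleftrightarrow> (\<forall>x y. T x \<bullet> y = x \<bullet> T y)"

definition orthonormal_basis :: "'a::real_inner set \<Rightarrow> bool" where
  "orthonormal_basis B \<longleftrightarrow>
     (\<forall>e\<in>B. norm e = 1) \<and> pairwise orthogonal B \<and> closure (span B) = UNIV"

text \<open>\<open>P\<close> is the modulus \<open>|T|\<close>, i.e. the positive square root of \<open>T\<^sup>* T\<close>.\<close>

definition operator_modulus :: "('a::real_inner \<Rightarrow> 'a) \<Rightarrow> ('a \<Rightarrow> 'a) \<Rightarrow> bool" where
  "operator_modulus T P \<longleftrightarrow>
     bounded_linear P \<and> self_adjoint P \<and> (\<forall>x. 0 \<le> P x \<bullet> x) \<and>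
     (\<forall>x y. P (P x) \<bullet> y = T x \<bullet> T y)"

definition trace_class :: "('a::real_inner \<Rightarrow> 'a) \<Rightarrow> bool" where
  "trace_class T \<longleftrightarrow> bounded_linear T \<and>
     (\<exists>P. operator_modulus T P \<and>
          (\<forall>B. orthonormal_basis B \<longrightarrow> (\<lambda>e. P e \<bullet> e) summable_on B))"

definition nonsingular_covariance_operator :: "('a::real_inner \<Rightarrow> 'a) \<Rightarrow> bool" where
  "nonsingular_covariance_operator C \<longleftrightarrow>
     bounded_linear C \<and> self_adjoint C \<and> (\<forall>x. x \<noteq> 0 \<longrightarrow> 0 < C x \<bullet> x) \<and>
     trace_class C \<and> {x. C x = 0} = {0}"

text \<open>\<open>M = N(0, C)\<close>: the Borel probability measure whose characteristic functional is
  \<open>h \<mapsto> exp (- \<langle>C h, h\<rangle> / 2)\<close>.\<close>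

definition centered_gaussian ::
    "('a::{real_inner, polish_space} \<Rightarrow> 'a) \<Rightarrow> 'a measure \<Rightarrow> bool" where
  "centered_gaussian C M \<longleftrightarrow>
     prob_space M \<and> sets M = sets borel \<and>
     (\<forall>h. (LINT x|M. iexp (h \<bullet> x)) = complex_of_real (exp (- (C h \<bullet> h) / 2)))"

definition lower_semicontinuous :: "('a::topological_space \<Rightarrow> real) \<Rightarrow> bool" where
  "lower_semicontinuous f \<longleftrightarrow> (\<forall>x. \<forall>c < f x. \<forall>\<^sub>F y in nhds x. c < f y)"

definition gen_interval :: "real \<Rightarrow> real \<Rightarrow> real set" where
  "gen_interval \<alpha> \<beta> =
     (if \<alpha> < \<beta> then {\<alpha>..<\<beta>}
      else if \<alpha> > \<beta> then {0..<\<beta>} \<union> {\<alpha>..<2 * pi}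
      else {0..<2 * pi})"

definition gen_interval0 :: "real \<Rightarrow> real \<Rightarrow> real set" where
  "gen_interval0 \<alpha> \<beta> = (if \<alpha> = \<beta> then {} else gen_interval \<alpha> \<beta>)"

definition shrink_states :: "real \<Rightarrow> (real \<times> real \<times> real) set" where
  "shrink_states \<theta> =
     {(\<gamma>, a, b). \<gamma> \<in> {0..<2 * pi} \<and> a \<in> {0..<2 * pi} \<and> b \<in> {0..<2 * pi} \<and>
        \<gamma> \<in> gen_interval a b \<and> \<theta> \<in> gen_interval a b \<and> \<gamma> \<noteq> \<theta>}"

definition shrink_transition ::
    "real \<Rightarrow> real \<times> real \<times> real \<Rightarrow> (real \<times> real \<times> real) set \<Rightarrow> ennreal" where
  "shrink_transition \<theta> z D =
     (case z of (\<gamma>, a, b) \<Rightarrow>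
        indicator (gen_interval0 a \<theta>) \<gamma> *
          emeasure (uniform_measure lborel (gen_interval \<gamma> b) \<Otimes>\<^sub>M return borel (\<gamma>, b)) D +
        indicator (gen_interval \<theta> b) \<gamma> *
          emeasure (uniform_measure lborel (gen_interval a \<gamma>) \<Otimes>\<^sub>M return borel (a, \<gamma>)) D)"

text \<open>The chain almost surely stays in \<^term>\<open>shrink_states \<theta>\<close>; Dirac measures outside of this
  set only serve to make the kernel total.\<close>

definition shrink_kernel :: "real \<Rightarrow> real \<times> real \<times> real \<Rightarrow> (real \<times> real \<times> real) measure" where
  "shrink_kernel \<theta> z =
     (if z \<in> shrink_states \<theta> then measure_of UNIV (sets borel) (shrink_transition \<theta> z)
      else return borel z)"

definition shrink_init :: "(real \<times> real \<times> real) measure" where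
  "shrink_init = distr (uniform_measure lborel {0..<2 * pi}) borel (\<lambda>\<gamma>. (\<gamma>, \<gamma>, \<gamma>))"

definition shrink_step ::
    "real \<Rightarrow> nat \<Rightarrow> (nat \<Rightarrow> real \<times> real \<times> real) \<Rightarrow> (real \<times> real \<times> real) measure" where
  "shrink_step \<theta> n z = (case n of 0 \<Rightarrow> shrink_init | Suc m \<Rightarrow> shrink_kernel \<theta> (z m))"

text \<open>The law of the whole chain given \<open>\<Theta> = \<theta>\<close>, obtained from the Ionescu-Tulcea theorem.
  Trajectories are indexed from 0: coordinate \<open>n\<close> is the state \<open>Z\<^bsub>n+1\<^esub>\<close>.\<close>

definition shrink_chain :: "real \<Rightarrow> (nat \<Rightarrow> real \<times> real \<times> real) measure" where
  "shrink_chain \<theta> =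
     projective_family.lim UNIV (Ionescu_Tulcea.CI (shrink_step \<theta>) (\<lambda>_. borel)) (\<lambda>_. borel)"

definition hitting_time :: "real set \<Rightarrow> (nat \<Rightarrow> real \<times> real \<times> real) \<Rightarrow> enat" where
  "hitting_time S z = Inf (enat ` {n. fst (z n) \<in> S})"

definition shrinkage_kernel :: "real set \<Rightarrow> real \<Rightarrow> real set \<Rightarrow> ennreal" where
  "shrinkage_kernel S \<theta> F =
     emeasure (shrink_chain \<theta>)
       {z \<in> space (shrink_chain \<theta>).
          hitting_time S z < \<infinity> \<and> fst (z (the_enat (hitting_time S z))) \<in> F}"

definition level_set :: "('a \<Rightarrow> real) \<Rightarrow> real \<Rightarrow> 'a set" where
  "level_set \<rho> t = {x. \<rho> x > t}"

definition ellipse :: "'a::real_vector \<Rightarrow> 'a \<Rightarrow> real \<Rightarrow> 'a" where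
  "ellipse x w \<theta> = cos \<theta> *\<^sub>R x + sin \<theta> *\<^sub>R w"

definition ellipse_preimage :: "'a::real_vector \<Rightarrow> 'a \<Rightarrow> 'a set \<Rightarrow> real set" where
  "ellipse_preimage x w A = {\<theta> \<in> {0..<2 * pi}. ellipse x w \<theta> \<in> A}"

definition ess_transition ::
    "'a::real_vector measure \<Rightarrow> ('a \<Rightarrow> real) \<Rightarrow> 'a \<Rightarrow> 'a set \<Rightarrow> ennreal" where
  "ess_transition \<mu>0 \<rho> x A =
     ennreal (1 / \<rho> x) *
       (\<integral>\<^sup>+t\<in>{0..\<rho> x}.
          (\<integral>\<^sup>+w. shrinkage_kernel (ellipse_preimage x w (level_set \<rho> t)) 0
                  (ellipse_preimage x w (level_set \<rho> t \<inter> A)) \<partial>\<mu>0)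
        \<partial>lborel)"

text \<open>The measure \<open>H(x, \<cdot>)\<close>, for use in integrals; see \<open>emeasure_ess_kernel\<close> below.\<close>

definition ess_kernel ::
    "'a::{real_inner, polish_space} measure \<Rightarrow> ('a \<Rightarrow> real) \<Rightarrow> 'a \<Rightarrow> 'a measure" where
  "ess_kernel \<mu>0 \<rho> x = measure_of UNIV (sets borel) (ess_transition \<mu>0 \<rho> x)"

definition target_measure :: "'a measure \<Rightarrow> ('a \<Rightarrow> real) \<Rightarrow> 'a measure" where
  "target_measure \<mu>0 \<rho> = density \<mu>0 (\<lambda>x. ennreal (\<rho> x / (LINT y|\<mu>0. \<rho> y)))"

definition reversible :: "'a measure \<Rightarrow> ('a \<Rightarrow> 'a set \<Rightarrow> ennreal) \<Rightarrow> bool" where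
  "reversible M K \<longleftrightarrow>
     (\<forall>A\<in>sets M. \<forall>B\<in>sets M. (\<integral>\<^sup>+x\<in>B. K x A \<partial>M) = (\<integral>\<^sup>+x\<in>A. K x B \<partial>M))"

definition L2 :: "'a measure \<Rightarrow> ('a \<Rightarrow> real) set" where
  "L2 M = {f \<in> borel_measurable M. (\<integral>\<^sup>+x. ennreal ((f x)\<^sup>2) \<partial>M) < \<infinity>}"

definition L2_inner :: "'a measure \<Rightarrow> ('a \<Rightarrow> real) \<Rightarrow> ('a \<Rightarrow> real) \<Rightarrow> real" where
  "L2_inner M f g = (LINT x|M. f x * g x)"

definition kernel_operator :: "('a \<Rightarrow> 'a measure) \<Rightarrow> ('a \<Rightarrow> real) \<Rightarrow> 'a \<Rightarrow> real" where
  "kernel_operator K f x = (LINT y|K x. f y)"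

text \<open>A map on square integrable functions that induces a linear operator on the space of
  almost-everywhere classes.\<close>

definition L2_linear_operator :: "'a measure \<Rightarrow> (('a \<Rightarrow> real) \<Rightarrow> 'a \<Rightarrow> real) \<Rightarrow> bool" where
  "L2_linear_operator M T \<longleftrightarrow>
     (\<forall>f\<in>L2 M. T f \<in> L2 M) \<and>
     (\<forall>f\<in>L2 M. \<forall>g\<in>L2 M. (AE x in M. f x = g x) \<longrightarrow> (AE x in M. T f x = T g x)) \<and>
     (\<forall>f\<in>L2 M. \<forall>g\<in>L2 M. \<forall>a b.
        AE x in M. T (\<lambda>y. a * f y + b * g y) x = a * T f x + b * T g x)"

definition L2_positive_semidefinite :: "'a measure \<Rightarrow> (('a \<Rightarrow> real) \<Rightarrow> 'a \<Rightarrow> real) \<Rightarrow> bool" where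
  "L2_positive_semidefinite M T \<longleftrightarrow> (\<forall>f\<in>L2 M. 0 \<le> L2_inner M (T f) f)"

lemma sets_gen_interval [measurable]: "gen_interval a b \<in> sets borel"
  by (simp add: gen_interval_def)

lemma emeasure_gen_interval_finite: "emeasure lborel (gen_interval a b) < \<infinity>"
proof -
  have "emeasure lborel (gen_interval a b) \<le> emeasure lborel ({a..<b} \<union> {0..<b} \<union> {a..<2*pi} \<union> {0..<2*pi})"
    by (intro emeasure_mono) (auto simp: gen_interval_def)
  also have "\<dots> < \<infinity>"
    by (intro emeasure_bounded_finite) auto
  finally show ?thesis .
qed

lemma emeasure_gen_interval_pos:
  assumes "a \<in> {0..<2 * pi}" "b \<in> {0..<2 * pi}"
  shows "0 < emeasure lborel (gen_interval a b)"
proof -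
  obtain c d where cd: "c < d" "{c..<d} \<subseteq> gen_interval a b"
  proof (cases "a < b")
    case True
    then show ?thesis by (intro that[of a b]) (auto simp: gen_interval_def)
  next
    case False
    then show ?thesis using assms by (intro that[of a "2 * pi"]) (auto simp: gen_interval_def)
  qed
  have "0 < emeasure lborel {c..<d}" using cd by simp
  also have "\<dots> \<le> emeasure lborel (gen_interval a b)"
    by (intro emeasure_mono cd) simp
  finally show ?thesis .
qed

lemma prob_space_uniform_gen_interval:
  assumes "a \<in> {0..<2 * pi}" "b \<in> {0..<2 * pi}"
  shows "prob_space (uniform_measure lborel (gen_interval a b))"
  using emeasure_gen_interval_finite[of a b] emeasure_gen_interval_pos[OF assms]
  by (intro prob_space_uniform_measure) auto

lemma measurable_gen_interval_pred [measurable]: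
  "Measurable.pred (borel \<Otimes>\<^sub>M borel \<Otimes>\<^sub>M borel) (\<lambda>(x, a, b). x \<in> gen_interval a b)"
proof -
  have "(\<lambda>(x, a, b). x \<in> gen_interval a b) =
    (\<lambda>y. (fst (snd y) < snd (snd y) \<and> fst (snd y) \<le> fst y \<and> fst y < snd (snd y)) \<or>
      (fst (snd y) > snd (snd y) \<and> (0 \<le> fst y \<and> fst y < snd (snd y) \<or> fst (snd y) \<le> fst y \<and> fst y < 2 * pi)) \<or>
      (fst (snd y) = snd (snd y) \<and> 0 \<le> fst y \<and> fst y < 2 * pi))"
    by (auto simp: gen_interval_def fun_eq_iff)
  then show ?thesis by simp
qed

lemma pred_gen_interval:
  assumes [measurable]: "f \<in> borel_measurable M" "g \<in> borel_measurable M" "h \<in> borel_measurable M"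
  shows "Measurable.pred M (\<lambda>x. f x \<in> gen_interval (g x) (h x))"
  using measurable_compose[of "\<lambda>x. (f x, g x, h x)", OF _ measurable_gen_interval_pred] by simp

lemma sets_shrink_states: "shrink_states \<theta> \<in> sets borel"
proof -
  have "shrink_states \<theta> = {z \<in> space (borel \<Otimes>\<^sub>M borel \<Otimes>\<^sub>M borel).
      0 \<le> fst z \<and> fst z < 2 * pi \<and> 0 \<le> fst (snd z) \<and> fst (snd z) < 2 * pi \<and>
      0 \<le> snd (snd z) \<and> snd (snd z) < 2 * pi \<and>
      fst z \<in> gen_interval (fst (snd z)) (snd (snd z)) \<and>
      \<theta> \<in> gen_interval (fst (snd z)) (snd (snd z)) \<and> fst z \<noteq> \<theta>}"
    by (auto simp: shrink_states_def space_pair_measure)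
  also have "\<dots> \<in> sets (borel \<Otimes>\<^sub>M borel \<Otimes>\<^sub>M borel)"
    using pred_gen_interval[measurable] by measurable
  finally show ?thesis by (simp only: borel_prod)
qed

lemma measurable_uniform_gen_interval:
  assumes [measurable]: "g \<in> borel_measurable M" "h \<in> borel_measurable M"
  shows "(\<lambda>x. uniform_measure lborel (gen_interval (g x) (h x))) \<in> measurable M (subprob_algebra borel)"
proof (rule measurable_subprob_algebra)
  fix x
  have "emeasure (uniform_measure lborel (gen_interval (g x) (h x))) UNIV \<le> 1"
    by (cases "emeasure lborel (gen_interval (g x) (h x)) = 0")
       (use emeasure_gen_interval_finite[of "g x" "h x"] in \<open>auto simp: emeasure_uniform_measure\<close>)
  then show "subprob_space (uniform_measure lborel (gen_interval (g x) (h x)))"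
    by (intro subprob_spaceI) auto
  show "sets (uniform_measure lborel (gen_interval (g x) (h x))) = sets borel" by simp
next
  fix A :: "real set" assume [measurable]: "A \<in> sets borel"
  note pred_gen_interval[measurable]
  have em: "(\<lambda>x. emeasure lborel (gen_interval (g x) (h x) \<inter> A)) \<in> borel_measurable M"
    if [measurable]: "A \<in> sets borel" for A
  proof -
    have "{y \<in> space (M \<Otimes>\<^sub>M lborel). snd y \<in> gen_interval (g (fst y)) (h (fst y)) \<and> snd y \<in> A}
        \<in> sets (M \<Otimes>\<^sub>M lborel)" (is "?X \<in> _")
      by measurable
    from lborel.measurable_emeasure_Pair[OF this]
    show ?thesis
      by (rule measurable_cong[THEN iffD1, rotated])
         (auto intro!: arg_cong[where f="emeasure lborel"] simp: space_pair_measure)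
  qed
  show "(\<lambda>x. emeasure (uniform_measure lborel (gen_interval (g x) (h x))) A) \<in> borel_measurable M"
    using em[of A] em[of UNIV] by (simp add: emeasure_uniform_measure)
qed

lemma measurable_shrink_component:
  fixes g h u v :: "'b \<Rightarrow> real"
  assumes [measurable]: "g \<in> borel_measurable M" "h \<in> borel_measurable M"
    "u \<in> borel_measurable M" "v \<in> borel_measurable M"
  shows "(\<lambda>x. uniform_measure lborel (gen_interval (g x) (h x)) \<Otimes>\<^sub>M return borel (u x, v x))
     \<in> measurable M (subprob_algebra (borel :: (real \<times> real \<times> real) measure))"
proof -
  have "(\<lambda>x. return borel (u x, v x)) \<in> measurable M (subprob_algebra (borel :: (real \<times> real) measure))"
    by (rule measurable_compose[OF _ return_measurable]) simp
  from measurable_pair_measure[OF measurable_uniform_gen_interval[of g M h] this]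
  show ?thesis by (simp add: borel_prod)
qed

text \<open>On \<^term>\<open>shrink_states \<theta>\<close> exactly one of the two indicators in
  \<^const>\<open>shrink_transition\<close> equals 1.\<close>

lemma shrink_kernel_eq:
  assumes "(\<gamma>, a, b) \<in> shrink_states \<theta>"
  shows "shrink_kernel \<theta> (\<gamma>, a, b) =
    (if a \<noteq> \<theta> \<and> \<gamma> \<in> gen_interval a \<theta>
     then uniform_measure lborel (gen_interval \<gamma> b) \<Otimes>\<^sub>M return borel (\<gamma>, b)
     else uniform_measure lborel (gen_interval a \<gamma>) \<Otimes>\<^sub>M return borel (a, \<gamma>))" (is "_ = ?R")
proof -
  have 1: "\<gamma> \<in> gen_interval \<theta> b \<longleftrightarrow> \<not> (a \<noteq> \<theta> \<and> \<gamma> \<in> gen_interval a \<theta>)"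
    using assms by (auto simp: shrink_states_def gen_interval_def split: if_splits)
  have "shrink_transition \<theta> (\<gamma>, a, b) = emeasure ?R"
    by (rule ext) (auto simp: shrink_transition_def 1 gen_interval0_def indicator_def)
  moreover have "sets ?R = sets borel" "space ?R = UNIV"
    by (auto simp: space_pair_measure borel_prod[symmetric] intro!: sets_pair_measure_cong)
  ultimately show ?thesis
    using assms measure_of_of_measure[of ?R] by (simp add: shrink_kernel_def)
qed

lemma prob_space_shrink_component:
  assumes "a \<in> {0..<2 * pi}" "b \<in> {0..<2 * pi}"
  shows "prob_space (uniform_measure lborel (gen_interval a b) \<Otimes>\<^sub>M return borel (c :: real \<times> real))"
proof -
  interpret A: prob_space "uniform_measure lborel (gen_interval a b)"
    by (rule prob_space_uniform_gen_interval[OF assms])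
  interpret B: prob_space "return borel c" by (rule prob_space_return) simp
  interpret pair_prob_space "uniform_measure lborel (gen_interval a b)" "return borel c" ..
  show ?thesis by (rule prob_space_axioms)
qed

lemma prob_space_shrink_kernel: "prob_space (shrink_kernel \<theta> z)"
proof (cases "z \<in> shrink_states \<theta>")
  case True
  then obtain \<gamma> a b where z: "z = (\<gamma>, a, b)"
    and r: "\<gamma> \<in> {0..<2 * pi}" "a \<in> {0..<2 * pi}" "b \<in> {0..<2 * pi}"
    by (auto simp: shrink_states_def)
  show ?thesis
    unfolding z shrink_kernel_eq[OF True[unfolded z]]
    using prob_space_shrink_component r by auto
next
  case False
  then show ?thesis by (auto simp: shrink_kernel_def intro!: prob_space_return)
qed

lemma measurable_shrink_kernel: "shrink_kernel \<theta> \<in> measurable borel (subprob_algebra borel)"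
proof -
  let ?B = "borel :: (real \<times> real \<times> real) measure"
  have comp [measurable]: "fst \<in> borel_measurable ?B" "(\<lambda>z. fst (snd z)) \<in> borel_measurable ?B"
    "(\<lambda>z. snd (snd z)) \<in> borel_measurable ?B"
    by (auto simp: borel_prod[symmetric])
  have eq: "shrink_kernel \<theta> = (\<lambda>z. if z \<in> shrink_states \<theta> then
      (if fst (snd z) \<noteq> \<theta> \<and> fst z \<in> gen_interval (fst (snd z)) \<theta>
       then uniform_measure lborel (gen_interval (fst z) (snd (snd z))) \<Otimes>\<^sub>M return borel (fst z, snd (snd z))
       else uniform_measure lborel (gen_interval (fst (snd z)) (fst z)) \<Otimes>\<^sub>M return borel (fst (snd z), fst z))
      else return borel z)"
  proof
    fix z show "shrink_kernel \<theta> z = (if z \<in> shrink_states \<theta> then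
      (if fst (snd z) \<noteq> \<theta> \<and> fst z \<in> gen_interval (fst (snd z)) \<theta>
       then uniform_measure lborel (gen_interval (fst z) (snd (snd z))) \<Otimes>\<^sub>M return borel (fst z, snd (snd z))
       else uniform_measure lborel (gen_interval (fst (snd z)) (fst z)) \<Otimes>\<^sub>M return borel (fst (snd z), fst z))
      else return borel z)"
      using shrink_kernel_eq[of "fst z" "fst (snd z)" "snd (snd z)" \<theta>]
      by (cases "z \<in> shrink_states \<theta>") (simp_all add: shrink_kernel_def)
  qed
  have p1: "Measurable.pred ?B (\<lambda>z. z \<in> shrink_states \<theta>)"
    by (rule pred_sets2[OF sets_shrink_states]) simp
  have p2: "Measurable.pred ?B (\<lambda>z. fst (snd z) \<noteq> \<theta> \<and> fst z \<in> gen_interval (fst (snd z)) \<theta>)"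
    using pred_gen_interval[measurable] by measurable
  show ?thesis
    unfolding eq
    by (intro measurable_If measurable_shrink_component comp return_measurable)
       (use p1 p2 in \<open>simp_all add: pred_def\<close>)
qed

lemma sets_shrink_kernel: "sets (shrink_kernel \<theta> z) = sets borel"
  using subprob_measurableD(2)[OF measurable_shrink_kernel] by simp

lemma prob_space_shrink_init: "prob_space shrink_init"
proof -
  have m: "(\<lambda>\<gamma>::real. (\<gamma>, \<gamma>, \<gamma>)) \<in> measurable (uniform_measure lborel {0..<2 * pi}) borel"
    by (simp add: borel_prod[symmetric] measurable_cong_sets[OF sets_uniform_measure refl])
  have "prob_space (uniform_measure lborel {0..<2 * pi :: real})"
    by (rule prob_space_uniform_measure) (auto simp: ennreal_eq_0_iff not_le)
  then show ?thesis
    unfolding shrink_init_def using m by (rule prob_space.prob_space_distr)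
qed

lemma Ionescu_Tulcea_shrink_step: "Ionescu_Tulcea (shrink_step \<theta>) (\<lambda>_. borel)"
proof (rule Ionescu_Tulcea.intro)
  fix n
  show "shrink_step \<theta> n \<in> measurable (PiM {0..<n} (\<lambda>_. borel)) (subprob_algebra borel)"
  proof (cases n)
    case 0
    have "shrink_init \<in> space (subprob_algebra borel)"
      using prob_space_shrink_init
      by (simp add: space_subprob_algebra prob_space_imp_subprob_space) (simp add: shrink_init_def)
    then show ?thesis by (simp add: shrink_step_def[abs_def] 0)
  next
    case (Suc m)
    have "(\<lambda>z. z m) \<in> measurable (PiM {0..<n} (\<lambda>_. borel)) borel"
      by (rule measurable_component_singleton) (simp add: Suc)
    from measurable_compose[OF this measurable_shrink_kernel]
    show ?thesis by (simp add: shrink_step_def[abs_def] Suc)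
  qed
next
  show "prob_space (shrink_step \<theta> n x)" for n x
    by (cases n) (auto simp: shrink_step_def prob_space_shrink_init prob_space_shrink_kernel)
qed

lemma sets_shrink_chain: "sets (shrink_chain \<theta>) = sets (PiM UNIV (\<lambda>_. borel))"
  and space_shrink_chain: "space (shrink_chain \<theta>) = UNIV"
  and prob_space_shrink_chain: "prob_space (shrink_chain \<theta>)"
proof -
  interpret IT: Ionescu_Tulcea "shrink_step \<theta>" "\<lambda>_. borel"
    by (rule Ionescu_Tulcea_shrink_step)
  have [simp]: "shrink_chain \<theta> = IT.PF.lim" by (simp add: shrink_chain_def)
  show "sets (shrink_chain \<theta>) = sets (PiM UNIV (\<lambda>_. borel))" by simp
  show sp: "space (shrink_chain \<theta>) = UNIV" by (simp add: space_PiM)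
  show "prob_space (shrink_chain \<theta>)"
  proof
    have "emeasure IT.PF.lim (IT.PF.emb UNIV {} (space (PiM {} (\<lambda>_. borel)))) =
        emeasure (IT.CI {}) (space (PiM {} (\<lambda>_. borel)))"
      by (rule IT.lim) auto
    also have "\<dots> = 1"
      using prob_space.emeasure_space_1[OF IT.PF.prob_space_P[of "{}"]] by (simp add: IT.PF.space_P)
    also have "IT.PF.emb UNIV {} (space (PiM {} (\<lambda>_. borel))) = (UNIV :: (nat \<Rightarrow> real \<times> real \<times> real) set)"
      by (auto simp: prod_emb_def space_PiM)
    finally show "emeasure (shrink_chain \<theta>) (space (shrink_chain \<theta>)) = 1"
      by (simp add: space_PiM)
  qed
qed

lemma hitting_time_iff:
  "hitting_time S z < \<infinity> \<and> fst (z (the_enat (hitting_time S z))) \<in> F \<longleftrightarrow>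
     (\<exists>n. fst (z n) \<in> S \<and> fst (z n) \<in> F \<and> (\<forall>k<n. fst (z k) \<notin> S))"
proof (cases "\<exists>n. fst (z n) \<in> S")
  case True
  define m where "m = (LEAST n. fst (z n) \<in> S)"
  have m: "fst (z m) \<in> S" "\<And>k. k < m \<Longrightarrow> fst (z k) \<notin> S"
    unfolding m_def using True by (auto intro: LeastI_ex dest: not_less_Least)
  have "hitting_time S z = enat m"
    unfolding hitting_time_def
  proof (rule antisym)
    show "Inf (enat ` {n. fst (z n) \<in> S}) \<le> enat m" using m by (intro Inf_lower) auto
    show "enat m \<le> Inf (enat ` {n. fst (z n) \<in> S})"
      using m by (intro Inf_greatest) (auto simp: not_less[symmetric])
  qed
  moreover have "(\<exists>n. fst (z n) \<in> S \<and> fst (z n) \<in> F \<and> (\<forall>k<n. fst (z k) \<notin> S)) \<longleftrightarrow> fst (z m) \<in> F"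
  proof
    assume "\<exists>n. fst (z n) \<in> S \<and> fst (z n) \<in> F \<and> (\<forall>k<n. fst (z k) \<notin> S)"
    then obtain n where n: "fst (z n) \<in> S" "fst (z n) \<in> F" "\<forall>k<n. fst (z k) \<notin> S" by blast
    then have "n = m" using m by (meson linorder_neqE_nat)
    with n show "fst (z m) \<in> F" by simp
  qed (use m in blast)
  ultimately show ?thesis by simp
next
  case False
  then have "hitting_time S z = \<infinity>" by (simp add: hitting_time_def top_enat_def)
  with False show ?thesis by auto
qed

lemma borel_measurable_lower_semicontinuous:
  assumes "lower_semicontinuous f" shows "f \<in> borel_measurable borel"
proof (rule borel_measurableI_greater)
  fix c
  have "open {x. c < f x}"
  proof (subst open_subopen, safe)
    fix x assume "c < f x"
    then have "\<forall>\<^sub>F y in nhds x. c < f y" using assms by (auto simp: lower_semicontinuous_def)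
    then show "\<exists>T. open T \<and> x \<in> T \<and> T \<subseteq> {x. c < f x}" by (auto simp: eventually_nhds)
  qed
  then show "{x \<in> space borel. c < f x} \<in> sets borel" by simp
qed

context
  fixes \<mu>0 :: "'a::{real_inner, polish_space} measure" and \<rho> :: "'a \<Rightarrow> real"
  assumes prob: "prob_space \<mu>0" and sets0: "sets \<mu>0 = sets borel"
    and \<rho>: "\<rho> \<in> borel_measurable borel"
begin

lemma sets_ess_event:
  assumes [measurable]: "A \<in> sets borel"
  shows "{y \<in> space ((borel \<Otimes>\<^sub>M borel) \<Otimes>\<^sub>M shrink_chain 0).
      hitting_time (ellipse_preimage x (snd (fst y)) (level_set \<rho> (fst (fst y)))) (snd y) < \<infinity> \<and>
      fst (snd y (the_enat (hitting_time (ellipse_preimage x (snd (fst y)) (level_set \<rho> (fst (fst y)))) (snd y))))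
        \<in> ellipse_preimage x (snd (fst y)) (level_set \<rho> (fst (fst y)) \<inter> A)}
    \<in> sets (((borel :: real measure) \<Otimes>\<^sub>M (borel :: 'a measure)) \<Otimes>\<^sub>M shrink_chain 0)"
proof -
  let ?N = "((borel :: real measure) \<Otimes>\<^sub>M (borel :: 'a measure)) \<Otimes>\<^sub>M shrink_chain 0"
  note [measurable] = \<rho>
  have [measurable]: "(\<lambda>y. fst (snd y n)) \<in> borel_measurable ?N" for n
  proof -
    have "(\<lambda>z. z n) \<in> measurable (shrink_chain 0) borel"
      by (simp add: measurable_cong_sets[OF sets_shrink_chain refl] measurable_component_singleton)
    moreover have "fst \<in> measurable (borel :: (real \<times> real \<times> real) measure) borel"
      by (simp add: borel_prod[symmetric])
    ultimately have "(\<lambda>z. fst (z n)) \<in> borel_measurable (shrink_chain 0)" by (rule measurable_compose)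
    then show ?thesis by (rule measurable_compose[OF measurable_snd])
  qed
  have [measurable]: "(\<lambda>y. fst (fst y)) \<in> borel_measurable ?N" "(\<lambda>y. snd (fst y)) \<in> borel_measurable ?N"
    by measurable
  have [measurable]: "(\<lambda>y. ellipse x (snd (fst y)) (fst (snd y n))) \<in> borel_measurable ?N" for n
    unfolding ellipse_def by measurable
  show ?thesis
    unfolding hitting_time_iff unfolding ellipse_preimage_def level_set_def mem_Collect_eq Int_iff atLeastLessThan_iff
    by measurable
qed

lemma measurable_ess_integrand:
  assumes "A \<in> sets borel"
  shows "(\<lambda>(t, w). shrinkage_kernel (ellipse_preimage x w (level_set \<rho> t)) 0
      (ellipse_preimage x w (level_set \<rho> t \<inter> A))) \<in> borel_measurable (lborel \<Otimes>\<^sub>M \<mu>0)"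
proof -
  interpret P: prob_space "shrink_chain 0" by (rule prob_space_shrink_chain)
  have "(\<lambda>(t, w). shrinkage_kernel (ellipse_preimage x w (level_set \<rho> t)) 0
      (ellipse_preimage x w (level_set \<rho> t \<inter> A))) \<in> borel_measurable (borel \<Otimes>\<^sub>M borel)"
    using P.measurable_emeasure_Pair[OF sets_ess_event[OF assms, of x]]
    by (rule measurable_cong[THEN iffD1, rotated])
       (auto simp: shrinkage_kernel_def space_pair_measure intro!: arg_cong[where f="emeasure (shrink_chain 0)"])
  then show ?thesis
    by (simp add: measurable_cong_sets[OF sets_pair_measure_cong[OF sets_lborel sets0] refl])
qed

lemma shrinkage_kernel_suminf:
  assumes "range A \<subseteq> sets borel" "disjoint_family A"
  shows "shrinkage_kernel (ellipse_preimage x w (level_set \<rho> t)) 0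
      (ellipse_preimage x w (level_set \<rho> t \<inter> (\<Union>i. A i))) =
    (\<Sum>i. shrinkage_kernel (ellipse_preimage x w (level_set \<rho> t)) 0
      (ellipse_preimage x w (level_set \<rho> t \<inter> A i)))"
proof -
  let ?S = "ellipse_preimage x w (level_set \<rho> t)"
  let ?E = "\<lambda>A. {z \<in> space (shrink_chain 0). hitting_time ?S z < \<infinity> \<and>
      fst (z (the_enat (hitting_time ?S z))) \<in> ellipse_preimage x w (level_set \<rho> t \<inter> A)}"
  have "?E A \<in> sets (shrink_chain 0)" if "A \<in> sets borel" for A
    using sets_Pair1[OF sets_ess_event[OF that, of x], of "(t, w)"]
    by (simp add: vimage_def space_pair_measure)
  then have "range (\<lambda>i. ?E (A i)) \<subseteq> sets (shrink_chain 0)" using assms(1) by blast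
  moreover have "disjoint_family (\<lambda>i. ?E (A i))"
    using assms(2) unfolding disjoint_family_on_def ellipse_preimage_def by blast
  ultimately have "(\<Sum>i. emeasure (shrink_chain 0) (?E (A i))) = emeasure (shrink_chain 0) (\<Union>i. ?E (A i))"
    by (rule suminf_emeasure)
  also have "(\<Union>i. ?E (A i)) = ?E (\<Union>i. A i)"
    by (auto simp: ellipse_preimage_def)
  finally show ?thesis by (simp add: shrinkage_kernel_def)
qed

lemma emeasure_ess_kernel:
  assumes "A \<in> sets borel"
  shows "emeasure (ess_kernel \<mu>0 \<rho> x) A = ess_transition \<mu>0 \<rho> x A"
proof (rule emeasure_measure_of[OF ess_kernel_def])
  interpret M: prob_space \<mu>0 by (rule prob)
  let ?Q = "\<lambda>t w A. shrinkage_kernel (ellipse_preimage x w (level_set \<rho> t)) 0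
      (ellipse_preimage x w (level_set \<rho> t \<inter> A))"
  show "sets borel \<subseteq> Pow (UNIV :: 'a set)" by simp
  show "positive (sets (ess_kernel \<mu>0 \<rho> x)) (ess_transition \<mu>0 \<rho> x)"
    by (simp add: positive_def ess_transition_def shrinkage_kernel_def ellipse_preimage_def)
  show "countably_additive (sets (ess_kernel \<mu>0 \<rho> x)) (ess_transition \<mu>0 \<rho> x)"
  proof (rule countably_additiveI)
    fix A :: "nat \<Rightarrow> 'a set"
    assume "range A \<subseteq> sets (ess_kernel \<mu>0 \<rho> x)" and dj: "disjoint_family A"
    moreover have "sets (ess_kernel \<mu>0 \<rho> x) = sets borel"
      unfolding ess_kernel_def using sets.sigma_sets_eq[of "borel :: 'a measure"]
      by (simp add: space_borel)
    ultimately have rA: "range A \<subseteq> sets borel" by simp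
    have meas: "(\<lambda>(t, w). ?Q t w (A i)) \<in> borel_measurable (lborel \<Otimes>\<^sub>M \<mu>0)" for i
      using rA by (intro measurable_ess_integrand) auto
    have m1: "(\<lambda>w. ?Q t w (A i)) \<in> borel_measurable \<mu>0" for t i
      using measurable_compose[OF measurable_Pair1' meas, of t i] by simp
    have m2: "(\<lambda>t. \<integral>\<^sup>+w. ?Q t w (A i) \<partial>\<mu>0) \<in> borel_measurable lborel" for i
      by (rule M.borel_measurable_nn_integral[OF meas])
    have "(\<integral>\<^sup>+w. ?Q t w (\<Union>i. A i) \<partial>\<mu>0) = (\<Sum>i. \<integral>\<^sup>+w. ?Q t w (A i) \<partial>\<mu>0)" for t
      by (simp only: shrinkage_kernel_suminf[OF rA dj] nn_integral_suminf[OF m1])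
    then have "(\<integral>\<^sup>+t\<in>{0..\<rho> x}. (\<integral>\<^sup>+w. ?Q t w (\<Union>i. A i) \<partial>\<mu>0) \<partial>lborel) =
        (\<integral>\<^sup>+t. (\<Sum>i. (\<integral>\<^sup>+w. ?Q t w (A i) \<partial>\<mu>0) * indicator {0..\<rho> x} t) \<partial>lborel)"
      by simp
    also have "\<dots> = (\<Sum>i. \<integral>\<^sup>+t\<in>{0..\<rho> x}. (\<integral>\<^sup>+w. ?Q t w (A i) \<partial>\<mu>0) \<partial>lborel)"
      by (rule nn_integral_suminf) (use m2 in measurable)
    finally show "(\<Sum>i. ess_transition \<mu>0 \<rho> x (A i)) = ess_transition \<mu>0 \<rho> x (\<Union>i. A i)"
      by (simp add: ess_transition_def)
  qed
  show "A \<in> sets (ess_kernel \<mu>0 \<rho> x)"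
    unfolding ess_kernel_def using assms sets.sigma_sets_eq[of "borel :: 'a measure"]
    by (simp add: space_borel)
qed

end

end

theory Submission
  imports Defs
begin

text \<open>The product \<open>\<mu>\<^sub>0 \<otimes> \<mu>\<^sub>0\<close> is invariant under rotations of the pair \<open>(x, w)\<close>, and rotating the pair
  by \<open>\<theta>\<close> amounts to reparametrising the ellipse through \<open>x\<close> and \<open>w\<close> by a shift of the angle. Averaging
  over \<open>\<theta>\<close> therefore writes \<open>\<integral> f (Hg) d\<mu>\<close> as a mixture, over levels \<open>t\<close> and pairs \<open>(x, w)\<close>, of
  the forms \<open>\<integral>\<^sub>S f(\<theta>) (Q\<^sub>S g)(\<theta>) d\<theta>\<close> on the ellipse, with \<open>S\<close> the part of the ellipse in the level set.

  For those forms, condition on the rejected proposals. Cutting an interval at a rejected proposal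
  splits it into two pieces, and the chain continues in the piece that contains \<open>\<theta>\<close>. By
  induction on the number of rejections the form is a mixture of the rank-one forms
  \<open>(\<integral>\<^sub>J f) (\<integral>\<^sub>J g) / |J|\<close> over intervals intersected with \<open>S\<close>, hence symmetric and positive semidefinite.\<close>


section \<open>Characteristic functionals and rotation invariance\<close>

text \<open>The Gaussian measure is given only through its characteristic functional, so rotation
  invariance rests on a uniqueness theorem for such functionals; the rotation itself just preserves
  \<open>C h \<bullet> h + C k \<bullet> k\<close>, by cos^2 + sin^2 = 1. The sampler always starts
  the shrinkage at angle 0, the current state. The form on the ellipse needs every starting angle,
  and covariance of the shrinkage under rotations of the circle supplies them. The level t is mixed
  with Lebesgue measure because the density of the target cancels the factor 1/\<rho>(x) of the
  kernel. What remains is the region t < \<rho>(x), which says precisely that angle 0 belongs to S.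
  All energies are integrals of nonnegative functions with values in \<open>ennreal\<close>, where
  sums and integrals may be exchanged freely. Positivity then reads B(f,g) + B(g,f) \<le> B(f,f) +
  B(g,g), and signs and integrability return only on square integrable functions.\<close>

text \<open>Frequency 0 shows that the total masses agree. Dividing by the common mass, if it is
  positive, reduces the claim to Levy's theorem for probability measures. Finite measures are the
  right generality because restrictions to cylinders are no longer normalised.\<close>

lemma finite_measure_eq_of_char_eq:
  fixes M N :: "real measure"
  assumes "finite_measure M" "finite_measure N" and sets: "sets M = sets borel" "sets N = sets borel"
    and eq: "\<And>t. (CLINT x|M. iexp (t * x)) = (CLINT x|N. iexp (t * x))"
  shows "M = N"
proof -
  interpret M: finite_measure M by fact
  interpret N: finite_measure N by fact
  have sp: "space M = UNIV" "space N = UNIV" using sets[THEN sets_eq_imp_space_eq] by auto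
  define m where "m = measure M UNIV"
  have m2: "measure N UNIV = m" using eq[of 0] by (simp add: m_def sp)
  show ?thesis
  proof (cases "m = 0")
    case True
    show ?thesis
    proof (rule measure_eqI)
      fix A assume A: "A \<in> sets M"
      have "emeasure M A \<le> emeasure M UNIV" "emeasure N A \<le> emeasure N UNIV"
        using A sets by (auto intro!: emeasure_mono)
      then show "emeasure M A = emeasure N A"
        using True m2 by (simp add: M.emeasure_eq_measure N.emeasure_eq_measure m_def measure_le_0_iff)
    qed (simp add: sets)
  next
    case False
    then have mpos: "m > 0" by (simp add: m_def less_le)
    define D where "D K = density K (\<lambda>_. ennreal (1 / m))" for K :: "real measure"
    have rd: "real_distribution (D K)" if "finite_measure K" "sets K = sets borel" "measure K UNIV = m" for K
    proof -
      interpret K: finite_measure K by fact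
      have spK: "space K = UNIV" using that(2)[THEN sets_eq_imp_space_eq] by auto
      show ?thesis unfolding real_distribution_def real_distribution_axioms_def
      proof (intro conjI prob_spaceI)
        show "emeasure (D K) (space (D K)) = 1"
          using that mpos by (simp add: D_def emeasure_density spK K.emeasure_eq_measure ennreal_mult'[symmetric])
        show "sets (D K) = sets borel" using that by (simp add: D_def)
      qed
    qed
    have ch: "char (D K) t = (1 / m) *\<^sub>R (CLINT x|K. iexp (t * x))" if "sets K = sets borel" for K t
    proof -
      have [measurable_cong]: "sets K = sets borel" by fact
      show ?thesis using mpos unfolding D_def char_def
        by (subst integral_density) auto
    qed
    have "D M = D N"
    proof (rule Levy_uniqueness[OF rd rd])
      show "char (D M) = char (D N)" by (rule ext) (simp only: ch sets eq)
    qed (use assms(1,2) sets m_def m2 in auto)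
    show ?thesis
    proof (rule measure_eqI)
      fix A assume A: "A \<in> sets M"
      have "emeasure (D M) A = emeasure (D N) A" by (simp add: \<open>D M = D N\<close>)
      then have "ennreal (1 / m) * emeasure M A = ennreal (1 / m) * emeasure N A"
        using A sets by (simp add: D_def emeasure_density nn_integral_cmult)
      then show "emeasure M A = emeasure N A"
        using mpos by (auto simp: ennreal_mult_cancel_left)
    qed (simp add: sets)
  qed
qed

lemma integrable_bounded_iexp:
  fixes M :: "'a::{real_inner, second_countable_topology} measure" and w :: "'a \<Rightarrow> real"
  assumes "finite_measure M" "sets M = sets borel" "w \<in> borel_measurable borel" "\<And>x. \<bar>w x\<bar> \<le> B"
  shows "integrable M (\<lambda>x. w x *\<^sub>R iexp (h \<bullet> x))"
proof -
  interpret finite_measure M by fact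
  note [measurable_cong] = assms(2) note [measurable] = assms(3)
  show ?thesis
    by (rule integrable_const_bound[of _ B]) (use assms(4) in \<open>auto simp: norm_mult\<close>)
qed

text \<open>Taking the weights \<open>1\<close>, \<open>1 + cos \<langle>h, \<cdot>\<rangle>\<close> and \<open>1 + sin \<langle>h, \<cdot>\<rangle>\<close> transfers equality of
  characteristic functionals to the restrictions to one-dimensional cylinders, so that the
  one-dimensional uniqueness theorem can be iterated.\<close>

lemma weighted_cylinder_eq:
  fixes M N :: "'a::{real_inner, second_countable_topology} measure" and w :: "'a \<Rightarrow> real"
  assumes fin: "finite_measure M" "finite_measure N" and sets: "sets M = sets borel" "sets N = sets borel"
    and w: "w \<in> borel_measurable borel" "\<And>x. 0 \<le> w x" "\<And>x. w x \<le> B"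
    and eq: "\<And>h. (CLINT x|M. w x *\<^sub>R iexp (h \<bullet> x)) = (CLINT x|N. w x *\<^sub>R iexp (h \<bullet> x))"
    and A: "A \<in> sets borel"
  shows "(LINT x|M. indicator A (k \<bullet> x) * w x) = (LINT x|N. indicator A (k \<bullet> x) * w x)"
proof -
  \<comment> \<open>The image of the weighted measure under k \<bullet> x. Its characteristic
    function at t is the weighted functional of K at t k, so the hypothesis settles all frequencies
    at once.\<close>
  define D where "D K = distr (density K (\<lambda>x. ennreal (w x))) borel (\<lambda>x. k \<bullet> x)" for K :: "'a measure"
  have *: "finite_measure (D K)" "(CLINT x|D K. iexp (t * x)) = (CLINT x|K. w x *\<^sub>R iexp ((t *\<^sub>R k) \<bullet> x))"
    "(LINT x|D K. indicator A x) = (LINT x|K. indicator A (k \<bullet> x) * w x)"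
    if K: "finite_measure K" "sets K = sets borel" for K t
  proof -
    interpret K: finite_measure K by fact
    note [measurable_cong] = K(2) note [measurable] = w(1) A
    have "emeasure (density K (\<lambda>x. ennreal (w x))) (space K) \<le> (\<integral>\<^sup>+x. ennreal B \<partial>K)"
      by (subst emeasure_density) (auto intro!: nn_integral_mono ennreal_leI w simp: indicator_def simp del: nn_integral_const)
    also have "\<dots> < \<infinity>" by (simp add: ennreal_mult_less_top less_top K.emeasure_eq_measure)
    finally have f: "finite_measure (density K (\<lambda>x. ennreal (w x)))" by (intro finite_measureI) auto
    show "finite_measure (D K)" unfolding D_def
      by (rule finite_measure.finite_measure_distr[OF f]) measurable
    show "(CLINT x|D K. iexp (t * x)) = (CLINT x|K. w x *\<^sub>R iexp ((t *\<^sub>R k) \<bullet> x))"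
      unfolding D_def by (subst integral_distr; (subst integral_density)?) (auto simp: w)
    show "(LINT x|D K. indicator A x) = (LINT x|K. indicator A (k \<bullet> x) * w x)"
      unfolding D_def by (subst integral_distr; (subst integral_density)?) (auto simp: w mult.commute)
  qed
  have "D M = D N"
  proof (rule finite_measure_eq_of_char_eq)
    show "(CLINT x|D M. iexp (t * x)) = (CLINT x|D N. iexp (t * x))" for t
      by (simp only: *(2)[OF fin(1) sets(1)] *(2)[OF fin(2) sets(2)] eq)
  qed (use *(1) fin sets in \<open>auto simp: D_def\<close>)
  then show ?thesis using *(3)[OF fin(1) sets(1)] *(3)[OF fin(2) sets(2)] by simp
qed

text \<open>The real and imaginary parts of the functional of the restriction are integrals against
  cos and sin. These weights change sign, so 1 is added to obtain measures, and the contribution of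
  the weight 1 is subtracted afterwards.\<close>

lemma char_eq_restrict_cylinder:
  fixes M N :: "'a::{real_inner, second_countable_topology} measure"
  assumes fin: "finite_measure M" "finite_measure N" and sets: "sets M = sets borel" "sets N = sets borel"
    and eq: "\<And>h. (CLINT x|M. iexp (h \<bullet> x)) = (CLINT x|N. iexp (h \<bullet> x))"
    and A: "A \<in> sets borel"
  shows "(CLINT x|density M (indicator {x. k \<bullet> x \<in> A}). iexp (h \<bullet> x)) =
    (CLINT x|density N (indicator {x. k \<bullet> x \<in> A}). iexp (h \<bullet> x))"
proof -
  have int: "integrable K (\<lambda>x. iexp (g \<bullet> x))" if "finite_measure K" "sets K = sets borel" for K :: "'a measure" and g
    using integrable_bounded_iexp[of K "\<lambda>_. 1" 1 g] that by simp
  have split: "(LINT x|K. indicator A (k \<bullet> x) * (1 + c x)) =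
      (LINT x|K. indicator A (k \<bullet> x)) + (LINT x|K. indicator A (k \<bullet> x) * c x)"
     "integrable K (\<lambda>x. indicator A (k \<bullet> x) * c x)"
    if "finite_measure K" "sets K = sets borel" "c \<in> borel_measurable borel" "\<And>x. \<bar>c x\<bar> \<le> 1"
    for K :: "'a measure" and c :: "'a \<Rightarrow> real"
  proof -
    interpret K: finite_measure K by fact
    note [measurable_cong] = that(2) note [measurable] = that(3) A
    have i: "integrable K (\<lambda>x. indicator A (k \<bullet> x) * c x)" "integrable K (\<lambda>x. indicator A (k \<bullet> x) :: real)"
      by (intro K.integrable_const_bound[of _ 1] AE_I2; use that(4) in \<open>simp add: indicator_def\<close>)+
    show "integrable K (\<lambda>x. indicator A (k \<bullet> x) * c x)" by fact
    show "(LINT x|K. indicator A (k \<bullet> x) * (1 + c x)) =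
      (LINT x|K. indicator A (k \<bullet> x)) + (LINT x|K. indicator A (k \<bullet> x) * c x)"
      using i by (simp add: ring_distribs)
  qed
  have one: "(LINT x|M. indicator A (k \<bullet> x)) = (LINT x|N. indicator A (k \<bullet> x) :: real)"
    using weighted_cylinder_eq[OF fin sets _ _ _ _ A, of "\<lambda>_. 1" 1 k] eq by simp
  \<comment> \<open>A trigonometric weight times a character is a combination of characters at the
    frequencies g, g + h and g - h, where the functionals of M and N are known to agree.\<close>
  have expand: "(1 + cos (h \<bullet> x)) *\<^sub>R iexp (g \<bullet> x) =
       iexp (g \<bullet> x) + (1/2) * iexp ((g + h) \<bullet> x) + (1/2) * iexp ((g - h) \<bullet> x)"
     "(1 + sin (h \<bullet> x)) *\<^sub>R iexp (g \<bullet> x) =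
       iexp (g \<bullet> x) + (- \<i>/2) * iexp ((g + h) \<bullet> x) + (\<i>/2) * iexp ((g - h) \<bullet> x)" for g x
    by (simp_all add: complex_eq_iff Re_exp Im_exp inner_simps cos_add sin_add cos_diff sin_diff field_simps)
  have c: "(LINT x|M. indicator A (k \<bullet> x) * cos (h \<bullet> x)) = (LINT x|N. indicator A (k \<bullet> x) * cos (h \<bullet> x))"
  proof -
    have "(LINT x|M. indicator A (k \<bullet> x) * (1 + cos (h \<bullet> x))) = (LINT x|N. indicator A (k \<bullet> x) * (1 + cos (h \<bullet> x)))"
    proof (rule weighted_cylinder_eq[OF fin sets _ _ _ _ A, of _ 2])
      show "0 \<le> 1 + cos (h \<bullet> x)" for x using cos_ge_minus_one[of "h \<bullet> x"] by linarith
    qed (use fin sets in \<open>simp_all add: expand int eq\<close>)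
    then show ?thesis using one fin sets by (simp add: split)
  qed
  have s: "(LINT x|M. indicator A (k \<bullet> x) * sin (h \<bullet> x)) = (LINT x|N. indicator A (k \<bullet> x) * sin (h \<bullet> x))"
  proof -
    have "(LINT x|M. indicator A (k \<bullet> x) * (1 + sin (h \<bullet> x))) = (LINT x|N. indicator A (k \<bullet> x) * (1 + sin (h \<bullet> x)))"
    proof (rule weighted_cylinder_eq[OF fin sets _ _ _ _ A, of _ 2])
      show "0 \<le> 1 + sin (h \<bullet> x)" for x using sin_ge_minus_one[of "h \<bullet> x"] by linarith
    qed (use fin sets in \<open>simp_all add: expand int eq\<close>)
    then show ?thesis using one fin sets by (simp add: split)
  qed
  have "(CLINT x|density K (indicator {x. k \<bullet> x \<in> A}). iexp (h \<bullet> x)) =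
      complex_of_real (LINT x|K. indicator A (k \<bullet> x) * cos (h \<bullet> x)) +
      \<i> * complex_of_real (LINT x|K. indicator A (k \<bullet> x) * sin (h \<bullet> x))"
    if K: "finite_measure K" "sets K = sets borel" for K :: "'a measure"
  proof -
    note [measurable_cong] = K(2) note [measurable] = A
    have "(CLINT x|density K (\<lambda>x. ennreal (indicator {x. k \<bullet> x \<in> A} x)). iexp (h \<bullet> x)) =
      (CLINT x|K. indicator {x. k \<bullet> x \<in> A} x *\<^sub>R iexp (h \<bullet> x))"
      by (subst integral_density) auto
    also have "\<dots> = (CLINT x|K. of_real (indicator A (k \<bullet> x) * cos (h \<bullet> x)) + \<i> * of_real (indicator A (k \<bullet> x) * sin (h \<bullet> x)))"
      by (intro Bochner_Integration.integral_cong) (auto simp: complex_eq_iff Re_exp Im_exp indicator_def)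
    also have "\<dots> = (CLINT x|K. of_real (indicator A (k \<bullet> x) * cos (h \<bullet> x))) +
        (CLINT x|K. \<i> * of_real (indicator A (k \<bullet> x) * sin (h \<bullet> x)))"
      using split(2)[OF K, of "\<lambda>x. cos (h \<bullet> x)"] split(2)[OF K, of "\<lambda>x. sin (h \<bullet> x)"]
      by (intro Bochner_Integration.integral_add) (auto simp del: of_real_mult intro: integrable_of_real)
    finally show ?thesis by (simp add: ennreal_indicator del: of_real_mult)
  qed
  then show ?thesis using fin sets c s by simp
qed

section \<open>Cylinder sets as an intersection-stable generator of the Borel sets\<close>

definition cylinder :: "('a::real_inner \<times> real set) list \<Rightarrow> 'a set" where
  "cylinder l = {x. \<forall>(k, A)\<in>set l. k \<bullet> x \<in> A}"

lemma sets_cylinder: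
  fixes l :: "('a::{real_inner, second_countable_topology} \<times> real set) list"
  assumes "\<forall>(k, A)\<in>set l. A \<in> sets borel" shows "cylinder l \<in> sets borel"
  using assms
proof (induction l)
  case (Cons p l)
  obtain k A where p: "p = (k, A)" by force
  with Cons have [measurable]: "cylinder l \<in> sets borel" "A \<in> sets borel" by auto
  have "cylinder (p # l) = ((\<lambda>x. k \<bullet> x) -` A \<inter> space borel) \<inter> cylinder l"
    by (auto simp: cylinder_def p)
  also have "\<dots> \<in> sets borel" by measurable
  finally show ?case .
qed (simp add: cylinder_def)

text \<open>The induction absorbs the head constraint into both measures as an indicator density.
  The restricted measures again have equal characteristic functionals, which is why M and N must
  stay arbitrary.\<close>

lemma char_eq_imp_cylinder_eq:
  fixes M N :: "'a::{real_inner, second_countable_topology} measure"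
  assumes "finite_measure M" "finite_measure N" "sets M = sets borel" "sets N = sets borel"
    and "\<And>h. (CLINT x|M. iexp (h \<bullet> x)) = (CLINT x|N. iexp (h \<bullet> x))"
    and "\<forall>(k, A)\<in>set l. A \<in> sets borel"
  shows "emeasure M (cylinder l) = emeasure N (cylinder l)"
  using assms
proof (induction l arbitrary: M N)
  case Nil
  interpret M: finite_measure M by fact
  interpret N: finite_measure N by fact
  have "space M = UNIV" "space N = UNIV" using Nil(3,4)[THEN sets_eq_imp_space_eq] by auto
  then show ?case using Nil(5)[of 0]
    by (simp add: cylinder_def M.emeasure_eq_measure N.emeasure_eq_measure)
next
  case (Cons p l)
  obtain k A where p: "p = (k, A)" by force
  with Cons have A [measurable]: "A \<in> sets borel" and l: "\<forall>(k, A)\<in>set l. A \<in> sets borel" by auto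
  let ?D = "\<lambda>M. density M (indicator {x. k \<bullet> x \<in> A})"
  have D: "finite_measure (?D K)" "emeasure (?D K) (cylinder l) = emeasure K (cylinder (p # l))"
    if "finite_measure K" "sets K = sets borel" for K
  proof -
    interpret K: finite_measure K by fact
    note [measurable_cong] = that(2)
    have m: "{x. k \<bullet> x \<in> A} \<in> sets K"
      using measurable_sets[of "\<lambda>x. k \<bullet> x" borel borel A] that by (simp add: vimage_def)
    then show "finite_measure (?D K)"
      by (intro finite_measureI) (auto simp: emeasure_restricted[OF m] K.emeasure_eq_measure)
    show "emeasure (?D K) (cylinder l) = emeasure K (cylinder (p # l))"
      using sets_cylinder[OF l] that m
      by (subst emeasure_restricted) (auto simp: cylinder_def p intro!: arg_cong[where f="emeasure K"])
  qed
  have "emeasure (?D M) (cylinder l) = emeasure (?D N) (cylinder l)"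
    by (rule Cons.IH) (use Cons.prems D l A in \<open>auto intro!: char_eq_restrict_cylinder\<close>)
  then show ?case using D Cons.prems by simp
qed

text \<open>Separability makes countably many directions sufficient: closed balls are countable
  intersections of half-spaces, and open sets are countable unions of closed balls.\<close>

lemma sigma_sets_cylinder:
  "sigma_sets UNIV {cylinder l | l. \<forall>(k, A)\<in>set l. A \<in> sets borel} =
    sets (borel :: 'a::{real_inner, second_countable_topology} measure)" (is "sigma_sets UNIV ?G = _")
proof (rule antisym)
  show "sigma_sets UNIV ?G \<subseteq> sets borel"
    using sets.sigma_sets_subset[of ?G "borel :: 'a measure"] sets_cylinder by auto
  obtain D :: "'a set" where D: "countable D" "\<And>X. open X \<Longrightarrow> X \<noteq> {} \<Longrightarrow> \<exists>d\<in>D. d \<in> X"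
    by (rule countable_dense_setE) blast
  interpret s: sigma_algebra UNIV "sigma_sets UNIV ?G" by (rule sigma_algebra_sigma_sets) simp
  have cb: "cball c q \<in> sigma_sets UNIV ?G" if "q \<ge> 0" for c :: 'a and q
  proof -
    \<comment> \<open>One inclusion is Cauchy-Schwarz. For the other, the directions violating the
      half-space bound form an open set that misses the dense set D, so there are none; the
      direction x - c then gives the norm bound.\<close>
    have "cball c q = (\<Inter>k\<in>D. {x. k \<bullet> x \<in> {..k \<bullet> c + q * norm k}})"
    proof (intro equalityI subsetI INT_I CollectI)
      fix x k assume "x \<in> cball c q"
      then have "norm (x - c) \<le> q" by (simp add: dist_norm norm_minus_commute)
      moreover have "k \<bullet> (x - c) \<le> norm k * norm (x - c)" by (rule norm_cauchy_schwarz)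
      ultimately show "k \<bullet> x \<in> {..k \<bullet> c + q * norm k}"
        using mult_left_mono[of "norm (x - c)" q "norm k"] by (simp add: inner_diff mult.commute)
    next
      fix x assume x: "x \<in> (\<Inter>k\<in>D. {x. k \<bullet> x \<in> {..k \<bullet> c + q * norm k}})"
      let ?U = "{k. k \<bullet> (x - c) > q * norm k}"
      have "open ?U" by (intro open_Collect_less continuous_intros)
      then have "?U = {}" using D(2)[of ?U] x by (force simp: inner_diff)
      then have "(x - c) \<bullet> (x - c) \<le> q * norm (x - c)" by (auto simp: not_less)
      then have "norm (x - c) * norm (x - c) \<le> q * norm (x - c)" by (simp add: dot_square_norm power2_eq_square)
      then have "norm (x - c) \<le> q" using that by (cases "x = c") auto
      then show "x \<in> cball c q" by (simp add: dist_norm norm_minus_commute)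
    qed
    also have "\<dots> \<in> sigma_sets UNIV ?G"
    proof (cases "D = {}")
      case False
      have "{x. k \<bullet> x \<in> {..s}} = cylinder [(k, {..s})]" for k :: 'a and s by (auto simp: cylinder_def)
      then show ?thesis using D(1) False
        by (intro s.countable_INT'') (auto intro!: sigma_sets.Basic exI)
    qed (use sigma_sets_top in auto)
    finally show ?thesis .
  qed
  have "U \<in> sigma_sets UNIV ?G" if "open U" for U :: "'a set"
  proof -
    let ?I = "{(c, q). c \<in> D \<and> q \<in> \<rat> \<and> 0 \<le> q \<and> cball c q \<subseteq> U}"
    have "countable ?I"
      by (rule countable_subset[of _ "D \<times> \<rat>"]) (use D(1) countable_rat in auto)
    have "U = (\<Union>(c, q)\<in>?I. cball c q)"
    proof safe
      fix x assume "x \<in> U"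
      then obtain e where e: "e > 0" "ball x e \<subseteq> U" using \<open>open U\<close> by (auto simp: open_contains_ball)
      \<comment> \<open>The centre d is within e/3 of x, so a radius above e/3 covers x, and a
        radius below e/2 keeps the ball inside \<open>ball x e\<close>, since e/3 + e/2 < e.\<close>
      obtain d where d: "d \<in> D" "d \<in> ball x (e/3)" using D(2)[of "ball x (e/3)"] e by auto
      obtain q where q: "q \<in> \<rat>" "e/3 < q" "q < e/2" using Rats_dense_in_real[of "e/3" "e/2"] e by auto
      have "cball d q \<subseteq> ball x e"
      proof
        fix y assume "y \<in> cball d q"
        then show "y \<in> ball x e" using d q e dist_triangle[of x y d] by auto
      qed
      then have "(d, q) \<in> ?I" "x \<in> cball d q" using d q e by (auto simp: dist_commute)
      then show "x \<in> (\<Union>(c, q)\<in>?I. cball c q)" by blast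
    qed auto
    also have "\<dots> \<in> sigma_sets UNIV ?G"
      by (intro s.countable_UN'') (use \<open>countable ?I\<close> cb in auto)
    finally show ?thesis .
  qed
  then have "sigma_sets UNIV {U :: 'a set. open U} \<subseteq> sigma_sets UNIV ?G"
    by (intro s.sigma_sets_subset) auto
  then show "sets borel \<subseteq> sigma_sets UNIV ?G" by (simp only: sets_borel)
qed

lemma finite_measure_eqI_char_functional:
  fixes M N :: "'a::{real_inner, second_countable_topology} measure"
  assumes fin: "finite_measure M" "finite_measure N" and sets: "sets M = sets borel" "sets N = sets borel"
    and eq: "\<And>h. (CLINT x|M. iexp (h \<bullet> x)) = (CLINT x|N. iexp (h \<bullet> x))"
  shows "M = N"
proof (rule measure_eqI_generator_eq[where A="\<lambda>_. UNIV" and \<Omega>=UNIV])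
  let ?G = "{cylinder l | l. \<forall>(k, A)\<in>set l. A \<in> sets borel} :: 'a set set"
  show "Int_stable ?G"
  proof (rule Int_stableI)
    fix a b assume "a \<in> ?G" "b \<in> ?G"
    then obtain l l' where "a = cylinder l" "b = cylinder l'"
      "\<forall>(k, A)\<in>set l. A \<in> sets borel" "\<forall>(k, A)\<in>set l'. A \<in> sets borel" by auto
    moreover have "cylinder l \<inter> cylinder l' = cylinder (l @ l')" by (auto simp: cylinder_def)
    ultimately show "a \<inter> b \<in> ?G" by (intro CollectI exI[of _ "l @ l'"]) auto
  qed
  show "emeasure M X = emeasure N X" if "X \<in> ?G" for X
    using that char_eq_imp_cylinder_eq[OF fin sets eq] by auto
  show "range (\<lambda>_. UNIV) \<subseteq> ?G" by (auto simp: cylinder_def intro!: exI[of _ "[]"])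
  show "emeasure M UNIV \<noteq> \<infinity>" by (simp add: finite_measure.emeasure_finite[OF fin(1)])
qed (simp_all add: sets sigma_sets_cylinder)

section \<open>Rotation invariance of the product of two centred Gaussian measures\<close>

lemma char_functional_pair:
  fixes M :: "'a::{real_inner, second_countable_topology} measure"
  assumes "prob_space M" "sets M = sets borel"
  shows "(CLINT y|M \<Otimes>\<^sub>M M. iexp (h \<bullet> fst y + k \<bullet> snd y)) =
     (CLINT x|M. iexp (h \<bullet> x)) * (CLINT x|M. iexp (k \<bullet> x))"
proof -
  interpret M: prob_space M by fact
  interpret MM: pair_prob_space M M ..
  note [measurable_cong] = assms(2)
  have "integrable (M \<Otimes>\<^sub>M M) (\<lambda>y. iexp (h \<bullet> fst y + k \<bullet> snd y))"
    by (rule MM.integrable_const_bound[of _ 1]) auto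
  then have "(CLINT y|M \<Otimes>\<^sub>M M. iexp (h \<bullet> fst y + k \<bullet> snd y)) =
      (CLINT x|M. CLINT w|M. iexp (h \<bullet> x + k \<bullet> w))"
    by (subst MM.integral_fst'[symmetric]) auto
  also have "\<dots> = (CLINT x|M. CLINT w|M. iexp (h \<bullet> x) * iexp (k \<bullet> w))"
    by (simp add: ring_distribs exp_add)
  finally show ?thesis by simp
qed

text \<open>The second component is the derivative in \<theta> of the first. The new pair therefore
  spans the same ellipse, with the origin of the angle moved to \<theta>.\<close>

definition pair_rotation :: "real \<Rightarrow> 'a::real_vector \<times> 'a \<Rightarrow> 'a \<times> 'a" where
  "pair_rotation \<theta> y =
     (cos \<theta> *\<^sub>R fst y + sin \<theta> *\<^sub>R snd y, - sin \<theta> *\<^sub>R fst y + cos \<theta> *\<^sub>R snd y)"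

text \<open>Moving the rotation onto the frequencies (h, k) rotates them, and the exponent of the
  product functional is a multiple of \<open>C h \<bullet> h + C k \<bullet> k\<close>, which such a
  rotation preserves.\<close>

lemma distr_pair_rotation_gaussian:
  fixes C :: "'a::{real_inner, polish_space} \<Rightarrow> 'a"
  assumes C: "nonsingular_covariance_operator C" and M: "centered_gaussian C M"
  shows "distr (M \<Otimes>\<^sub>M M) (M \<Otimes>\<^sub>M M) (pair_rotation \<theta>) = M \<Otimes>\<^sub>M M"
proof -
  interpret M: prob_space M using M by (simp add: centered_gaussian_def)
  interpret MM: pair_prob_space M M ..
  have sM [measurable_cong]: "sets M = sets borel" using M by (simp add: centered_gaussian_def)
  have sMM: "sets (M \<Otimes>\<^sub>M M) = sets borel"
    using sets_pair_measure_cong[OF sM sM] by (simp only: borel_prod)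
  have ch: "(CLINT x|M. iexp (h \<bullet> x)) = complex_of_real (exp (- (C h \<bullet> h) / 2))" for h
    using M by (simp add: centered_gaussian_def)
  have [measurable]: "pair_rotation \<theta> \<in> measurable (M \<Otimes>\<^sub>M M) (M \<Otimes>\<^sub>M M)"
    unfolding pair_rotation_def by measurable
  interpret C: bounded_linear C using C by (simp add: nonsingular_covariance_operator_def)
  \<comment> \<open>The mixed terms of the two quadratic forms carry opposite signs and
    cancel.\<close>
  have quad: "C (c *\<^sub>R h - s *\<^sub>R k) \<bullet> (c *\<^sub>R h - s *\<^sub>R k) + C (s *\<^sub>R h + c *\<^sub>R k) \<bullet> (s *\<^sub>R h + c *\<^sub>R k)
      = C h \<bullet> h + C k \<bullet> k" if "c\<^sup>2 + s\<^sup>2 = 1" for c s h k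
  proof -
    have "C (c *\<^sub>R h - s *\<^sub>R k) \<bullet> (c *\<^sub>R h - s *\<^sub>R k) + C (s *\<^sub>R h + c *\<^sub>R k) \<bullet> (s *\<^sub>R h + c *\<^sub>R k)
      = (c\<^sup>2 + s\<^sup>2) * (C h \<bullet> h) + (c\<^sup>2 + s\<^sup>2) * (C k \<bullet> k)"
      by (simp add: C.add C.diff C.scaleR inner_simps algebra_simps power2_eq_square)
    then show ?thesis using that by simp
  qed
  show ?thesis
  proof (rule finite_measure_eqI_char_functional)
    show "finite_measure (distr (M \<Otimes>\<^sub>M M) (M \<Otimes>\<^sub>M M) (pair_rotation \<theta>))"
      by (rule MM.finite_measure_distr) measurable
    show "finite_measure (M \<Otimes>\<^sub>M M)" by (rule MM.finite_measure_axioms)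
    fix v :: "'a \<times> 'a"
    obtain h k where v: "v = (h, k)" by force
    have "(CLINT y|distr (M \<Otimes>\<^sub>M M) (M \<Otimes>\<^sub>M M) (pair_rotation \<theta>). iexp (v \<bullet> y)) =
        (CLINT y|M \<Otimes>\<^sub>M M. iexp (v \<bullet> pair_rotation \<theta> y))"
      by (rule integral_distr) (simp_all add: v inner_prod_def)
    also have "\<dots> = (CLINT y|M \<Otimes>\<^sub>M M. iexp ((cos \<theta> *\<^sub>R h - sin \<theta> *\<^sub>R k) \<bullet> fst y + (sin \<theta> *\<^sub>R h + cos \<theta> *\<^sub>R k) \<bullet> snd y))"
      by (simp add: v pair_rotation_def inner_prod_def inner_simps algebra_simps)
    also have "\<dots> = complex_of_real (exp (- (C h \<bullet> h) / 2) * exp (- (C k \<bullet> k) / 2))"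
      using quad[of "cos \<theta>" "sin \<theta>" h k]
      by (simp only: char_functional_pair[OF M.prob_space_axioms sM] ch of_real_mult[symmetric] exp_add[symmetric])
         (simp add: algebra_simps add_divide_distrib[symmetric] del: exp_add)
    also have "\<dots> = (CLINT y|M \<Otimes>\<^sub>M M. iexp (v \<bullet> y))"
      using char_functional_pair[OF M.prob_space_axioms sM, of h k]
      by (simp add: v inner_prod_def ch)
    finally show "(CLINT y|distr (M \<Otimes>\<^sub>M M) (M \<Otimes>\<^sub>M M) (pair_rotation \<theta>). iexp (v \<bullet> y)) =
      (CLINT y|M \<Otimes>\<^sub>M M. iexp (v \<bullet> y))" .
  qed (simp_all add: sMM)
qed

section \<open>The law of the shrinkage chain\<close>

text \<open>The transition operator of the chain killed on S: a state whose proposal already lies in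
  S contributes nothing further. Its n-th power records n successive misses.\<close>

definition killed_step ::
    "real set \<Rightarrow> real \<Rightarrow> (real \<times> real \<times> real \<Rightarrow> ennreal) \<Rightarrow> real \<times> real \<times> real \<Rightarrow> ennreal" where
  "killed_step S \<theta> g z = indicator (- S) (fst z) * (\<integral>\<^sup>+y. g y \<partial>shrink_kernel \<theta> z)"

lemma measurable_fst_triple [measurable]:
  "fst \<in> measurable (borel :: (real \<times> real \<times> real) measure) borel"
  by (simp add: borel_prod[symmetric])

lemma measurable_killed_step:
  assumes [measurable]: "S \<in> sets borel" "g \<in> borel_measurable borel"
  shows "killed_step S \<theta> g \<in> borel_measurable borel"
proof -
  have "(\<lambda>z. \<integral>\<^sup>+y. g y \<partial>shrink_kernel \<theta> z) \<in> borel_measurable borel"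
    by (rule nn_integral_measurable_subprob_algebra2[OF _ measurable_shrink_kernel]) measurable
  then show ?thesis unfolding killed_step_def[abs_def] by measurable
qed

text \<open>Integrating out the last coordinate replaces g by
  \<open>killed_step S \<theta> g\<close> and shortens the path by one. The induction on n therefore
  has to let g vary.\<close>

lemma nn_integral_shrink_chain:
  assumes S [measurable]: "S \<in> sets borel" and g: "g \<in> borel_measurable borel"
  shows "(\<integral>\<^sup>+z. (\<Prod>k<n. indicator (- S) (fst (z k))) * g (z n) \<partial>shrink_chain \<theta>) =
    (\<integral>\<^sup>+z. (killed_step S \<theta> ^^ n) g z \<partial>shrink_init)"
proof -
  interpret IT: Ionescu_Tulcea "shrink_step \<theta>" "\<lambda>_. borel"
    by (rule Ionescu_Tulcea_shrink_step)
  let ?M = "\<lambda>n. PiM {0..<n} (\<lambda>_. borel :: (real \<times> real \<times> real) measure)"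
  let ?C = "\<lambda>n. IT.C 0 n (\<lambda>_. undefined)"
  let ?F = "\<lambda>n g z. (\<Prod>k<n. indicator (- S) (fst (z k))) * (g (z n) :: ennreal)"
  \<comment> \<open>The default \<open>undefined\<close> is forced here: this function is the only
    point of the product over the empty index set, the empty history from which the kernels are
    iterated.\<close>
  have u: "(\<lambda>_. undefined) \<in> space (?M 0)" by (auto simp: space_PiM PiE_def extensional_def)
  have sp: "v \<in> space (?C n) \<Longrightarrow> v \<in> space (?M n)" for v n using IT.space_C[OF u, of n] by simp
  have CI: "IT.CI {0..<n} = ?C n" for n
  proof (rule measure_eqI)
    show s: "sets (IT.CI {0..<n}) = sets (?C n)" using IT.sets_C[OF u, of n] by (simp add: IT.CI_def)
    fix X assume "X \<in> sets (IT.CI {0..<n})"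
    then have X: "X \<in> sets (?M n)" by (simp add: IT.CI_def)
    have "prod_emb {0..<n} (\<lambda>_. borel) {0..<n} X = X"
      using sets.sets_into_space[OF X] by (intro prod_emb_id) (simp add: space_PiM)
    then show "emeasure (IT.CI {0..<n}) X = emeasure (?C n) X"
      using IT.emeasure_CI[OF order_refl X] by simp
  qed
  have Fm: "?F n g \<in> borel_measurable (?M (Suc n))" if [measurable]: "g \<in> borel_measurable borel" for n g
  proof -
    have [measurable]: "(\<lambda>z. z k) \<in> measurable (?M (Suc n)) borel" if "k \<le> n" for k
      using that by (intro measurable_component_singleton) auto
    have [measurable]: "(\<lambda>z. fst (z k)) \<in> borel_measurable (?M (Suc n))" if "k \<le> n" for k
      using that by measurable
    have ind: "(\<lambda>y. indicator (- S) y :: ennreal) \<in> borel_measurable borel" by measurable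
    have "(\<lambda>z. indicator (- S) (fst (z k)) :: ennreal) \<in> borel_measurable (?M (Suc n))" if "k < n" for k
      using that by (intro measurable_compose[OF _ ind]) auto
    then have "(\<lambda>z. \<Prod>k<n. indicator (- S) (fst (z k)) :: ennreal) \<in> borel_measurable (?M (Suc n))"
      by (intro borel_measurable_prod_ennreal) auto
    moreover have "(\<lambda>z. g (z n)) \<in> borel_measurable (?M (Suc n))"
      by (rule measurable_compose[OF _ that]) simp
    ultimately show ?thesis by measurable
  qed
  have step: "(\<integral>\<^sup>+z. f z \<partial>(?C (Suc n))) = (\<integral>\<^sup>+v. (\<integral>\<^sup>+x. f (v(n := x)) \<partial>shrink_step \<theta> n v) \<partial>(?C n))"
    if "f \<in> borel_measurable (?M (Suc n))" for f n
  proof -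
    have "(\<integral>\<^sup>+z. f z \<partial>(?C (Suc n))) = (\<integral>\<^sup>+v. (\<integral>\<^sup>+z. f z \<partial>IT.eP n v) \<partial>(?C n))"
      using that IT.sets_C[OF u, of n] by (auto intro!: nn_integral_bind[where B="?M (Suc n)"] cong: measurable_cong_sets)
    then show ?thesis using that by (auto intro!: nn_integral_cong IT.nn_integral_eP dest!: sp)
  qed
  have main: "(\<integral>\<^sup>+z. ?F n g z \<partial>(?C (Suc n))) = (\<integral>\<^sup>+z. (killed_step S \<theta> ^^ n) g z \<partial>shrink_init)"
    if "g \<in> borel_measurable borel" for g n using that
  proof (induction n arbitrary: g)
    case 0
    have "(\<integral>\<^sup>+z. ?F 0 g z \<partial>(?C (Suc 0))) =
        (\<integral>\<^sup>+v. (\<integral>\<^sup>+x. ?F 0 g (v(0 := x)) \<partial>shrink_step \<theta> 0 v) \<partial>(?C 0))"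
      by (rule step[OF Fm[OF 0]])
    also have "\<dots> = (\<integral>\<^sup>+z. g z \<partial>shrink_init)"
      by (simp add: shrink_step_def nn_integral_return u)
    finally show ?case by simp
  next
    case (Suc n)
    have "(\<integral>\<^sup>+z. ?F (Suc n) g z \<partial>(?C (Suc (Suc n)))) =
        (\<integral>\<^sup>+v. (\<integral>\<^sup>+x. ?F (Suc n) g (v(Suc n := x)) \<partial>shrink_step \<theta> (Suc n) v) \<partial>(?C (Suc n)))"
      by (rule step[OF Fm[OF Suc.prems]])
    also have "\<dots> = (\<integral>\<^sup>+v. ?F n (killed_step S \<theta> g) v \<partial>(?C (Suc n)))"
    proof (intro nn_integral_cong)
      fix v
      have "(\<integral>\<^sup>+x. ?F (Suc n) g (v(Suc n := x)) \<partial>shrink_step \<theta> (Suc n) v) =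
          (\<integral>\<^sup>+x. (\<Prod>k<Suc n. indicator (- S) (fst (v k))) * g x \<partial>shrink_kernel \<theta> (v n))"
        unfolding shrink_step_def by (auto intro!: nn_integral_cong prod.cong arg_cong2[where f="(*)"])
      also have "\<dots> = (\<Prod>k<Suc n. indicator (- S) (fst (v k))) * (\<integral>\<^sup>+x. g x \<partial>shrink_kernel \<theta> (v n))"
        using Suc.prems by (intro nn_integral_cmult) (simp add: measurable_cong_sets[OF sets_shrink_kernel refl])
      finally show "(\<integral>\<^sup>+x. ?F (Suc n) g (v(Suc n := x)) \<partial>shrink_step \<theta> (Suc n) v) =
          ?F n (killed_step S \<theta> g) v"
        by (simp add: killed_step_def mult.assoc)
    qed
    also have "\<dots> = (\<integral>\<^sup>+z. (killed_step S \<theta> ^^ n) (killed_step S \<theta> g) z \<partial>shrink_init)"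
      by (rule Suc.IH[OF measurable_killed_step[OF S Suc.prems]])
    finally show ?case by (simp only: funpow_Suc_right o_apply)
  qed
  have "(\<integral>\<^sup>+z. ?F n g z \<partial>shrink_chain \<theta>) = (\<integral>\<^sup>+z. ?F n g (restrict z {0..<Suc n}) \<partial>shrink_chain \<theta>)"
    \<comment> \<open>The integrand sees the coordinates 0 to n only, so the law of the whole
      trajectory may be replaced by its marginal on the first n + 1 coordinates.\<close>
    by (intro nn_integral_cong) (simp add: restrict_def)
  also have "\<dots> = (\<integral>\<^sup>+z. ?F n g z \<partial>distr (shrink_chain \<theta>) (?M (Suc n)) (\<lambda>z. restrict z {0..<Suc n}))"
  proof (rule nn_integral_distr[symmetric])
    show "(\<lambda>z. restrict z {0..<Suc n}) \<in> measurable (shrink_chain \<theta>) (?M (Suc n))"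
      unfolding measurable_cong_sets[OF sets_shrink_chain refl] by (rule measurable_restrict_subset) simp
  qed (simp add: Fm[OF g])
  also have "distr (shrink_chain \<theta>) (?M (Suc n)) (\<lambda>z. restrict z {0..<Suc n}) = ?C (Suc n)"
    using IT.distr_lim[of "{0..<Suc n}"] unfolding shrink_chain_def CI by simp
  finally show ?thesis using main[OF g] by simp
qed

section \<open>The expectation at the first hit as a recursion over intervals\<close>

definition shrink_avg :: "real \<Rightarrow> real \<Rightarrow> (real \<Rightarrow> ennreal) \<Rightarrow> ennreal" where
  "shrink_avg a b \<phi> = (\<integral>\<^sup>+\<gamma>\<in>gen_interval a b. \<phi> \<gamma> \<partial>lborel) / emeasure lborel (gen_interval a b)"

text \<open>\<open>shrink_value n S h a b \<theta>\<close> is the expectation of \<open>h\<close> at the first hit of \<open>S\<close>, restricted to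
  exactly \<open>n\<close> preceding misses, when the next proposal is uniform on \<open>gen_interval a b\<close>.\<close>

primrec shrink_value ::
    "nat \<Rightarrow> real set \<Rightarrow> (real \<Rightarrow> ennreal) \<Rightarrow> real \<Rightarrow> real \<Rightarrow> real \<Rightarrow> ennreal" where
  "shrink_value 0 S h a b \<theta> = shrink_avg a b (\<lambda>\<gamma>. indicator S \<gamma> * h \<gamma>)"
| "shrink_value (Suc n) S h a b \<theta> = shrink_avg a b (\<lambda>\<gamma>. indicator (- S) \<gamma> *
     (if \<gamma> \<in> gen_interval0 a \<theta> then shrink_value n S h \<gamma> b \<theta> else shrink_value n S h a \<gamma> \<theta>))"

lemma shrink_avg_cong:
  "(\<And>\<gamma>. \<gamma> \<in> gen_interval a b \<Longrightarrow> \<phi> \<gamma> = \<psi> \<gamma>) \<Longrightarrow> shrink_avg a b \<phi> = shrink_avg a b \<psi>"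
  unfolding shrink_avg_def
  by (intro arg_cong2[where f="(/)"] nn_integral_cong refl) (simp split: split_indicator)

lemma nn_integral_shrink_component:
  assumes "u \<in> borel_measurable borel"
  shows "(\<integral>\<^sup>+y. u y \<partial>(uniform_measure lborel (gen_interval a b) \<Otimes>\<^sub>M return borel c)) =
    shrink_avg a b (\<lambda>\<gamma>. u (\<gamma>, c :: real \<times> real))"
proof -
  interpret B: prob_space "return borel c" by (rule prob_space_return) simp
  have s: "sets (uniform_measure lborel (gen_interval a b) \<Otimes>\<^sub>M return borel c) = sets borel"
    by (auto simp: borel_prod[symmetric] intro!: sets_pair_measure_cong)
  have m: "u \<in> borel_measurable (uniform_measure lborel (gen_interval a b) \<Otimes>\<^sub>M return borel c)"
    using assms by (simp add: measurable_cong_sets[OF s refl])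
  have [measurable]: "(\<lambda>y. u (x, y)) \<in> borel_measurable borel" for x
    using assms by (intro measurable_compose[OF _ assms]) (simp add: borel_prod[symmetric])
  have "(\<lambda>x::real. (x, c)) \<in> measurable borel (borel \<Otimes>\<^sub>M (borel :: (real \<times> real) measure))" by measurable
  then have "(\<lambda>x::real. (x, c)) \<in> measurable borel borel" by (simp only: borel_prod)
  from measurable_compose[OF this assms] have [measurable]: "(\<lambda>x. u (x, c)) \<in> borel_measurable borel" .
  have "(\<integral>\<^sup>+y. u y \<partial>(uniform_measure lborel (gen_interval a b) \<Otimes>\<^sub>M return borel c)) =
      (\<integral>\<^sup>+x. u (x, c) \<partial>uniform_measure lborel (gen_interval a b))"
    by (subst B.nn_integral_fst[symmetric, OF m]) (simp add: nn_integral_return)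
  also have "\<dots> = shrink_avg a b (\<lambda>\<gamma>. u (\<gamma>, c))"
    unfolding shrink_avg_def by (subst nn_integral_uniform_measure) auto
  finally show ?thesis .
qed

lemma nn_integral_shrink_kernel:
  assumes u: "u \<in> borel_measurable borel" and z: "(\<gamma>, a, b) \<in> shrink_states \<theta>"
  shows "(\<integral>\<^sup>+y. u y \<partial>shrink_kernel \<theta> (\<gamma>, a, b)) =
    (if \<gamma> \<in> gen_interval0 a \<theta> then shrink_avg \<gamma> b (\<lambda>y. u (y, \<gamma>, b)) else shrink_avg a \<gamma> (\<lambda>y. u (y, a, \<gamma>)))"
  unfolding shrink_kernel_eq[OF z]
  by (auto simp: nn_integral_shrink_component[OF u] gen_interval0_def)

context
  fixes S :: "real set" and h :: "real \<Rightarrow> ennreal" and \<theta> :: real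
  assumes S [measurable]: "S \<in> sets borel" and h [measurable]: "h \<in> borel_measurable borel" and \<theta>: "\<theta> \<in> S" "\<theta> \<in> {0..<2 * pi}"
begin

private abbreviation u where
  "u n \<equiv> (killed_step S \<theta> ^^ n) (\<lambda>z. indicator S (fst z) * h (fst z))"

private lemma measurable_u: "u n \<in> borel_measurable borel"
proof (induction n)
  case 0
  have "(\<lambda>y. indicator S y * h y) \<in> borel_measurable borel" by measurable
  from measurable_compose[OF measurable_fst_triple this] show ?case by simp
qed (simp add: measurable_killed_step[OF S])

text \<open>A state carries a proposal together with the interval from which it was drawn. Averaging
  over the proposal leaves a recursion in the interval alone. Since \<theta> lies in S, a missed
  proposal differs from \<theta>, and so the state belongs to
  \<open>shrink_states \<theta>\<close>.\<close>

lemma shrink_avg_killed_step: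
  assumes "a \<in> {0..<2 * pi}" "b \<in> {0..<2 * pi}" "\<theta> \<in> gen_interval a b"
  shows "shrink_avg a b (\<lambda>\<gamma>. u n (\<gamma>, a, b)) = shrink_value n S h a b \<theta>"
  using assms
proof (induction n arbitrary: a b)
  case 0 then show ?case by simp
next
  case (Suc n)
  have "u (Suc n) (\<gamma>, a, b) = indicator (- S) \<gamma> *
     (if \<gamma> \<in> gen_interval0 a \<theta> then shrink_value n S h \<gamma> b \<theta> else shrink_value n S h a \<gamma> \<theta>)"
    if g: "\<gamma> \<in> gen_interval a b" for \<gamma>
  proof (cases "\<gamma> \<in> S")
    case False
    have gT: "\<gamma> \<in> {0..<2*pi}" using g Suc.prems by (auto simp: gen_interval_def split: if_splits)
    have z: "(\<gamma>, a, b) \<in> shrink_states \<theta>"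
      using g gT Suc.prems \<theta> False by (auto simp: shrink_states_def)
    \<comment> \<open>The invariant of the recursion: whichever piece is kept after the cut at
      \<gamma>, it still contains \<theta>.\<close>
    have 1: "\<theta> \<in> gen_interval \<gamma> b" if "\<gamma> \<in> gen_interval0 a \<theta>"
      using that g gT Suc.prems \<theta> by (auto simp: gen_interval_def gen_interval0_def split: if_splits)
    have 2: "\<theta> \<in> gen_interval a \<gamma>" if "\<gamma> \<notin> gen_interval0 a \<theta>"
    proof -
      have "\<gamma> \<noteq> \<theta>" using False \<theta> by auto
      then show ?thesis
        using that g gT Suc.prems \<theta> by (auto simp: gen_interval_def gen_interval0_def split: if_splits)
    qed
    show ?thesis
      using 1 2 Suc.IH[of \<gamma> b] Suc.IH[of a \<gamma>] gT Suc.prems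
      by (simp add: killed_step_def[of S \<theta> "u n"] nn_integral_shrink_kernel[OF measurable_u z])
  qed (simp add: killed_step_def)
  then show ?case unfolding shrink_value.simps by (rule shrink_avg_cong)
qed

text \<open>The first proposal is special because it serves as both of its own endpoints. A miss at
  \<gamma> cuts the circle open there without shortening it, and the next proposal is uniform on
  \<open>gen_interval \<gamma> \<gamma>\<close>, the full circle. Hence the recursion starts only
  after the first miss.\<close>

lemma nn_integral_shrink_init_killed_step:
  "(\<integral>\<^sup>+z. u 0 z \<partial>shrink_init) = (\<integral>\<^sup>+\<gamma>\<in>{0..<2*pi}. indicator S \<gamma> * h \<gamma> \<partial>lborel) / ennreal (2 * pi)"
  "(\<integral>\<^sup>+z. u (Suc n) z \<partial>shrink_init) =
    (\<integral>\<^sup>+\<gamma>\<in>{0..<2*pi}. indicator (- S) \<gamma> * shrink_value n S h \<gamma> \<gamma> \<theta> \<partial>lborel) / ennreal (2 * pi)"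
proof -
  have [measurable]: "(\<lambda>\<gamma>::real. (\<gamma>, \<gamma>, \<gamma>)) \<in> measurable borel borel"
    by (simp add: borel_prod[symmetric])
  have *: "(\<integral>\<^sup>+z. u n z \<partial>shrink_init) = (\<integral>\<^sup>+\<gamma>\<in>{0..<2*pi}. u n (\<gamma>, \<gamma>, \<gamma>) \<partial>lborel) / ennreal (2 * pi)" for n
  proof -
    have m: "(\<lambda>\<gamma>. u n (\<gamma>, \<gamma>, \<gamma>)) \<in> borel_measurable borel"
      by (rule measurable_compose[OF _ measurable_u]) measurable
    have "(\<integral>\<^sup>+z. u n z \<partial>shrink_init) = (\<integral>\<^sup>+\<gamma>. u n (\<gamma>, \<gamma>, \<gamma>) \<partial>uniform_measure lborel {0..<2 * pi})"
      unfolding shrink_init_def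
      by (rule nn_integral_distr) (simp_all add: measurable_cong_sets[OF sets_uniform_measure refl] measurable_u)
    also have "\<dots> = (\<integral>\<^sup>+\<gamma>\<in>{0..<2*pi}. u n (\<gamma>, \<gamma>, \<gamma>) \<partial>lborel) / ennreal (2 * pi)"
      using m by (subst nn_integral_uniform_measure) auto
    finally show ?thesis .
  qed
  show "(\<integral>\<^sup>+z. u 0 z \<partial>shrink_init) = (\<integral>\<^sup>+\<gamma>\<in>{0..<2*pi}. indicator S \<gamma> * h \<gamma> \<partial>lborel) / ennreal (2 * pi)"
    unfolding * by simp
  have "u (Suc n) (\<gamma>, \<gamma>, \<gamma>) = indicator (- S) \<gamma> * shrink_value n S h \<gamma> \<gamma> \<theta>" if g: "\<gamma> \<in> {0..<2*pi}" for \<gamma>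
  proof (cases "\<gamma> \<in> S")
    case False
    then have ne: "\<gamma> \<noteq> \<theta>" using \<theta> by auto
    have z: "(\<gamma>, \<gamma>, \<gamma>) \<in> shrink_states \<theta>" "\<gamma> \<in> gen_interval0 \<gamma> \<theta>"
      using g \<theta> ne by (auto simp: shrink_states_def gen_interval0_def gen_interval_def)
    have "\<theta> \<in> gen_interval \<gamma> \<gamma>" using \<theta> by (simp add: gen_interval_def)
    then show ?thesis
      using shrink_avg_killed_step[OF g g, of n] z by (simp add: killed_step_def[of S \<theta> "u n"] nn_integral_shrink_kernel[OF measurable_u z(1)])
  qed (simp add: killed_step_def)
  then show "(\<integral>\<^sup>+z. u (Suc n) z \<partial>shrink_init) =
    (\<integral>\<^sup>+\<gamma>\<in>{0..<2*pi}. indicator (- S) \<gamma> * shrink_value n S h \<gamma> \<gamma> \<theta> \<partial>lborel) / ennreal (2 * pi)"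
    unfolding * by (intro arg_cong2[where f="(/)"] nn_integral_cong refl) (simp split: split_indicator)
qed

end

section \<open>Symmetry and positivity of the shrinkage form\<close>

lemma shrink_avg_mono:
  "(\<And>\<gamma>. \<gamma> \<in> gen_interval a b \<Longrightarrow> \<phi> \<gamma> \<le> \<psi> \<gamma>) \<Longrightarrow> shrink_avg a b \<phi> \<le> shrink_avg a b \<psi>"
  unfolding shrink_avg_def
  by (intro divide_right_mono_ennreal nn_integral_mono) (simp split: split_indicator)

lemma shrink_avg_add:
  assumes [measurable]: "\<phi> \<in> borel_measurable borel" "\<psi> \<in> borel_measurable borel"
  shows "shrink_avg a b (\<lambda>\<gamma>. \<phi> \<gamma> + \<psi> \<gamma>) = shrink_avg a b \<phi> + shrink_avg a b \<psi>"
  unfolding shrink_avg_def by (simp add: ring_distribs nn_integral_add add_divide_distrib_ennreal)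

lemma measurable_shrink_avg:
  assumes [measurable]: "a \<in> borel_measurable M" "b \<in> borel_measurable M"
    and [measurable]: "(\<lambda>y. \<phi> (fst y) (snd y)) \<in> borel_measurable (M \<Otimes>\<^sub>M lborel)"
  shows "(\<lambda>x. shrink_avg (a x) (b x) (\<phi> x)) \<in> borel_measurable M"
proof -
  note pred_gen_interval[measurable]
  have "{y \<in> space (M \<Otimes>\<^sub>M lborel). snd y \<in> gen_interval (a (fst y)) (b (fst y))} \<in> sets (M \<Otimes>\<^sub>M lborel)"
    by measurable
  then have i [measurable]: "(\<lambda>y. indicator (gen_interval (a (fst y)) (b (fst y))) (snd y) :: ennreal)
      \<in> borel_measurable (M \<Otimes>\<^sub>M lborel)"
    by (rule borel_measurable_indicator')
  have 1: "(\<lambda>x. \<integral>\<^sup>+\<gamma>\<in>gen_interval (a x) (b x). \<phi> x \<gamma> \<partial>lborel) \<in> borel_measurable M"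
    by (rule lborel.borel_measurable_nn_integral) (simp add: split_beta')
  have "(\<lambda>x. \<integral>\<^sup>+\<gamma>. indicator (gen_interval (a x) (b x)) \<gamma> \<partial>lborel) \<in> borel_measurable M"
    by (rule lborel.borel_measurable_nn_integral) (simp add: split_beta')
  then have 2: "(\<lambda>x. emeasure lborel (gen_interval (a x) (b x))) \<in> borel_measurable M" by simp
  show ?thesis unfolding shrink_avg_def using 1 2 by measurable
qed

text \<open>Joint measurability in both endpoints and the angle is what the induction needs, because
  an endpoint of the shorter interval is the integration variable of the longer one.\<close>

lemma measurable_shrink_value:
  assumes [measurable]: "S \<in> sets borel" "h \<in> borel_measurable borel"
    and [measurable]: "a \<in> borel_measurable M" "b \<in> borel_measurable M" "t \<in> borel_measurable M"
  shows "(\<lambda>x. shrink_value n S h (a x) (b x) (t x)) \<in> borel_measurable M"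
proof -
  let ?B = "borel \<Otimes>\<^sub>M borel \<Otimes>\<^sub>M borel :: (real \<times> real \<times> real) measure"
  have "(\<lambda>x. shrink_value n S h (fst x) (fst (snd x)) (snd (snd x))) \<in> borel_measurable ?B"
  proof (induction n)
    case 0
    show ?case unfolding shrink_value.simps by (rule measurable_shrink_avg) measurable
  next
    case (Suc n)
    have IH: "(\<lambda>y. shrink_value n S h (a y) (b y) (t y)) \<in> borel_measurable (?B \<Otimes>\<^sub>M lborel)"
      if [measurable]: "a \<in> borel_measurable (?B \<Otimes>\<^sub>M lborel)" "b \<in> borel_measurable (?B \<Otimes>\<^sub>M lborel)"
        "t \<in> borel_measurable (?B \<Otimes>\<^sub>M lborel)" for a b t
      using measurable_compose[OF _ Suc.IH, of "\<lambda>x. (a x, b x, t x)" "?B \<Otimes>\<^sub>M lborel"] by simp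
    note [measurable] = IH pred_gen_interval
    have g0: "x \<in> gen_interval0 a b \<longleftrightarrow> a \<noteq> b \<and> x \<in> gen_interval a b" for x a b
      by (simp add: gen_interval0_def)
    show ?case unfolding shrink_value.simps g0 by (rule measurable_shrink_avg) measurable
  qed
  from measurable_compose[OF _ this, of "\<lambda>x. (a x, b x, t x)" M] show ?thesis by simp
qed

text \<open>The integral over \<theta> is not divided by the length of the interval, so that the
  forms on two complementary pieces simply add up.\<close>

definition shrink_form ::
    "nat \<Rightarrow> real set \<Rightarrow> (real \<Rightarrow> ennreal) \<Rightarrow> (real \<Rightarrow> ennreal) \<Rightarrow> real \<Rightarrow> real \<Rightarrow> ennreal" where
  "shrink_form n S f h a b =
     (\<integral>\<^sup>+\<theta>\<in>gen_interval a b. (indicator S \<theta> * f \<theta>) * shrink_value n S h a b \<theta> \<partial>lborel)"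

lemma gen_interval_subset: "a \<in> {0..<2*pi} \<Longrightarrow> b \<in> {0..<2*pi} \<Longrightarrow> gen_interval a b \<subseteq> {0..<2*pi}"
  by (auto simp: gen_interval_def split: if_splits)

text \<open>If x \<le> y, write y = x + d; adding d * d to the left side gives the right side. This
  form of (x - y)^2 \<ge> 0 covers infinite values and is the base case of positivity.\<close>

lemma ennreal_two_mult_le_squares: "x * y + y * x \<le> x * x + y * (y :: ennreal)"
proof -
  have *: "x * y + y * x \<le> x * x + y * y" if xy: "x \<le> y" for x y :: ennreal
  proof -
    obtain d where y: "y = x + d" using xy by (auto simp: le_iff_add)
    have "x * y + y * x \<le> x * y + y * x + d * d" by simp
    also have "\<dots> = x * x + y * y" by (simp add: y ring_distribs ac_simps)
    finally show ?thesis .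
  qed
  show ?thesis using *[of x y] *[of y x] by (cases "x \<le> y") (auto simp: ac_simps)
qed

context
  fixes S :: "real set"
  assumes S [measurable]: "S \<in> sets borel"
begin

lemma measurable_shrink_form:
  assumes [measurable]: "f \<in> borel_measurable borel" "h \<in> borel_measurable borel"
    and [measurable]: "a \<in> borel_measurable M" "b \<in> borel_measurable M"
  shows "(\<lambda>x. shrink_form n S f h (a x) (b x)) \<in> borel_measurable M"
proof -
  note [measurable] = pred_gen_interval measurable_shrink_value
  have "{y \<in> space (M \<Otimes>\<^sub>M lborel). snd y \<in> gen_interval (a (fst y)) (b (fst y))} \<in> sets (M \<Otimes>\<^sub>M lborel)"
    by measurable
  then have [measurable]: "(\<lambda>y. indicator (gen_interval (a (fst y)) (b (fst y))) (snd y) :: ennreal)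
      \<in> borel_measurable (M \<Otimes>\<^sub>M lborel)"
    by (rule borel_measurable_indicator')
  show ?thesis unfolding shrink_form_def
    by (rule lborel.borel_measurable_nn_integral) (simp add: split_beta')
qed

text \<open>Without a preceding miss the expectation does not depend on \<theta>, so it leaves the
  integral and the form has rank one.\<close>

lemma shrink_form_0:
  assumes [measurable]: "f \<in> borel_measurable borel"
  shows "shrink_form 0 S f h a b =
    (\<integral>\<^sup>+\<theta>\<in>gen_interval a b. indicator S \<theta> * f \<theta> \<partial>lborel) *
    (\<integral>\<^sup>+\<theta>\<in>gen_interval a b. indicator S \<theta> * h \<theta> \<partial>lborel) / emeasure lborel (gen_interval a b)"
proof -
  have "shrink_form 0 S f h a b = (\<integral>\<^sup>+\<theta>. (indicator S \<theta> * f \<theta> * indicator (gen_interval a b) \<theta>) *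
      shrink_avg a b (\<lambda>\<gamma>. indicator S \<gamma> * h \<gamma>) \<partial>lborel)"
    unfolding shrink_form_def by (simp add: ac_simps)
  also have "\<dots> = (\<integral>\<^sup>+\<theta>\<in>gen_interval a b. indicator S \<theta> * f \<theta> \<partial>lborel) *
      shrink_avg a b (\<lambda>\<gamma>. indicator S \<gamma> * h \<gamma>)"
    by (rule nn_integral_multc) measurable
  finally show ?thesis by (simp add: shrink_avg_def ennreal_times_divide)
qed

text \<open>A missed proposal \<open>\<gamma>\<close> cuts the interval into two pieces; \<open>\<theta>\<close> then continues in its own piece.
  After exchanging the integrals over \<open>\<theta>\<close> and \<open>\<gamma>\<close> the form is the sum of the forms on both pieces.\<close>

lemma shrink_form_Suc:
  assumes [measurable]: "f \<in> borel_measurable borel" "h \<in> borel_measurable borel"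
    and ab: "a \<in> {0..<2*pi}" "b \<in> {0..<2*pi}"
  shows "shrink_form (Suc n) S f h a b =
    shrink_avg a b (\<lambda>\<gamma>. indicator (- S) \<gamma> * (shrink_form n S f h \<gamma> b + shrink_form n S f h a \<gamma>))"
proof -
  let ?I = "gen_interval a b" and ?m = "emeasure lborel (gen_interval a b)"
  define W where "W \<gamma> \<theta> = (if \<gamma> \<in> gen_interval0 a \<theta> then shrink_value n S h \<gamma> b \<theta>
    else shrink_value n S h a \<gamma> \<theta>)" for \<gamma> \<theta>
  define X where "X \<theta> \<gamma> = indicator ?I \<theta> * indicator S \<theta> * f \<theta> *
    (indicator ?I \<gamma> * indicator (- S) \<gamma> * W \<gamma> \<theta>)" for \<theta> \<gamma>
  note [measurable] = pred_gen_interval measurable_shrink_value[OF S assms(2)]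
  have g0: "x \<in> gen_interval0 a b \<longleftrightarrow> a \<noteq> b \<and> x \<in> gen_interval a b" for x a b
    by (simp add: gen_interval0_def)
  have [measurable]: "(\<lambda>y. W (snd y) (fst y)) \<in> borel_measurable (lborel \<Otimes>\<^sub>M lborel)"
    unfolding W_def g0 by measurable
  have Wm [measurable]: "(\<lambda>\<gamma>. W \<gamma> \<theta>) \<in> borel_measurable borel" for \<theta>
    unfolding W_def g0 by measurable
  have Xm: "(\<lambda>(x, y). X x y) \<in> borel_measurable (lborel \<Otimes>\<^sub>M lborel)"
    unfolding X_def split_beta' by measurable
  have inner: "(\<integral>\<^sup>+\<gamma>. X \<theta> \<gamma> \<partial>lborel) = indicator ?I \<theta> * indicator S \<theta> * f \<theta> *
      (\<integral>\<^sup>+\<gamma>\<in>?I. indicator (- S) \<gamma> * W \<gamma> \<theta> \<partial>lborel)" for \<theta>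
    unfolding X_def by (subst nn_integral_cmult) (auto simp: ac_simps)
  have "shrink_form (Suc n) S f h a b = (\<integral>\<^sup>+\<theta>. (\<integral>\<^sup>+\<gamma>. X \<theta> \<gamma> \<partial>lborel) / ?m \<partial>lborel)"
    unfolding shrink_form_def shrink_value.simps W_def[symmetric] shrink_avg_def inner
    by (simp add: ennreal_times_divide ac_simps)
  also have "\<dots> = (\<integral>\<^sup>+\<theta>. \<integral>\<^sup>+\<gamma>. X \<theta> \<gamma> \<partial>lborel \<partial>lborel) / ?m"
    by (rule nn_integral_divide) (rule lborel.borel_measurable_nn_integral[OF Xm])
  also have "(\<integral>\<^sup>+\<theta>. \<integral>\<^sup>+\<gamma>. X \<theta> \<gamma> \<partial>lborel \<partial>lborel) = (\<integral>\<^sup>+\<gamma>. \<integral>\<^sup>+\<theta>. X \<theta> \<gamma> \<partial>lborel \<partial>lborel)"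
    by (rule lborel_pair.Fubini'[OF Xm, symmetric])
  also have "\<dots> = (\<integral>\<^sup>+\<gamma>\<in>?I. indicator (- S) \<gamma> * (shrink_form n S f h \<gamma> b + shrink_form n S f h a \<gamma>) \<partial>lborel)"
  proof (rule nn_integral_cong_AE)
    \<comment> \<open>\<open>\<gamma> = a\<close> must be excluded: \<open>gen_interval a a\<close> is the full circle rather than empty.\<close>
    have "AE \<gamma> in lborel. \<gamma> \<noteq> a" by (rule AE_lborel_singleton)
    then show "AE \<gamma> in lborel. (\<integral>\<^sup>+\<theta>. X \<theta> \<gamma> \<partial>lborel) =
      indicator (- S) \<gamma> * (shrink_form n S f h \<gamma> b + shrink_form n S f h a \<gamma>) * indicator ?I \<gamma>"
    proof eventually_elim
      case (elim \<gamma>)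
      show ?case
      proof (cases "\<gamma> \<in> ?I \<and> \<gamma> \<notin> S")
        case True
        then have gT: "\<gamma> \<in> {0..<2*pi}" using gen_interval_subset[OF ab] by auto
        have "X \<theta> \<gamma> = (indicator S \<theta> * f \<theta>) * shrink_value n S h \<gamma> b \<theta> * indicator (gen_interval \<gamma> b) \<theta> +
          (indicator S \<theta> * f \<theta>) * shrink_value n S h a \<gamma> \<theta> * indicator (gen_interval a \<gamma>) \<theta>" for \<theta>
        proof (cases "\<theta> \<in> S")
          case tS: True
          then have ne: "\<theta> \<noteq> \<gamma>" using True by auto
          \<comment> \<open>For \<theta> \<noteq> \<gamma> inside the arc, \<gamma> lies between a
            and \<theta> exactly when \<theta> lies beyond \<gamma>. The branch chosen by the update
            is therefore the piece that contains \<theta>. The two angles differ because \<theta> is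
            in S and \<gamma> is not.\<close>
          have d: "(\<theta> \<in> ?I \<and> \<gamma> \<in> gen_interval0 a \<theta>) \<longleftrightarrow> \<theta> \<in> gen_interval \<gamma> b"
            "(\<theta> \<in> ?I \<and> \<gamma> \<notin> gen_interval0 a \<theta>) \<longleftrightarrow> \<theta> \<in> gen_interval a \<gamma>"
            using elim ne True gT ab
            by (auto simp: gen_interval_def gen_interval0_def split: if_splits)
          show ?thesis using True tS d unfolding X_def W_def
            by (cases "\<gamma> \<in> gen_interval0 a \<theta>") (auto simp: indicator_def)
        qed (simp add: X_def)
        then show ?thesis using True
          by (simp add: nn_integral_add shrink_form_def)
      qed (auto simp: X_def)
    qed
  qed
  finally show ?thesis by (simp add: shrink_avg_def)
qed

lemma shrink_form_commute:
  assumes f: "f \<in> borel_measurable borel" and h: "h \<in> borel_measurable borel"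
    and "a \<in> {0..<2*pi}" "b \<in> {0..<2*pi}"
  shows "shrink_form n S f h a b = shrink_form n S h f a b"
  using assms(3,4)
proof (induction n arbitrary: a b)
  case 0
  then show ?case by (simp add: shrink_form_0 f h mult.commute)
next
  case (Suc n)
  show ?case unfolding shrink_form_Suc[OF f h Suc.prems] shrink_form_Suc[OF h f Suc.prems]
    using Suc gen_interval_subset[OF Suc.prems]
    by (intro shrink_avg_cong arg_cong2[where f="(*)"] arg_cong2[where f="(+)"] refl) auto
qed

text \<open>Applied to the positive and negative parts of a real function, this inequality is positive
  semidefiniteness, without any integrability conditions.\<close>

lemma shrink_form_two_mult_le:
  assumes f: "f \<in> borel_measurable borel" and h: "h \<in> borel_measurable borel"
    and "a \<in> {0..<2*pi}" "b \<in> {0..<2*pi}"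
  shows "shrink_form n S f h a b + shrink_form n S h f a b \<le> shrink_form n S f f a b + shrink_form n S h h a b"
  using assms(3,4)
proof (induction n arbitrary: a b)
  case 0
  show ?case
    by (simp add: shrink_form_0 f h add_divide_distrib_ennreal[symmetric] divide_right_mono_ennreal ennreal_two_mult_le_squares)
next
  case (Suc n)
  have m [measurable]: "(\<lambda>\<gamma>. shrink_form n S f h \<gamma> b) \<in> borel_measurable borel"
    "(\<lambda>\<gamma>. shrink_form n S f h a \<gamma>) \<in> borel_measurable borel"
    if "f \<in> borel_measurable borel" "h \<in> borel_measurable borel" for f h
    using that by (auto intro!: measurable_shrink_form)
  note [measurable] = f h
  \<comment> \<open>The terms are regrouped by piece, so that the induction hypothesis applies
    separately to the piece from \<gamma> to b and to the piece from a to \<gamma>.\<close>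
  have eq: "shrink_form (Suc n) S f h a b + shrink_form (Suc n) S f' h' a b =
     shrink_avg a b (\<lambda>\<gamma>. indicator (- S) \<gamma> * ((shrink_form n S f h \<gamma> b + shrink_form n S f' h' \<gamma> b) +
        (shrink_form n S f h a \<gamma> + shrink_form n S f' h' a \<gamma>)))"
    if [measurable]: "f \<in> borel_measurable borel" "h \<in> borel_measurable borel"
       "f' \<in> borel_measurable borel" "h' \<in> borel_measurable borel" for f h f' h'
    unfolding shrink_form_Suc[OF that(1,2) Suc.prems] shrink_form_Suc[OF that(3,4) Suc.prems]
    by (subst shrink_avg_add[symmetric]) (simp_all add: ring_distribs ac_simps)
  show ?case unfolding eq[OF f h h f] eq[OF f f h h]
    using Suc gen_interval_subset[OF Suc.prems]
    by (auto intro!: shrink_avg_mono mult_left_mono add_mono[of "_ + _" "_ + _" "_ + _" "_ + _"])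
qed

end

text \<open>The first term is an immediate hit. In the n-th summand the first proposal misses at
  \<gamma> and exactly n further misses precede the hit; the division by 2 \<pi> is the law of the
  first proposal.\<close>

definition shrinkage_value :: "real set \<Rightarrow> (real \<Rightarrow> ennreal) \<Rightarrow> real \<Rightarrow> ennreal" where
  "shrinkage_value S h \<theta> =
     ((\<integral>\<^sup>+\<gamma>\<in>{0..<2*pi}. indicator S \<gamma> * h \<gamma> \<partial>lborel) +
      (\<Sum>n. \<integral>\<^sup>+\<gamma>\<in>{0..<2*pi}. indicator (- S) \<gamma> * shrink_value n S h \<gamma> \<gamma> \<theta> \<partial>lborel)) / ennreal (2 * pi)"

definition shrinkage_form :: "real set \<Rightarrow> (real \<Rightarrow> ennreal) \<Rightarrow> (real \<Rightarrow> ennreal) \<Rightarrow> ennreal" where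
  "shrinkage_form S f h = (\<integral>\<^sup>+\<theta>\<in>{0..<2*pi}. indicator S \<theta> * f \<theta> * shrinkage_value S h \<theta> \<partial>lborel)"

context
  fixes S :: "real set"
  assumes S [measurable]: "S \<in> sets borel"
begin

text \<open>Exchanging \<theta> with the first missed proposal \<gamma> turns each summand into an
  average of forms on the circle cut open at \<gamma>. Symmetry and positivity are then inherited
  term by term.\<close>

lemma shrinkage_form_eq:
  assumes [measurable]: "f \<in> borel_measurable borel" "h \<in> borel_measurable borel"
  shows "shrinkage_form S f h =
    ((\<integral>\<^sup>+\<gamma>\<in>{0..<2*pi}. indicator S \<gamma> * f \<gamma> \<partial>lborel) * (\<integral>\<^sup>+\<gamma>\<in>{0..<2*pi}. indicator S \<gamma> * h \<gamma> \<partial>lborel) +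
     (\<Sum>n. \<integral>\<^sup>+\<gamma>\<in>{0..<2*pi}. indicator (- S) \<gamma> * shrink_form n S f h \<gamma> \<gamma> \<partial>lborel)) / ennreal (2 * pi)"
proof -
  let ?T = "{0..<2*pi}"
  define F where "F \<theta> = indicator S \<theta> * f \<theta> * indicator ?T \<theta>" for \<theta>
  define K where "K = (\<integral>\<^sup>+\<gamma>\<in>?T. indicator S \<gamma> * h \<gamma> \<partial>lborel)"
  define V where "V n \<theta> = (\<integral>\<^sup>+\<gamma>\<in>?T. indicator (- S) \<gamma> * shrink_value n S h \<gamma> \<gamma> \<theta> \<partial>lborel)" for n \<theta>
  note [measurable] = measurable_shrink_value[OF S assms(2)] measurable_shrink_form[OF S assms(1,2)]
  have [measurable]: "F \<in> borel_measurable borel" unfolding F_def by measurable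
  have [measurable]: "V n \<in> borel_measurable borel" for n
    unfolding V_def by (rule lborel.borel_measurable_nn_integral) (simp add: split_beta')
  have T: "gen_interval \<gamma> \<gamma> = ?T" for \<gamma> by (simp add: gen_interval_def)
  have FV: "(\<integral>\<^sup>+\<theta>. F \<theta> * V n \<theta> \<partial>lborel) = (\<integral>\<^sup>+\<gamma>\<in>?T. indicator (- S) \<gamma> * shrink_form n S f h \<gamma> \<gamma> \<partial>lborel)" for n
  proof -
    have "(\<integral>\<^sup>+\<theta>. F \<theta> * V n \<theta> \<partial>lborel) =
        (\<integral>\<^sup>+\<theta>. \<integral>\<^sup>+\<gamma>. F \<theta> * (indicator (- S) \<gamma> * shrink_value n S h \<gamma> \<gamma> \<theta> * indicator ?T \<gamma>) \<partial>lborel \<partial>lborel)"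
      unfolding V_def by (intro nn_integral_cong nn_integral_cmult[symmetric]) measurable
    also have "\<dots> = (\<integral>\<^sup>+\<gamma>. \<integral>\<^sup>+\<theta>. F \<theta> * (indicator (- S) \<gamma> * shrink_value n S h \<gamma> \<gamma> \<theta> * indicator ?T \<gamma>) \<partial>lborel \<partial>lborel)"
      by (rule lborel_pair.Fubini'[symmetric]) (simp add: split_beta')
    also have "\<dots> = (\<integral>\<^sup>+\<gamma>. \<integral>\<^sup>+\<theta>. (indicator (- S) \<gamma> * indicator ?T \<gamma>) * ((indicator S \<theta> * f \<theta>) * shrink_value n S h \<gamma> \<gamma> \<theta> * indicator ?T \<theta>) \<partial>lborel \<partial>lborel)"
      unfolding F_def by (simp add: ac_simps)
    also have "\<dots> = (\<integral>\<^sup>+\<gamma>. (indicator (- S) \<gamma> * indicator ?T \<gamma>) * shrink_form n S f h \<gamma> \<gamma> \<partial>lborel)"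
      unfolding shrink_form_def T by (intro nn_integral_cong nn_integral_cmult) measurable
    finally show ?thesis by (simp add: ac_simps)
  qed
  have "shrinkage_form S f h = (\<integral>\<^sup>+\<theta>. (F \<theta> * K + (\<Sum>n. F \<theta> * V n \<theta>)) / ennreal (2 * pi) \<partial>lborel)"
    unfolding shrinkage_form_def shrinkage_value_def F_def K_def V_def
    by (simp add: ennreal_suminf_cmult ennreal_times_divide ring_distribs ac_simps)
  also have "\<dots> = ((\<integral>\<^sup>+\<theta>. F \<theta> * K \<partial>lborel) + (\<Sum>n. \<integral>\<^sup>+\<theta>. F \<theta> * V n \<theta> \<partial>lborel)) / ennreal (2 * pi)"
    by (simp add: nn_integral_divide nn_integral_add nn_integral_suminf del: ennreal_suminf_cmult)
  also have "(\<integral>\<^sup>+\<theta>. F \<theta> * K \<partial>lborel) = (\<integral>\<^sup>+\<theta>. F \<theta> \<partial>lborel) * K"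
    by (rule nn_integral_multc) measurable
  finally show ?thesis unfolding FV unfolding F_def K_def .
qed

lemma shrinkage_form_commute:
  assumes "f \<in> borel_measurable borel" "h \<in> borel_measurable borel"
  shows "shrinkage_form S f h = shrinkage_form S h f"
  unfolding shrinkage_form_eq[OF assms] shrinkage_form_eq[OF assms(2,1)]
  by (intro arg_cong2[where f="(/)"] arg_cong2[where f="(+)"] suminf_cong nn_integral_cong refl)
     (auto simp: mult.commute indicator_def shrink_form_commute[OF S assms])

lemma shrinkage_form_two_mult_le:
  assumes [measurable]: "f \<in> borel_measurable borel" "h \<in> borel_measurable borel"
  shows "shrinkage_form S f h + shrinkage_form S h f \<le> shrinkage_form S f f + shrinkage_form S h h"
proof -
  let ?T = "{0..<2*pi}"
  let ?B = "\<lambda>f h n. \<integral>\<^sup>+\<gamma>\<in>?T. indicator (- S) \<gamma> * shrink_form n S f h \<gamma> \<gamma> \<partial>lborel"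
  note [measurable] = measurable_shrink_form[OF S]
  have add: "?B f h n + ?B f' h' n = (\<integral>\<^sup>+\<gamma>\<in>?T. indicator (- S) \<gamma> * (shrink_form n S f h \<gamma> \<gamma> + shrink_form n S f' h' \<gamma> \<gamma>) \<partial>lborel)"
    if [measurable]: "f \<in> borel_measurable borel" "h \<in> borel_measurable borel"
       "f' \<in> borel_measurable borel" "h' \<in> borel_measurable borel" for f h f' h' n
    by (subst nn_integral_add[symmetric]) (auto simp: ring_distribs)
  have le: "?B f h n + ?B h f n \<le> ?B f f n + ?B h h n" for n
    unfolding add[OF assms assms(2,1)] add[OF assms(1,1) assms(2,2)]
    using shrink_form_two_mult_le[OF S assms]
    by (intro nn_integral_mono) (auto simp: indicator_def)
  have sum: "(\<Sum>n. ?B f h n) + (\<Sum>n. ?B h f n) \<le> (\<Sum>n. ?B f f n) + (\<Sum>n. ?B h h n)"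
    unfolding suminf_add[OF summableI summableI] by (intro suminf_le le summableI)
  let ?J = "\<lambda>f. \<integral>\<^sup>+\<gamma>\<in>?T. indicator S \<gamma> * f \<gamma> \<partial>lborel"
  have "(?J f * ?J h + (\<Sum>n. ?B f h n)) + (?J h * ?J f + (\<Sum>n. ?B h f n)) \<le>
      (?J f * ?J f + (\<Sum>n. ?B f f n)) + (?J h * ?J h + (\<Sum>n. ?B h h n))"
    using add_mono[OF ennreal_two_mult_le_squares[of "?J f" "?J h"] sum] by (simp add: ac_simps)
  then show ?thesis unfolding shrinkage_form_eq[OF assms] shrinkage_form_eq[OF assms(2,1)]
      shrinkage_form_eq[OF assms(1,1)] shrinkage_form_eq[OF assms(2,2)] add_divide_distrib_ennreal[symmetric]
    by (rule divide_right_mono_ennreal)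
qed

end

section \<open>Rotating the circle\<close>

text \<open>Addition modulo 2 \<pi>; one subtraction is enough for arguments in [0, 2
  \<pi>).\<close>

definition circle_shift :: "real \<Rightarrow> real \<Rightarrow> real" where
  "circle_shift s \<alpha> = (if \<alpha> + s < 2 * pi then \<alpha> + s else \<alpha> + s - 2 * pi)"

lemma circle_shift_in: "s \<in> {0..<2*pi} \<Longrightarrow> \<alpha> \<in> {0..<2*pi} \<Longrightarrow> circle_shift s \<alpha> \<in> {0..<2*pi}"
  by (auto simp: circle_shift_def)

lemma measurable_circle_shift [measurable]: "circle_shift s \<in> borel_measurable borel"
  unfolding circle_shift_def[abs_def] by measurable

text \<open>Generalised intervals are arcs and depend only on the cyclic order of the angles. The
  case split records which of them cross 2 \<pi>; equal endpoints give the full circle before and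
  after the shift.\<close>

lemma gen_interval_circle_shift:
  assumes "s \<in> {0..<2*pi}" "a \<in> {0..<2*pi}" "b \<in> {0..<2*pi}" "\<gamma> \<in> {0..<2*pi}"
  shows "circle_shift s \<gamma> \<in> gen_interval (circle_shift s a) (circle_shift s b) \<longleftrightarrow> \<gamma> \<in> gen_interval a b"
  using assms unfolding circle_shift_def gen_interval_def
  by (cases "a + s < 2 * pi"; cases "b + s < 2 * pi"; cases "\<gamma> + s < 2 * pi") auto

lemma circle_shift_eq_iff:
  assumes "s \<in> {0..<2*pi}" "a \<in> {0..<2*pi}" "b \<in> {0..<2*pi}"
  shows "circle_shift s a = circle_shift s b \<longleftrightarrow> a = b"
  using assms by (auto simp: circle_shift_def)

lemma nn_integral_circle_shift:
  assumes [measurable]: "\<phi> \<in> borel_measurable borel" and s: "s \<in> {0..<2*pi}"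
  shows "(\<integral>\<^sup>+\<gamma>\<in>{0..<2*pi}. \<phi> (circle_shift s \<gamma>) \<partial>lborel) = (\<integral>\<^sup>+\<gamma>\<in>{0..<2*pi}. \<phi> \<gamma> \<partial>lborel)"
proof -
  have "(\<integral>\<^sup>+\<gamma>\<in>{0..<2*pi}. \<phi> (circle_shift s \<gamma>) \<partial>lborel) =
     (\<integral>\<^sup>+\<gamma>. \<phi> (s + 1 * \<gamma>) * indicator {s..<2*pi} (s + 1 * \<gamma>) +
       \<phi> ((s - 2 * pi) + 1 * \<gamma>) * indicator {0..<s} ((s - 2 * pi) + 1 * \<gamma>) \<partial>lborel)"
    \<comment> \<open>Angles that do not wrap are translated onto [s, 2 \<pi>), the others onto [0,
      s). The factor 1 matches the shape of the affine substitution rule.\<close>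
    using s by (intro nn_integral_cong) (auto simp: circle_shift_def indicator_def algebra_simps)
  also have "\<dots> = (\<integral>\<^sup>+\<gamma>. \<phi> (s + 1 * \<gamma>) * indicator {s..<2*pi} (s + 1 * \<gamma>) \<partial>lborel) +
       (\<integral>\<^sup>+\<gamma>. \<phi> ((s - 2 * pi) + 1 * \<gamma>) * indicator {0..<s} ((s - 2 * pi) + 1 * \<gamma>) \<partial>lborel)"
    by (rule nn_integral_add) measurable
  also have "(\<integral>\<^sup>+\<gamma>. \<phi> (s + 1 * \<gamma>) * indicator {s..<2*pi} (s + 1 * \<gamma>) \<partial>lborel) =
      (\<integral>\<^sup>+\<gamma>. \<phi> \<gamma> * indicator {s..<2*pi} \<gamma> \<partial>lborel)"
    using nn_integral_real_affine[of "\<lambda>\<gamma>. \<phi> \<gamma> * indicator {s..<2*pi} \<gamma>" 1 s] by simp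
  also have "(\<integral>\<^sup>+\<gamma>. \<phi> ((s - 2 * pi) + 1 * \<gamma>) * indicator {0..<s} ((s - 2 * pi) + 1 * \<gamma>) \<partial>lborel) =
      (\<integral>\<^sup>+\<gamma>. \<phi> \<gamma> * indicator {0..<s} \<gamma> \<partial>lborel)"
    using nn_integral_real_affine[of "\<lambda>\<gamma>. \<phi> \<gamma> * indicator {0..<s} \<gamma>" 1 "s - 2 * pi"] by simp
  also have "(\<integral>\<^sup>+\<gamma>. \<phi> \<gamma> * indicator {s..<2*pi} \<gamma> \<partial>lborel) + (\<integral>\<^sup>+\<gamma>. \<phi> \<gamma> * indicator {0..<s} \<gamma> \<partial>lborel) =
     (\<integral>\<^sup>+\<gamma>. \<phi> \<gamma> * indicator {s..<2*pi} \<gamma> + \<phi> \<gamma> * indicator {0..<s} \<gamma> \<partial>lborel)"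
    by (rule nn_integral_add[symmetric]) measurable
  also have "\<dots> = (\<integral>\<^sup>+\<gamma>\<in>{0..<2*pi}. \<phi> \<gamma> \<partial>lborel)"
    using s by (intro nn_integral_cong) (auto simp: indicator_def)
  finally show ?thesis .
qed

lemma nn_integral_gen_interval_circle_shift:
  assumes [measurable]: "\<phi> \<in> borel_measurable borel"
    and s: "s \<in> {0..<2*pi}" and ab: "a \<in> {0..<2*pi}" "b \<in> {0..<2*pi}"
  shows "(\<integral>\<^sup>+\<gamma>\<in>gen_interval a b. \<phi> (circle_shift s \<gamma>) \<partial>lborel) =
    (\<integral>\<^sup>+\<gamma>\<in>gen_interval (circle_shift s a) (circle_shift s b). \<phi> \<gamma> \<partial>lborel)"
proof -
  let ?r = "circle_shift s" and ?T = "{0..<2*pi}"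
  have r: "?r a \<in> ?T" "?r b \<in> ?T" using circle_shift_in s ab by auto
  have "(\<integral>\<^sup>+\<gamma>\<in>gen_interval a b. \<phi> (?r \<gamma>) \<partial>lborel) =
      (\<integral>\<^sup>+\<gamma>\<in>?T. \<phi> (?r \<gamma>) * indicator (gen_interval (?r a) (?r b)) (?r \<gamma>) \<partial>lborel)"
    using gen_interval_subset[OF ab] gen_interval_circle_shift[OF s ab]
    by (intro nn_integral_cong) (auto split: split_indicator)
  also have "\<dots> = (\<integral>\<^sup>+\<gamma>\<in>?T. \<phi> \<gamma> * indicator (gen_interval (?r a) (?r b)) \<gamma> \<partial>lborel)"
    by (rule nn_integral_circle_shift[OF _ s]) measurable
  also have "\<dots> = (\<integral>\<^sup>+\<gamma>\<in>gen_interval (?r a) (?r b). \<phi> \<gamma> \<partial>lborel)"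
    using gen_interval_subset[OF r] by (intro nn_integral_cong) (auto split: split_indicator)
  finally show ?thesis .
qed

lemma shrink_avg_circle_shift:
  assumes \<phi>: "\<phi> \<in> borel_measurable borel"
    and s: "s \<in> {0..<2*pi}" and ab: "a \<in> {0..<2*pi}" "b \<in> {0..<2*pi}"
  shows "shrink_avg a b (\<lambda>\<gamma>. \<phi> (circle_shift s \<gamma>)) = shrink_avg (circle_shift s a) (circle_shift s b) \<phi>"
  using nn_integral_gen_interval_circle_shift[OF \<phi> s ab]
    nn_integral_gen_interval_circle_shift[of "\<lambda>_. 1", OF _ s ab]
  by (simp add: shrink_avg_def)

text \<open>Arcs, their lengths and the choice of the surviving piece are all covariant under
  rotation, hence so is the recursion. Agreement of \<open>S'\<close> and \<open>h'\<close> with the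
  shifted data is required on [0, 2 \<pi>) only, as an ellipse preimage contains no other
  angles.\<close>

lemma shrink_value_circle_shift:
  assumes S [measurable]: "S \<in> sets borel" and h [measurable]: "h \<in> borel_measurable borel"
    and s: "s \<in> {0..<2*pi}"
    and S': "\<And>\<alpha>. \<alpha> \<in> {0..<2*pi} \<Longrightarrow> \<alpha> \<in> S' \<longleftrightarrow> circle_shift s \<alpha> \<in> S"
    and h': "\<And>\<alpha>. \<alpha> \<in> {0..<2*pi} \<Longrightarrow> h' \<alpha> = h (circle_shift s \<alpha>)"
    and "a \<in> {0..<2*pi}" "b \<in> {0..<2*pi}" "\<theta> \<in> {0..<2*pi}"
  shows "shrink_value n S' h' a b \<theta> =
    shrink_value n S h (circle_shift s a) (circle_shift s b) (circle_shift s \<theta>)"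
  using assms(6-8)
proof (induction n arbitrary: a b)
  case 0
  have "shrink_value 0 S' h' a b \<theta> =
      shrink_avg a b (\<lambda>\<gamma>. indicator S (circle_shift s \<gamma>) * h (circle_shift s \<gamma>))"
    unfolding shrink_value.simps
    using gen_interval_subset[OF 0(1,2)] by (intro shrink_avg_cong) (auto simp: indicator_def S' h')
  also have "\<dots> = shrink_value 0 S h (circle_shift s a) (circle_shift s b) (circle_shift s \<theta>)"
    unfolding shrink_value.simps by (rule shrink_avg_circle_shift[OF _ s 0(1,2)]) measurable
  finally show ?case .
next
  case (Suc n)
  let ?r = "circle_shift s"
  let ?\<phi> = "\<lambda>\<gamma>. indicator (- S) \<gamma> * (if \<gamma> \<in> gen_interval0 (?r a) (?r \<theta>)
        then shrink_value n S h \<gamma> (?r b) (?r \<theta>) else shrink_value n S h (?r a) \<gamma> (?r \<theta>))"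
  have g0: "?r \<gamma> \<in> gen_interval0 (?r a) (?r \<theta>) \<longleftrightarrow> \<gamma> \<in> gen_interval0 a \<theta>" if "\<gamma> \<in> {0..<2*pi}" for \<gamma>
    using gen_interval_circle_shift[OF s Suc.prems(1,3) that] circle_shift_eq_iff[OF s Suc.prems(1,3)]
    by (simp add: gen_interval0_def)
  have "shrink_value (Suc n) S' h' a b \<theta> = shrink_avg a b (\<lambda>\<gamma>. ?\<phi> (?r \<gamma>))"
    unfolding shrink_value.simps
  proof (rule shrink_avg_cong)
    fix \<gamma> assume "\<gamma> \<in> gen_interval a b"
    then have g: "\<gamma> \<in> {0..<2*pi}" using gen_interval_subset[OF Suc.prems(1,2)] by auto
    show "indicator (- S') \<gamma> * (if \<gamma> \<in> gen_interval0 a \<theta> then shrink_value n S' h' \<gamma> b \<theta>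
      else shrink_value n S' h' a \<gamma> \<theta>) = ?\<phi> (?r \<gamma>)"
      unfolding g0[OF g] Suc.IH[OF g Suc.prems(2,3)] Suc.IH[OF Suc.prems(1) g Suc.prems(3)]
      by (simp add: indicator_def S'[OF g])
  qed
  also have "\<dots> = shrink_value (Suc n) S h (?r a) (?r b) (?r \<theta>)"
    unfolding shrink_value.simps
  proof (rule shrink_avg_circle_shift[OF _ s Suc.prems(1,2)])
    note [measurable] = measurable_shrink_value[OF S h]
    show "?\<phi> \<in> borel_measurable borel"
      by (cases "?r a = ?r \<theta>") (simp_all add: gen_interval0_def)
  qed
  finally show ?case .
qed

text \<open>This converts a start at angle 0, the only one the sampler ever makes, into a start at
  an arbitrary angle s of the unrotated ellipse.\<close>

lemma shrinkage_value_circle_shift: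
  assumes S [measurable]: "S \<in> sets borel" and h [measurable]: "h \<in> borel_measurable borel"
    and s: "s \<in> {0..<2*pi}"
    and S': "\<And>\<alpha>. \<alpha> \<in> {0..<2*pi} \<Longrightarrow> \<alpha> \<in> S' \<longleftrightarrow> circle_shift s \<alpha> \<in> S"
    and h': "\<And>\<alpha>. \<alpha> \<in> {0..<2*pi} \<Longrightarrow> h' \<alpha> = h (circle_shift s \<alpha>)"
  shows "shrinkage_value S' h' 0 = shrinkage_value S h s"
proof -
  note [measurable] = measurable_shrink_value[OF S h]
  have s0: "circle_shift s 0 = s" using s by (simp add: circle_shift_def)
  have v: "shrink_value n S' h' \<gamma> \<gamma> 0 = shrink_value n S h (circle_shift s \<gamma>) (circle_shift s \<gamma>) s"
    if "\<gamma> \<in> {0..<2*pi}" for n \<gamma>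
    using shrink_value_circle_shift[OF S h s S' h' that that, of 0 n] s0 by simp
  have 1: "(\<integral>\<^sup>+\<gamma>\<in>{0..<2*pi}. indicator S' \<gamma> * h' \<gamma> \<partial>lborel) =
      (\<integral>\<^sup>+\<gamma>\<in>{0..<2*pi}. indicator S \<gamma> * h \<gamma> \<partial>lborel)"
    using S' h' by (subst nn_integral_circle_shift[OF _ s, symmetric])
      (auto intro!: nn_integral_cong simp: indicator_def)
  have 2: "(\<integral>\<^sup>+\<gamma>\<in>{0..<2*pi}. indicator (- S') \<gamma> * shrink_value n S' h' \<gamma> \<gamma> 0 \<partial>lborel) =
      (\<integral>\<^sup>+\<gamma>\<in>{0..<2*pi}. indicator (- S) \<gamma> * shrink_value n S h \<gamma> \<gamma> s \<partial>lborel)" for n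
    using S' v by (subst nn_integral_circle_shift[OF _ s, symmetric])
      (auto intro!: nn_integral_cong simp: indicator_def)
  show ?thesis unfolding shrinkage_value_def 1 2 ..
qed

section \<open>The elliptical slice sampler\<close>

text \<open>The indicator that n is the first hitting index, in product form so that it fits the
  integrand of \<open>nn_integral_shrink_chain\<close>.\<close>

definition first_hit :: "real set \<Rightarrow> nat \<Rightarrow> (nat \<Rightarrow> real \<times> real \<times> real) \<Rightarrow> ennreal" where
  "first_hit S n z = (\<Prod>k<n. indicator (- S) (fst (z k))) * indicator S (fst (z n))"

text \<open>The expectation of h at the hitting time; a trajectory that never meets S contributes 0
  to every summand.\<close>

definition hit_integral :: "real set \<Rightarrow> real \<Rightarrow> (real \<Rightarrow> ennreal) \<Rightarrow> ennreal" where
  "hit_integral S \<theta> h = (\<Sum>n. \<integral>\<^sup>+z. first_hit S n z * h (fst (z n)) \<partial>shrink_chain \<theta>)"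

lemma hit_integral_eq_shrinkage_value:
  assumes S: "S \<in> sets borel" and h: "h \<in> borel_measurable borel" and \<theta>: "\<theta> \<in> S" "\<theta> \<in> {0..<2*pi}"
  shows "hit_integral S \<theta> h = shrinkage_value S h \<theta>"
proof -
  let ?u = "\<lambda>n. (killed_step S \<theta> ^^ n) (\<lambda>z. indicator S (fst z) * h (fst z))"
  let ?I = "\<lambda>n. \<integral>\<^sup>+z. ?u n z \<partial>shrink_init"
  have "(\<lambda>y. indicator S y * h y) \<in> borel_measurable borel" using S h by measurable
  from measurable_compose[OF measurable_fst_triple this]
  have m: "(\<lambda>z :: real \<times> real \<times> real. indicator S (fst z) * h (fst z)) \<in> borel_measurable borel" .
  have "hit_integral S \<theta> h = (\<Sum>n. ?I n)"
    unfolding hit_integral_def first_hit_def nn_integral_shrink_chain[OF S m, symmetric]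
    by (simp add: mult.assoc)
  \<comment> \<open>The immediate hit is split off, since the first proposal obeys its own
    formula.\<close>
  also have "\<dots> = (\<Sum>n. ?I (Suc n)) + ?I 0"
    by (rule sums_unique[symmetric], rule sums_Suc, rule summable_sums, rule summableI)
  also have "\<dots> = shrinkage_value S h \<theta>"
    unfolding nn_integral_shrink_init_killed_step[OF S h \<theta>] shrinkage_value_def
    by (simp add: divide_ennreal_def ring_distribs add.commute)
  finally show ?thesis .
qed

lemma measurable_chain_component [measurable]:
  "(\<lambda>z. fst (z n)) \<in> borel_measurable (shrink_chain \<theta>)"
proof -
  have "(\<lambda>z. z n) \<in> measurable (shrink_chain \<theta>) borel"
    by (simp add: measurable_cong_sets[OF sets_shrink_chain refl] measurable_component_singleton)
  from measurable_compose[OF this measurable_fst_triple] show ?thesis .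
qed

lemma shrinkage_kernel_eq_hit_integral:
  assumes [measurable]: "S \<in> sets borel" "F \<in> sets borel"
  shows "shrinkage_kernel S \<theta> (S \<inter> F) = hit_integral S \<theta> (indicator F)"
proof -
  let ?E = "\<lambda>n. {z \<in> space (shrink_chain \<theta>). fst (z n) \<in> S \<and> fst (z n) \<in> F \<and> (\<forall>k<n. fst (z k) \<notin> S)}"
  have sE: "?E n \<in> sets (shrink_chain \<theta>)" for n by measurable
  have "shrinkage_kernel S \<theta> (S \<inter> F) = emeasure (shrink_chain \<theta>) (\<Union>n. ?E n)"
    unfolding shrinkage_kernel_def hitting_time_iff
    by (intro arg_cong[where f="emeasure (shrink_chain \<theta>)"]) auto
  also have "\<dots> = (\<Sum>n. emeasure (shrink_chain \<theta>) (?E n))"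
  proof (rule suminf_emeasure[symmetric])
    show "disjoint_family ?E"
      unfolding disjoint_family_on_def by (auto elim!: linorder_neqE_nat)
  qed (use sE in auto)
  also have "\<dots> = hit_integral S \<theta> (indicator F)"
    unfolding hit_integral_def
  proof (intro suminf_cong)
    fix n
    have "emeasure (shrink_chain \<theta>) (?E n) = (\<integral>\<^sup>+z. indicator (?E n) z \<partial>shrink_chain \<theta>)"
      using sE by simp
    also have "\<dots> = (\<integral>\<^sup>+z. first_hit S n z * indicator F (fst (z n)) \<partial>shrink_chain \<theta>)"
    proof (rule nn_integral_cong)
      fix z assume "z \<in> space (shrink_chain \<theta>)"
      then show "indicator (?E n) z = first_hit S n z * (indicator F (fst (z n)) :: ennreal)"
        by (auto simp: first_hit_def indicator_def)
    qed
    finally show "emeasure (shrink_chain \<theta>) (?E n) = (\<integral>\<^sup>+z. first_hit S n z * indicator F (fst (z n)) \<partial>shrink_chain \<theta>)" .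
  qed
  finally show ?thesis .
qed

lemma measurable_ellipse_comp:
  fixes x w :: "'b \<Rightarrow> 'a::{real_inner, second_countable_topology}"
  assumes [measurable]: "x \<in> borel_measurable M" "w \<in> borel_measurable M" "\<alpha> \<in> borel_measurable M"
  shows "(\<lambda>y. ellipse (x y) (w y) (\<alpha> y)) \<in> borel_measurable M"
  unfolding ellipse_def by measurable

lemma ellipse_preimage_level_Int:
  "ellipse_preimage x w (level_set \<rho> t \<inter> A) =
     ellipse_preimage x w (level_set \<rho> t) \<inter> {\<alpha>. ellipse x w \<alpha> \<in> A}"
  by (auto simp: ellipse_preimage_def)

text \<open>The expectation of g over the next state, for given state x, level t and auxiliary
  direction w. Angle 0 is x itself.\<close>

definition ess_slice :: "('a::real_vector \<Rightarrow> real) \<Rightarrow> ('a \<Rightarrow> ennreal) \<Rightarrow> real \<Rightarrow> 'a \<Rightarrow> 'a \<Rightarrow> ennreal" where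
  "ess_slice \<rho> g t x w =
     hit_integral (ellipse_preimage x w (level_set \<rho> t)) 0 (\<lambda>\<alpha>. g (ellipse x w \<alpha>))"

section \<open>Measurability of the sampler kernel and integration against it\<close>

locale slice_sampler =
  fixes \<mu>0 :: "'a::{real_inner, polish_space} measure" and \<rho> :: "'a \<Rightarrow> real"
  assumes prob: "prob_space \<mu>0" and sets0 [measurable_cong]: "sets \<mu>0 = sets borel"
    and \<rho> [measurable]: "\<rho> \<in> borel_measurable borel" and \<rho>_pos: "\<And>x. 0 < \<rho> x"
begin

sublocale prob_space \<mu>0 by (rule prob)

lemma space0: "space \<mu>0 = UNIV"
  using sets_eq_imp_space_eq[OF sets0] by simp

lemma sets_ellipse_preimage: "ellipse_preimage x w (level_set \<rho> t) \<in> sets borel"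
proof -
  have [measurable]: "(\<lambda>\<alpha>. ellipse x w \<alpha>) \<in> borel_measurable borel"
    by (rule measurable_ellipse_comp) measurable
  have "{\<alpha> \<in> space borel. 0 \<le> \<alpha> \<and> \<alpha> < 2 * pi \<and> t < \<rho> (ellipse x w \<alpha>)} \<in> sets borel" by measurable
  then show ?thesis by (simp add: ellipse_preimage_def level_set_def)
qed

lemma measurable_first_hit_ellipse:
  assumes [measurable]: "x \<in> borel_measurable M" "w \<in> borel_measurable M" "t \<in> borel_measurable M"
    and z: "\<And>k. (\<lambda>y. fst (z y k)) \<in> borel_measurable M"
  shows "(\<lambda>y. first_hit (ellipse_preimage (x y) (w y) (level_set \<rho> (t y))) n (z y)) \<in> borel_measurable M"
proof -
  have [measurable]: "(\<lambda>y. ellipse (x y) (w y) (fst (z y k))) \<in> borel_measurable M" for k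
    by (intro measurable_ellipse_comp z) measurable
  note [measurable] = z
  have p: "{y \<in> space M. 0 \<le> fst (z y k) \<and> fst (z y k) < 2 * pi \<and> t y < \<rho> (ellipse (x y) (w y) (fst (z y k)))} \<in> sets M" for k
    by measurable
  have q: "{y \<in> space M. \<not> (0 \<le> fst (z y k) \<and> fst (z y k) < 2 * pi \<and> t y < \<rho> (ellipse (x y) (w y) (fst (z y k))))} \<in> sets M" for k
    by measurable
  show ?thesis unfolding first_hit_def
    by (intro borel_measurable_times_ennreal borel_measurable_prod_ennreal borel_measurable_indicator')
       (use p q in \<open>simp_all add: ellipse_preimage_def level_set_def\<close>)
qed

lemma measurable_ess_slice:
  assumes [measurable]: "g \<in> borel_measurable borel"
    and [measurable]: "x \<in> borel_measurable M" "w \<in> borel_measurable M" "t \<in> borel_measurable M"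
  shows "(\<lambda>y. ess_slice \<rho> g (t y) (x y) (w y)) \<in> borel_measurable M"
proof -
  interpret P: prob_space "shrink_chain 0" by (rule prob_space_shrink_chain)
  note [measurable] = measurable_first_hit_ellipse measurable_ellipse_comp
  show ?thesis unfolding ess_slice_def hit_integral_def
    by (intro borel_measurable_suminf_order P.borel_measurable_nn_integral) (simp add: split_beta')
qed

lemma sets_ess_kernel [measurable_cong]: "sets (ess_kernel \<mu>0 \<rho> x) = sets borel"
  unfolding ess_kernel_def using sets.sigma_sets_eq[of "borel :: 'a measure"] by (simp add: space_borel)

lemma space_ess_kernel [simp]: "space (ess_kernel \<mu>0 \<rho> x) = UNIV"
  using sets_eq_imp_space_eq[OF sets_ess_kernel] by simp

text \<open>The kernel is given by a set function. To integrate a general g, it is realised as the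
  image of a weighted product of the level, the direction, the hitting index under counting measure
  and the trajectory. Tonelli's theorem then handles indicators and general functions alike.\<close>

lemma nn_integral_ess_kernel:
  assumes g [measurable]: "g \<in> borel_measurable borel"
  shows "(\<integral>\<^sup>+y. g y \<partial>ess_kernel \<mu>0 \<rho> x) =
    ennreal (1 / \<rho> x) * (\<integral>\<^sup>+t\<in>{0..\<rho> x}. (\<integral>\<^sup>+w. ess_slice \<rho> g t x w \<partial>\<mu>0) \<partial>lborel)"
proof -
  interpret P: prob_space "shrink_chain 0" by (rule prob_space_shrink_chain)
  interpret N: sigma_finite_measure "count_space (UNIV :: nat set)"
    by (rule sigma_finite_measure_count_space)
  interpret NP: pair_sigma_finite "count_space (UNIV :: nat set)" "shrink_chain 0" ..
  interpret MNP: pair_sigma_finite \<mu>0 "count_space (UNIV :: nat set) \<Otimes>\<^sub>M shrink_chain 0" ..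
  let ?N = "lborel \<Otimes>\<^sub>M \<mu>0 \<Otimes>\<^sub>M count_space (UNIV :: nat set) \<Otimes>\<^sub>M shrink_chain 0"
  \<comment> \<open>\<open>W\<close> is the weight that selects admissible levels and the first hit
    at index n; \<open>Y\<close> below is the point of the ellipse at the angle proposed at that
    index.\<close>
  define W where "W y = ennreal (1 / \<rho> x) * (indicator {0..\<rho> x} (fst y) *
    first_hit (ellipse_preimage x (fst (snd y)) (level_set \<rho> (fst y))) (fst (snd (snd y))) (snd (snd (snd y))))"
    for y :: "real \<times> 'a \<times> nat \<times> (nat \<Rightarrow> real \<times> real \<times> real)"
  define Y where "Y y = ellipse x (fst (snd y)) (fst (snd (snd (snd y)) (fst (snd (snd y)))))"
    for y :: "real \<times> 'a \<times> nat \<times> (nat \<Rightarrow> real \<times> real \<times> real)"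
  have c [measurable]: "(\<lambda>y. fst (snd (snd (snd y)) k)) \<in> borel_measurable ?N" for k by measurable
  have n: "(\<lambda>y. fst (snd (snd y))) \<in> measurable ?N (count_space UNIV)" by measurable
  have Wm [measurable]: "W \<in> borel_measurable ?N"
  proof -
    have "(\<lambda>y. first_hit (ellipse_preimage x (fst (snd y)) (level_set \<rho> (fst y))) (fst (snd (snd y))) (snd (snd (snd y))))
        \<in> borel_measurable ?N"
      by (rule measurable_compose_countable[OF _ n], rule measurable_first_hit_ellipse) measurable
    then show ?thesis unfolding W_def[abs_def] by measurable
  qed
  have Ym [measurable]: "Y \<in> borel_measurable ?N"
    unfolding Y_def[abs_def]
    by (rule measurable_compose_countable[OF _ n], rule measurable_ellipse_comp) measurable
  have main: "(\<integral>\<^sup>+y. W y * g (Y y) \<partial>?N) =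
    ennreal (1 / \<rho> x) * (\<integral>\<^sup>+t\<in>{0..\<rho> x}. (\<integral>\<^sup>+w. ess_slice \<rho> g t x w \<partial>\<mu>0) \<partial>lborel)"
    if g [measurable]: "g \<in> borel_measurable borel" for g
  proof -
    let ?F = "\<lambda>t w n z. first_hit (ellipse_preimage x w (level_set \<rho> t)) n z * g (ellipse x w (fst (z n)))"
    note [measurable] = measurable_first_hit_ellipse measurable_ellipse_comp
      measurable_ess_slice[OF g]
    have Fm: "(\<lambda>y. W y * g (Y y)) \<in> borel_measurable ?N" by measurable
    have F1: "(\<lambda>y. W (t, y) * g (Y (t, y))) \<in> borel_measurable (\<mu>0 \<Otimes>\<^sub>M count_space (UNIV :: nat set) \<Otimes>\<^sub>M shrink_chain 0)" for t
      by (rule measurable_compose[OF _ Fm]) measurable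
    have F2: "(\<lambda>y. W (t, w, y) * g (Y (t, w, y))) \<in> borel_measurable (count_space (UNIV :: nat set) \<Otimes>\<^sub>M shrink_chain 0)" for t w
      by (rule measurable_compose[OF _ Fm]) (simp add: space0)
    have "(\<integral>\<^sup>+y. W y * g (Y y) \<partial>?N) =
        (\<integral>\<^sup>+t. \<integral>\<^sup>+w. \<integral>\<^sup>+n. \<integral>\<^sup>+z. W (t, w, n, z) * g (Y (t, w, n, z)) \<partial>shrink_chain 0 \<partial>count_space UNIV \<partial>\<mu>0 \<partial>lborel)"
      by (simp only: MNP.nn_integral_fst[OF Fm, symmetric] NP.nn_integral_fst[OF F1, symmetric] P.nn_integral_fst[OF F2, symmetric])
    also have "\<dots> = (\<integral>\<^sup>+t. \<integral>\<^sup>+w. \<integral>\<^sup>+n. (ennreal (1 / \<rho> x) * indicator {0..\<rho> x} t) *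
        (\<integral>\<^sup>+z. ?F t w n z \<partial>shrink_chain 0) \<partial>count_space UNIV \<partial>\<mu>0 \<partial>lborel)"
      unfolding W_def Y_def fst_conv snd_conv
      by (subst nn_integral_cmult[symmetric]) (simp_all add: ac_simps)
    also have "\<dots> = (\<integral>\<^sup>+t. \<integral>\<^sup>+w. (ennreal (1 / \<rho> x) * indicator {0..\<rho> x} t) * ess_slice \<rho> g t x w \<partial>\<mu>0 \<partial>lborel)"
      unfolding ess_slice_def hit_integral_def
      by (simp add: nn_integral_count_space_nat)
    also have "\<dots> = (\<integral>\<^sup>+t. ennreal (1 / \<rho> x) * ((\<integral>\<^sup>+w. ess_slice \<rho> g t x w \<partial>\<mu>0) * indicator {0..\<rho> x} t) \<partial>lborel)"
      by (subst nn_integral_cmult) (simp_all add: ac_simps)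
    also have "\<dots> = ennreal (1 / \<rho> x) * (\<integral>\<^sup>+t\<in>{0..\<rho> x}. (\<integral>\<^sup>+w. ess_slice \<rho> g t x w \<partial>\<mu>0) \<partial>lborel)"
      by (rule nn_integral_cmult) measurable
    finally show ?thesis .
  qed
  \<comment> \<open>Indicators in \<open>main\<close> identify the two measures; \<open>main\<close>
    is then used again for the given g.\<close>
  have eq: "ess_kernel \<mu>0 \<rho> x = distr (density ?N W) borel Y"
  proof (rule measure_eqI)
    fix A assume "A \<in> sets (ess_kernel \<mu>0 \<rho> x)"
    then have A [measurable]: "A \<in> sets borel" by (simp add: sets_ess_kernel)
    have Fs: "{\<alpha>. ellipse x w \<alpha> \<in> A} \<in> sets borel" for w
    proof -
      have [measurable]: "(\<lambda>\<alpha>. ellipse x w \<alpha>) \<in> borel_measurable borel"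
        by (rule measurable_ellipse_comp) measurable
      have "{\<alpha> \<in> space borel. ellipse x w \<alpha> \<in> A} \<in> sets borel" by measurable
      then show ?thesis by simp
    qed
    have k: "shrinkage_kernel (ellipse_preimage x w (level_set \<rho> t)) 0 (ellipse_preimage x w (level_set \<rho> t \<inter> A)) =
        ess_slice \<rho> (indicator A) t x w" for t w
      unfolding ellipse_preimage_level_Int shrinkage_kernel_eq_hit_integral[OF sets_ellipse_preimage Fs] ess_slice_def
      by (simp add: indicator_def[abs_def])
    have "emeasure (distr (density ?N W) borel Y) A = emeasure (density ?N W) (Y -` A \<inter> space ?N)"
      by (subst emeasure_distr) auto
    also have "\<dots> = (\<integral>\<^sup>+y. W y * indicator A (Y y) \<partial>?N)"
      unfolding emeasure_density[OF Wm measurable_sets[OF Ym A]]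
      by (intro nn_integral_cong) (simp add: indicator_def)
    also have "\<dots> = emeasure (ess_kernel \<mu>0 \<rho> x) A"
      by (subst main) (simp_all add: emeasure_ess_kernel[OF prob sets0 \<rho> A] ess_transition_def k)
    finally show "emeasure (ess_kernel \<mu>0 \<rho> x) A = emeasure (distr (density ?N W) borel Y) A" ..
  qed (simp add: sets_ess_kernel)
  have "(\<integral>\<^sup>+y. g y \<partial>ess_kernel \<mu>0 \<rho> x) = (\<integral>\<^sup>+y. W y * g (Y y) \<partial>?N)"
    unfolding eq by (simp add: nn_integral_distr nn_integral_density)
  then show ?thesis using main[OF g] by simp
qed

text \<open>The hitting event has probability at most 1 for each level and direction, and the levels
  fill an interval of length \<rho>(x), which the prefactor cancels.\<close>

lemma emeasure_ess_kernel_le_1: "emeasure (ess_kernel \<mu>0 \<rho> x) (space (ess_kernel \<mu>0 \<rho> x)) \<le> 1"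
proof -
  have "shrinkage_kernel S 0 F \<le> 1" for S F
    unfolding shrinkage_kernel_def by (rule prob_space.emeasure_le_1[OF prob_space_shrink_chain])
  then have "(\<integral>\<^sup>+w. shrinkage_kernel (ellipse_preimage x w (level_set \<rho> t)) 0
      (ellipse_preimage x w (level_set \<rho> t \<inter> UNIV)) \<partial>\<mu>0) \<le> (\<integral>\<^sup>+w. 1 \<partial>\<mu>0)" for t
    by (intro nn_integral_mono) auto
  then have "ess_transition \<mu>0 \<rho> x UNIV \<le> ennreal (1 / \<rho> x) * (\<integral>\<^sup>+t\<in>{0..\<rho> x}. 1 \<partial>lborel)"
    unfolding ess_transition_def
    by (intro mult_left_mono nn_integral_mono mult_right_mono) (auto simp: emeasure_space_1)
  also have "\<dots> = 1" using \<rho>_pos[of x] by (simp add: ennreal_mult'[symmetric])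
  finally show ?thesis by (simp add: emeasure_ess_kernel[OF prob sets0 \<rho>])
qed

lemma measurable_ess_kernel:
  "ess_kernel \<mu>0 \<rho> \<in> measurable borel (subprob_algebra borel)"
proof (rule measurable_subprob_algebra)
  show "subprob_space (ess_kernel \<mu>0 \<rho> x)" for x
    using emeasure_ess_kernel_le_1 by (intro subprob_spaceI) auto
  show "sets (ess_kernel \<mu>0 \<rho> x) = sets borel" for x by (rule sets_ess_kernel)
  fix A :: "'a set" assume [measurable]: "A \<in> sets borel"
  have g: "indicator A \<in> borel_measurable borel" by measurable
  note [measurable] = measurable_ess_slice[OF g]
  have [measurable]: "(\<lambda>y. \<integral>\<^sup>+w. ess_slice \<rho> (indicator A) (snd y) (fst y) w \<partial>\<mu>0) \<in> borel_measurable (borel \<Otimes>\<^sub>M lborel)"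
    by (rule borel_measurable_nn_integral) (simp add: split_beta')
  have "{y \<in> space (borel \<Otimes>\<^sub>M lborel). 0 \<le> snd y \<and> snd y \<le> \<rho> (fst y)} \<in> sets (borel \<Otimes>\<^sub>M lborel)" by measurable
  then have [measurable]: "(\<lambda>y. indicator {0..\<rho> (fst y)} (snd y) :: ennreal) \<in> borel_measurable (borel \<Otimes>\<^sub>M lborel)"
    by (intro borel_measurable_indicator') simp
  have "(\<lambda>x. \<integral>\<^sup>+t\<in>{0..\<rho> x}. (\<integral>\<^sup>+w. ess_slice \<rho> (indicator A) t x w \<partial>\<mu>0) \<partial>lborel) \<in> borel_measurable borel"
    by (rule lborel.borel_measurable_nn_integral) (simp add: split_beta')
  then have "(\<lambda>x. \<integral>\<^sup>+y. indicator A y \<partial>ess_kernel \<mu>0 \<rho> x) \<in> borel_measurable borel"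
    unfolding nn_integral_ess_kernel[OF g] by measurable
  then show "(\<lambda>x. emeasure (ess_kernel \<mu>0 \<rho> x) A) \<in> borel_measurable borel"
    by (simp add: sets_ess_kernel)
qed

end

lemma ellipse_pair_rotation:
  "ellipse (fst (pair_rotation \<theta> (x, w))) (snd (pair_rotation \<theta> (x, w))) \<alpha> =
     ellipse x w (circle_shift \<theta> \<alpha>)"
proof -
  have s: "cos (circle_shift \<theta> \<alpha>) = cos (\<theta> + \<alpha>)" "sin (circle_shift \<theta> \<alpha>) = sin (\<theta> + \<alpha>)"
    by (auto simp: circle_shift_def cos_diff sin_diff add.commute)
  show ?thesis unfolding ellipse_def pair_rotation_def s
    by (simp add: cos_add sin_add algebra_simps)
qed

section \<open>Averaging the energy of the kernel over rotations of the pair\<close>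

context slice_sampler
begin

text \<open>The indicator restates t < \<rho>(x) as a condition on the state, so that for fixed t
  the energy is a function of the pair and can be rotated.\<close>

definition slice_energy :: "('a \<Rightarrow> ennreal) \<Rightarrow> ('a \<Rightarrow> ennreal) \<Rightarrow> real \<Rightarrow> 'a \<times> 'a \<Rightarrow> ennreal" where
  "slice_energy f g t y = f (fst y) * indicator (level_set \<rho> t) (fst y) * ess_slice \<rho> g t (fst y) (snd y)"

lemma measurable_slice_energy:
  assumes [measurable]: "f \<in> borel_measurable borel" "g \<in> borel_measurable borel"
    and [measurable]: "t \<in> borel_measurable M" "x \<in> borel_measurable M" "w \<in> borel_measurable M"
  shows "(\<lambda>z. slice_energy f g (t z) (x z, w z)) \<in> borel_measurable M"
proof -
  note [measurable] = measurable_ess_slice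
  have "{z \<in> space M. t z < \<rho> (x z)} \<in> sets M" by measurable
  then have [measurable]: "(\<lambda>z. indicator (level_set \<rho> (t z)) (x z) :: ennreal) \<in> borel_measurable M"
    by (intro borel_measurable_indicator') (simp add: level_set_def)
  show ?thesis unfolding slice_energy_def by simp
qed

text \<open>The target density \<rho>(x)/Z times 1/\<rho>(x) is the constant 1/Z. The state then
  enters the range of t only through t < \<rho>(x), and the level can be moved to the
  outside.\<close>

lemma kernel_energy_eq:
  assumes f [measurable]: "f \<in> borel_measurable borel" and g [measurable]: "g \<in> borel_measurable borel"
  shows "(\<integral>\<^sup>+x. f x * (\<integral>\<^sup>+y. g y \<partial>ess_kernel \<mu>0 \<rho> x) \<partial>target_measure \<mu>0 \<rho>) =
    ennreal (1 / (LINT y|\<mu>0. \<rho> y)) *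
      (\<integral>\<^sup>+t\<in>{0..}. (\<integral>\<^sup>+y. slice_energy f g t y \<partial>(\<mu>0 \<Otimes>\<^sub>M \<mu>0)) \<partial>lborel)"
proof -
  interpret PL: pair_sigma_finite \<mu>0 lborel ..
  interpret MM: pair_prob_space \<mu>0 \<mu>0 ..
  let ?Z = "LINT y|\<mu>0. \<rho> y"
  let ?w = "\<lambda>t x. \<integral>\<^sup>+w. ess_slice \<rho> g t x w \<partial>\<mu>0"
  let ?G = "\<lambda>x t. (\<integral>\<^sup>+w. slice_energy f g t (x, w) \<partial>\<mu>0) * indicator {0..} t"
  have Z: "0 \<le> ?Z" using \<rho>_pos by (intro integral_nonneg_AE) (auto intro: less_imp_le)
  note [measurable] = measurable_ess_slice[OF g] measurable_slice_energy[OF f g] measurable_ess_kernel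
  have wm [measurable]: "(\<lambda>y. ?w (snd y) (fst y)) \<in> borel_measurable (\<mu>0 \<Otimes>\<^sub>M lborel)"
    by (rule borel_measurable_nn_integral) (simp add: split_beta')
  have wm1 [measurable]: "(\<lambda>t. ?w t x) \<in> borel_measurable borel" for x
    by (rule borel_measurable_nn_integral) (simp add: split_beta')
  have Gm: "(\<lambda>(x, t). ?G x t) \<in> borel_measurable (\<mu>0 \<Otimes>\<^sub>M lborel)"
  proof -
    have "(\<lambda>y. \<integral>\<^sup>+w. slice_energy f g (snd y) (fst y, w) \<partial>\<mu>0) \<in> borel_measurable (\<mu>0 \<Otimes>\<^sub>M lborel)"
      by (rule borel_measurable_nn_integral) (simp add: split_beta')
    then show ?thesis by (simp add: split_beta')
  qed
  have km: "(\<lambda>x. \<integral>\<^sup>+y. g y \<partial>ess_kernel \<mu>0 \<rho> x) \<in> borel_measurable borel"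
    by (rule nn_integral_measurable_subprob_algebra2[OF _ measurable_ess_kernel]) measurable
  have pt: "ennreal (\<rho> x / ?Z) * (f x * (\<integral>\<^sup>+y. g y \<partial>ess_kernel \<mu>0 \<rho> x)) =
      ennreal (1 / ?Z) * (\<integral>\<^sup>+t. ?G x t \<partial>lborel)" for x
  proof -
    have "ennreal (\<rho> x / ?Z) * (f x * (\<integral>\<^sup>+y. g y \<partial>ess_kernel \<mu>0 \<rho> x)) =
        (ennreal (\<rho> x / ?Z) * ennreal (1 / \<rho> x)) * (f x * (\<integral>\<^sup>+t\<in>{0..\<rho> x}. ?w t x \<partial>lborel))"
      by (simp add: nn_integral_ess_kernel ac_simps)
    also have "ennreal (\<rho> x / ?Z) * ennreal (1 / \<rho> x) = ennreal (1 / ?Z)"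
      using \<rho>_pos[of x] Z by (simp add: ennreal_mult'[symmetric])
    also have "f x * (\<integral>\<^sup>+t\<in>{0..\<rho> x}. ?w t x \<partial>lborel) = (\<integral>\<^sup>+t. f x * (?w t x * indicator {0..\<rho> x} t) \<partial>lborel)"
      by (rule nn_integral_cmult[symmetric]) measurable
    also have "\<dots> = (\<integral>\<^sup>+t. ?G x t \<partial>lborel)"
    proof (rule nn_integral_cong_AE)
      \<comment> \<open>The kernel integrates over the closed range up to \<rho>(x), whereas the
        level set is strict; they differ in one level, a null set.\<close>
      have "AE t in lborel. t \<noteq> \<rho> x" by (rule AE_lborel_singleton)
      then show "AE t in lborel. f x * (?w t x * indicator {0..\<rho> x} t) = ?G x t"
      proof eventually_elim
        case (elim t)
        have "(\<integral>\<^sup>+w. slice_energy f g t (x, w) \<partial>\<mu>0) = f x * indicator (level_set \<rho> t) x * ?w t x"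
          unfolding slice_energy_def fst_conv snd_conv by (rule nn_integral_cmult) measurable
        then show ?case using elim by (auto simp: indicator_def level_set_def)
      qed
    qed
    finally show ?thesis .
  qed
  have "(\<integral>\<^sup>+x. f x * (\<integral>\<^sup>+y. g y \<partial>ess_kernel \<mu>0 \<rho> x) \<partial>target_measure \<mu>0 \<rho>) =
      (\<integral>\<^sup>+x. ennreal (\<rho> x / ?Z) * (f x * (\<integral>\<^sup>+y. g y \<partial>ess_kernel \<mu>0 \<rho> x)) \<partial>\<mu>0)"
    unfolding target_measure_def using km by (subst nn_integral_density) auto
  also have "\<dots> = ennreal (1 / ?Z) * (\<integral>\<^sup>+x. \<integral>\<^sup>+t. ?G x t \<partial>lborel \<partial>\<mu>0)"
    unfolding pt by (rule nn_integral_cmult) (rule lborel.borel_measurable_nn_integral[OF Gm])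
  also have "(\<integral>\<^sup>+x. \<integral>\<^sup>+t. ?G x t \<partial>lborel \<partial>\<mu>0) = (\<integral>\<^sup>+t. \<integral>\<^sup>+x. ?G x t \<partial>\<mu>0 \<partial>lborel)"
    by (rule PL.Fubini'[OF Gm, symmetric])
  also have "\<dots> = (\<integral>\<^sup>+t\<in>{0..}. (\<integral>\<^sup>+y. slice_energy f g t y \<partial>(\<mu>0 \<Otimes>\<^sub>M \<mu>0)) \<partial>lborel)"
  proof (rule nn_integral_cong)
    fix t :: real
    have m: "slice_energy f g t \<in> borel_measurable (\<mu>0 \<Otimes>\<^sub>M \<mu>0)"
      using measurable_slice_energy[OF f g, of "\<lambda>_. t" "\<mu>0 \<Otimes>\<^sub>M \<mu>0" fst snd] by simp
    have "(\<lambda>x. \<integral>\<^sup>+w. slice_energy f g t (x, w) \<partial>\<mu>0) \<in> borel_measurable \<mu>0"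
      using m by (intro borel_measurable_nn_integral) simp
    then have "(\<integral>\<^sup>+x. ?G x t \<partial>\<mu>0) = (\<integral>\<^sup>+x. \<integral>\<^sup>+w. slice_energy f g t (x, w) \<partial>\<mu>0 \<partial>\<mu>0) * indicator {0..} t"
      by (rule nn_integral_multc)
    then show "(\<integral>\<^sup>+x. ?G x t \<partial>\<mu>0) = (\<integral>\<^sup>+y. slice_energy f g t y \<partial>(\<mu>0 \<Otimes>\<^sub>M \<mu>0)) * indicator {0..} t"
      by (simp add: nn_integral_fst[OF m])
  qed
  finally show ?thesis .
qed

text \<open>Rotating the pair moves the state to the point at angle \<theta> of the same ellipse. A
  start at angle 0 of the rotated ellipse is a start at \<theta> of the original one, so the
  integral over \<theta> is the form on the ellipse.\<close>

lemma slice_energy_rotation: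
  assumes f [measurable]: "f \<in> borel_measurable borel" and g [measurable]: "g \<in> borel_measurable borel"
  shows "(\<integral>\<^sup>+\<theta>\<in>{0..<2*pi}. slice_energy f g t (pair_rotation \<theta> (x, w)) \<partial>lborel) =
    shrinkage_form (ellipse_preimage x w (level_set \<rho> t)) (\<lambda>\<alpha>. f (ellipse x w \<alpha>)) (\<lambda>\<alpha>. g (ellipse x w \<alpha>))"
  unfolding shrinkage_form_def
proof (rule nn_integral_cong)
  fix \<theta> :: real
  let ?S = "ellipse_preimage x w (level_set \<rho> t)"
  have em: "(\<lambda>\<alpha>. ellipse x w \<alpha>) \<in> borel_measurable borel" by (rule measurable_ellipse_comp) measurable
  show "slice_energy f g t (pair_rotation \<theta> (x, w)) * indicator {0..<2*pi} \<theta> =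
    indicator ?S \<theta> * f (ellipse x w \<theta>) * shrinkage_value ?S (\<lambda>\<alpha>. g (ellipse x w \<alpha>)) \<theta> * indicator {0..<2*pi} \<theta>"
  proof (cases "\<theta> \<in> {0..<2*pi}")
    case \<theta>: True
    define y where "y = pair_rotation \<theta> (x, w)"
    let ?S' = "ellipse_preimage (fst y) (snd y) (level_set \<rho> t)"
    have p: "ellipse (fst y) (snd y) \<alpha> = ellipse x w (circle_shift \<theta> \<alpha>)" for \<alpha>
      unfolding y_def by (rule ellipse_pair_rotation)
    have S': "\<alpha> \<in> ?S' \<longleftrightarrow> circle_shift \<theta> \<alpha> \<in> ?S" if "\<alpha> \<in> {0..<2*pi}" for \<alpha>
      using that circle_shift_in[OF \<theta> that] by (simp add: ellipse_preimage_def p)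
    have fy: "fst y = ellipse x w \<theta>" by (simp add: y_def pair_rotation_def ellipse_def)
    have lS: "fst y \<in> level_set \<rho> t \<longleftrightarrow> \<theta> \<in> ?S" using \<theta> by (simp add: fy ellipse_preimage_def)
    show ?thesis
    proof (cases "\<theta> \<in> ?S")
      case True
      \<comment> \<open>Here the level set indicator pays off: the start lies in the target set, as
        the interval recursion requires. If \<theta> is outside \<open>?S\<close>, both sides
        vanish.\<close>
      have "(0::real) \<in> ?S'"
        using S'[of 0] \<theta> True by (simp add: circle_shift_def)
      then have "ess_slice \<rho> g t (fst y) (snd y) = shrinkage_value ?S' (\<lambda>\<alpha>. g (ellipse x w (circle_shift \<theta> \<alpha>))) 0"
        unfolding ess_slice_def p
        by (intro hit_integral_eq_shrinkage_value sets_ellipse_preimage)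
           (use measurable_compose[OF measurable_compose[OF measurable_circle_shift em] g] in auto)
      also have "\<dots> = shrinkage_value ?S (\<lambda>\<alpha>. g (ellipse x w \<alpha>)) \<theta>"
        by (rule shrinkage_value_circle_shift[OF sets_ellipse_preimage measurable_compose[OF em g] \<theta> S']) auto
      finally show ?thesis using True lS unfolding y_def[symmetric] slice_energy_def
        by (simp add: fy)
    next
      case False
      then show ?thesis using lS unfolding y_def[symmetric] slice_energy_def by simp
    qed
  qed simp
qed

end

text \<open>The Gaussian law enters the energy computations through this invariance.\<close>

locale rotation_invariant_slice_sampler = slice_sampler +
  assumes rotation: "distr (\<mu>0 \<Otimes>\<^sub>M \<mu>0) (\<mu>0 \<Otimes>\<^sub>M \<mu>0) (pair_rotation \<theta>) = \<mu>0 \<Otimes>\<^sub>M \<mu>0"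
begin

sublocale MM: pair_prob_space \<mu>0 \<mu>0 ..

text \<open>The integral of \<open>slice_energy\<close> over all rotation angles, not divided by 2
  \<pi>, and written as a form on the ellipse so that symmetry and positivity can be read
  off.\<close>

definition rotation_average :: "('a \<Rightarrow> ennreal) \<Rightarrow> ('a \<Rightarrow> ennreal) \<Rightarrow> real \<Rightarrow> 'a \<times> 'a \<Rightarrow> ennreal" where
  "rotation_average f g t y = shrinkage_form (ellipse_preimage (fst y) (snd y) (level_set \<rho> t))
     (\<lambda>\<alpha>. f (ellipse (fst y) (snd y) \<alpha>)) (\<lambda>\<alpha>. g (ellipse (fst y) (snd y) \<alpha>))"

text \<open>The set in \<open>shrinkage_form\<close> varies with the pair. Joint measurability is
  therefore obtained from the other expression, the integral of \<open>slice_energy\<close> over the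
  angle.\<close>

lemma measurable_rotation_average:
  assumes f: "f \<in> borel_measurable borel" and g: "g \<in> borel_measurable borel"
  shows "(\<lambda>z. rotation_average f g (fst z) (snd z)) \<in> borel_measurable (lborel \<Otimes>\<^sub>M (\<mu>0 \<Otimes>\<^sub>M \<mu>0))"
proof -
  note [measurable] = measurable_slice_energy[OF f g]
  have "(\<lambda>z. \<integral>\<^sup>+\<theta>\<in>{0..<2*pi}. slice_energy f g (fst z) (pair_rotation \<theta> (fst (snd z), snd (snd z))) \<partial>lborel)
      \<in> borel_measurable (lborel \<Otimes>\<^sub>M (\<mu>0 \<Otimes>\<^sub>M \<mu>0))"
    unfolding pair_rotation_def by (rule lborel.borel_measurable_nn_integral) (simp add: split_beta')
  then show ?thesis unfolding slice_energy_rotation[OF f g] rotation_average_def .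
qed

lemma nn_integral_slice_energy:
  assumes f: "f \<in> borel_measurable borel" and g: "g \<in> borel_measurable borel"
  shows "(\<integral>\<^sup>+y. slice_energy f g t y \<partial>(\<mu>0 \<Otimes>\<^sub>M \<mu>0)) =
    (\<integral>\<^sup>+y. rotation_average f g t y \<partial>(\<mu>0 \<Otimes>\<^sub>M \<mu>0)) / ennreal (2 * pi)"
proof -
  interpret PL: pair_sigma_finite "\<mu>0 \<Otimes>\<^sub>M \<mu>0" lborel ..
  let ?MM = "\<mu>0 \<Otimes>\<^sub>M \<mu>0"
  let ?I = "\<integral>\<^sup>+y. slice_energy f g t y \<partial>?MM"
  note se = measurable_slice_energy[OF f g] note [measurable] = se
  have m: "slice_energy f g t \<in> borel_measurable ?MM"
    using se[of "\<lambda>_. t" ?MM fst snd] by simp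
  have [measurable]: "pair_rotation \<theta> \<in> measurable ?MM ?MM" for \<theta>
    unfolding pair_rotation_def by measurable
  have inv: "(\<integral>\<^sup>+y. slice_energy f g t (pair_rotation \<theta> y) \<partial>?MM) = ?I" for \<theta>
    using nn_integral_distr[of "pair_rotation \<theta>" ?MM ?MM "slice_energy f g t"] m rotation[of \<theta>] by simp
  have jm: "(\<lambda>(y, \<theta>). slice_energy f g t (pair_rotation \<theta> y) * indicator {0..<2*pi} \<theta>) \<in> borel_measurable (?MM \<Otimes>\<^sub>M lborel)"
    unfolding pair_rotation_def split_beta' by measurable
  have "(\<integral>\<^sup>+y. rotation_average f g t y \<partial>?MM) =
      (\<integral>\<^sup>+y. (\<integral>\<^sup>+\<theta>\<in>{0..<2*pi}. slice_energy f g t (pair_rotation \<theta> y) \<partial>lborel) \<partial>?MM)"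
    unfolding rotation_average_def slice_energy_rotation[OF f g, symmetric] by simp
  also have "\<dots> = (\<integral>\<^sup>+\<theta>. \<integral>\<^sup>+y. slice_energy f g t (pair_rotation \<theta> y) * indicator {0..<2*pi} \<theta> \<partial>?MM \<partial>lborel)"
    by (rule PL.Fubini'[OF jm, symmetric])
  also have "\<dots> = (\<integral>\<^sup>+\<theta>. ?I * indicator {0..<2*pi} \<theta> \<partial>lborel)"
    using m by (intro nn_integral_cong) (simp add: nn_integral_multc inv)
  also have "\<dots> = ?I * ennreal (2 * pi)" by (simp add: nn_integral_cmult)
  finally have e: "(\<integral>\<^sup>+y. rotation_average f g t y \<partial>?MM) = ?I * ennreal (2 * pi)" .
  have "?I * ennreal (2 * pi) / ennreal (2 * pi) = ?I"
    by (rule ennreal_mult_divide_eq) auto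
  then show ?thesis unfolding e ..
qed

lemma kernel_energy_rotation:
  assumes f: "f \<in> borel_measurable borel" and g: "g \<in> borel_measurable borel"
  shows "(\<integral>\<^sup>+x. f x * (\<integral>\<^sup>+y. g y \<partial>ess_kernel \<mu>0 \<rho> x) \<partial>target_measure \<mu>0 \<rho>) =
    ennreal (1 / (LINT y|\<mu>0. \<rho> y)) *
      (\<integral>\<^sup>+t\<in>{0..}. ((\<integral>\<^sup>+y. rotation_average f g t y \<partial>(\<mu>0 \<Otimes>\<^sub>M \<mu>0)) / ennreal (2 * pi)) \<partial>lborel)"
  unfolding kernel_energy_eq[OF f g] nn_integral_slice_energy[OF f g] ..

lemma measurable_ellipse [measurable]: "(\<lambda>\<alpha>. ellipse x w \<alpha>) \<in> borel_measurable borel" for x w :: 'a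
  by (rule measurable_ellipse_comp) measurable

lemma kernel_energy_commute:
  assumes f: "f \<in> borel_measurable borel" and g: "g \<in> borel_measurable borel"
  shows "(\<integral>\<^sup>+x. f x * (\<integral>\<^sup>+y. g y \<partial>ess_kernel \<mu>0 \<rho> x) \<partial>target_measure \<mu>0 \<rho>) =
    (\<integral>\<^sup>+x. g x * (\<integral>\<^sup>+y. f y \<partial>ess_kernel \<mu>0 \<rho> x) \<partial>target_measure \<mu>0 \<rho>)"
proof -
  have "rotation_average f g = rotation_average g f"
    unfolding rotation_average_def using f g
    by (intro ext shrinkage_form_commute sets_ellipse_preimage measurable_compose[OF measurable_ellipse])
  then show ?thesis unfolding kernel_energy_rotation[OF f g] kernel_energy_rotation[OF g f] by simp
qed

lemma kernel_energy_two_mult_le: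
  assumes f: "f \<in> borel_measurable borel" and g: "g \<in> borel_measurable borel"
  shows "(\<integral>\<^sup>+x. f x * (\<integral>\<^sup>+y. g y \<partial>ess_kernel \<mu>0 \<rho> x) \<partial>target_measure \<mu>0 \<rho>) +
    (\<integral>\<^sup>+x. g x * (\<integral>\<^sup>+y. f y \<partial>ess_kernel \<mu>0 \<rho> x) \<partial>target_measure \<mu>0 \<rho>) \<le>
    (\<integral>\<^sup>+x. f x * (\<integral>\<^sup>+y. f y \<partial>ess_kernel \<mu>0 \<rho> x) \<partial>target_measure \<mu>0 \<rho>) +
    (\<integral>\<^sup>+x. g x * (\<integral>\<^sup>+y. g y \<partial>ess_kernel \<mu>0 \<rho> x) \<partial>target_measure \<mu>0 \<rho>)"
proof -
  let ?MM = "\<mu>0 \<Otimes>\<^sub>M \<mu>0"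
  let ?A = "\<lambda>f g t. (\<integral>\<^sup>+y. rotation_average f g t y \<partial>?MM) / ennreal (2 * pi) * indicator {0..} t"
  have m: "rotation_average f g t \<in> borel_measurable ?MM"
    if "f \<in> borel_measurable borel" "g \<in> borel_measurable borel" for f g t
    using measurable_compose[OF measurable_Pair1' measurable_rotation_average[OF that], of t] by simp
  have Am: "?A f g \<in> borel_measurable lborel"
    if "f \<in> borel_measurable borel" "g \<in> borel_measurable borel" for f g
  proof -
    have "(\<lambda>t. \<integral>\<^sup>+y. rotation_average f g t y \<partial>?MM) \<in> borel_measurable lborel"
      using measurable_rotation_average[OF that] by (intro MM.borel_measurable_nn_integral) (simp add: split_beta')
    then show ?thesis by measurable
  qed
  have le: "?A f g t + ?A g f t \<le> ?A f f t + ?A g g t" for t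
  proof -
    have "(\<integral>\<^sup>+y. rotation_average f g t y \<partial>?MM) + (\<integral>\<^sup>+y. rotation_average g f t y \<partial>?MM) \<le>
        (\<integral>\<^sup>+y. rotation_average f f t y \<partial>?MM) + (\<integral>\<^sup>+y. rotation_average g g t y \<partial>?MM)"
      unfolding nn_integral_add[OF m[OF f g] m[OF g f], symmetric] nn_integral_add[OF m[OF f f] m[OF g g], symmetric]
      unfolding rotation_average_def using f g
      by (intro nn_integral_mono shrinkage_form_two_mult_le sets_ellipse_preimage
          measurable_compose[OF measurable_ellipse])
    then show ?thesis
      unfolding distrib_right[symmetric] add_divide_distrib_ennreal[symmetric]
      by (intro mult_right_mono divide_right_mono_ennreal) auto
  qed
  show ?thesis
    unfolding kernel_energy_rotation[OF f g] kernel_energy_rotation[OF g f]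
      kernel_energy_rotation[OF f f] kernel_energy_rotation[OF g g] distrib_left[symmetric]
    unfolding nn_integral_add[OF Am[OF f g] Am[OF g f], symmetric] nn_integral_add[OF Am[OF f f] Am[OF g g], symmetric]
    by (intro mult_left_mono nn_integral_mono le) auto
qed

end

section \<open>Symmetric kernels on square integrable functions\<close>

lemma L2_integrable_mult:
  assumes u: "u \<in> L2 M" and v: "v \<in> L2 M"
  shows "integrable M (\<lambda>x. u x * v x)"
proof -
  have [measurable]: "u \<in> borel_measurable M" "v \<in> borel_measurable M" using assms by (auto simp: L2_def)
  have "integrable M (\<lambda>x. (u x)\<^sup>2)" "integrable M (\<lambda>x. (v x)\<^sup>2)"
    using assms by (auto intro!: integrableI_nonneg simp: L2_def)
  then have "integrable M (\<lambda>x. (u x)\<^sup>2 + (v x)\<^sup>2)" by simp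
  then show ?thesis
  proof (rule Bochner_Integration.integrable_bound)
    have "\<bar>u x * v x\<bar> \<le> (u x)\<^sup>2 + (v x)\<^sup>2" for x
    proof -
      have "2 * (\<bar>u x\<bar> * \<bar>v x\<bar>) \<le> (u x)\<^sup>2 + (v x)\<^sup>2"
        using sum_squares_bound[of "\<bar>u x\<bar>" "\<bar>v x\<bar>"] by simp
      moreover have "0 \<le> \<bar>u x\<bar> * \<bar>v x\<bar>" by simp
      ultimately show ?thesis unfolding abs_mult by linarith
    qed
    then show "AE x in M. norm (u x * v x) \<le> norm ((u x)\<^sup>2 + (v x)\<^sup>2)" by (simp add: abs_of_nonneg)
  qed measurable
qed

text \<open>Jensen's inequality for total mass at most 1: expand the integral of (f - m)^2 \<ge> 0
  with m the integral of f, and bound the coefficient of m^2 by the mass.\<close>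

lemma (in subprob_space) square_integral_le:
  fixes f :: "'a \<Rightarrow> real"
  assumes f: "integrable M f" and f2: "integrable M (\<lambda>x. (f x)\<^sup>2)"
  shows "(LINT x|M. f x)\<^sup>2 \<le> (LINT x|M. (f x)\<^sup>2)"
proof -
  let ?m = "LINT x|M. f x"
  have "0 \<le> (LINT x|M. (f x - ?m)\<^sup>2)" by simp
  also have "(\<lambda>x. (f x - ?m)\<^sup>2) = (\<lambda>x. ((f x)\<^sup>2 - (2 * ?m) * f x) + ?m\<^sup>2)"
    by (rule ext) (simp add: power2_diff)
  also have "(LINT x|M. ((f x)\<^sup>2 - (2 * ?m) * f x) + ?m\<^sup>2) =
      (LINT x|M. (f x)\<^sup>2) - 2 * ?m * ?m + ?m\<^sup>2 * measure M (space M)"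
    using f f2 by simp
  also have "\<dots> \<le> (LINT x|M. (f x)\<^sup>2) - 2 * ?m * ?m + ?m\<^sup>2 * 1"
    using subprob_measure_le_1[of "space M"] by (intro add_left_mono mult_left_mono) auto
  finally show ?thesis by (simp add: power2_eq_square)
qed

text \<open>Symmetry is stated for \<open>ennreal\<close>-valued functions, so it also yields the
  estimates from which integrability is derived in the first place.\<close>

locale symmetric_kernel =
  fixes M :: "'a measure" and K :: "'a \<Rightarrow> 'a measure"
  assumes K [measurable]: "K \<in> measurable M (subprob_algebra M)"
    and energy_commute: "\<And>f g. f \<in> borel_measurable M \<Longrightarrow> g \<in> borel_measurable M \<Longrightarrow>
      (\<integral>\<^sup>+x. f x * (\<integral>\<^sup>+y. g y \<partial>K x) \<partial>M) = (\<integral>\<^sup>+x. g x * (\<integral>\<^sup>+y. f y \<partial>K x) \<partial>M)"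
begin

lemma subprob_K: "x \<in> space M \<Longrightarrow> subprob_space (K x)"
  using K by (rule subprob_space_kernel)

lemma sets_K: "x \<in> space M \<Longrightarrow> sets (K x) = sets M"
  using K by (rule sets_kernel)

lemma measurable_K: "x \<in> space M \<Longrightarrow> measurable (K x) N = measurable M N"
  by (rule measurable_cong_sets[OF sets_K refl])

text \<open>Symmetry against the constant 1 moves the kernel onto 1, where its mass is at most 1. So
  M is subinvariant, the source of the L2 bound and of the treatment of null sets.\<close>

lemma nn_integral_kernel_le:
  assumes [measurable]: "g \<in> borel_measurable M"
  shows "(\<integral>\<^sup>+x. (\<integral>\<^sup>+y. g y \<partial>K x) \<partial>M) \<le> (\<integral>\<^sup>+x. g x \<partial>M)"
proof -
  have "(\<integral>\<^sup>+x. (\<integral>\<^sup>+y. g y \<partial>K x) \<partial>M) = (\<integral>\<^sup>+x. g x * (\<integral>\<^sup>+y. 1 \<partial>K x) \<partial>M)"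
    using energy_commute[of "\<lambda>_. 1" g] by simp
  also have "\<dots> \<le> (\<integral>\<^sup>+x. g x * 1 \<partial>M)"
    using subprob_space.emeasure_space_le_1[OF subprob_K]
    by (intro nn_integral_mono mult_left_mono) auto
  finally show ?thesis by simp
qed

lemma AE_L2_kernel:
  assumes f: "f \<in> L2 M"
  shows "AE x in M. integrable (K x) f \<and> integrable (K x) (\<lambda>y. (f y)\<^sup>2)"
proof -
  have fm [measurable]: "f \<in> borel_measurable M" using f by (simp add: L2_def)
  have "(\<integral>\<^sup>+x. (\<integral>\<^sup>+y. ennreal ((f y)\<^sup>2) \<partial>K x) \<partial>M) \<le> (\<integral>\<^sup>+x. ennreal ((f x)\<^sup>2) \<partial>M)"
    by (rule nn_integral_kernel_le) measurable
  also have "\<dots> < \<infinity>" using f by (simp add: L2_def)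
  finally have "AE x in M. (\<integral>\<^sup>+y. ennreal ((f y)\<^sup>2) \<partial>K x) \<noteq> \<infinity>"
    by (intro nn_integral_PInf_AE) auto
  then show ?thesis using AE_space
  proof eventually_elim
    case (elim x)
    interpret subprob_space "K x" by (rule subprob_K[OF elim(2)])
    have m: "f \<in> borel_measurable (K x)" using fm by (simp add: measurable_K[OF elim(2)])
    \<comment> \<open>The measure \<open>K x\<close> is finite, so the constant 1 is square
      integrable and f = f * 1 is integrable.\<close>
    have "f \<in> L2 (K x)" "(\<lambda>_. 1) \<in> L2 (K x)" using elim m le_less_trans[OF emeasure_space_le_1 ennreal_one_less_top]
      by (auto simp: L2_def less_top)
    then show ?case using L2_integrable_mult[of f "K x" f] L2_integrable_mult[of f "K x" "\<lambda>_. 1"]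
      by (simp add: power2_eq_square)
  qed
qed

lemma kernel_operator_L2:
  assumes f: "f \<in> L2 M"
  shows "kernel_operator K f \<in> L2 M"
proof -
  have fm [measurable]: "f \<in> borel_measurable M" using f by (simp add: L2_def)
  have m: "kernel_operator K f \<in> borel_measurable M"
    unfolding kernel_operator_def[abs_def]
    by (rule measurable_compose[OF K integral_measurable_subprob_algebra]) measurable
  have "AE x in M. ennreal ((kernel_operator K f x)\<^sup>2) \<le> (\<integral>\<^sup>+y. ennreal ((f y)\<^sup>2) \<partial>K x)"
    using AE_L2_kernel[OF f] AE_space
  proof eventually_elim
    case (elim x)
    interpret subprob_space "K x" by (rule subprob_K[OF elim(2)])
    have "ennreal ((kernel_operator K f x)\<^sup>2) \<le> ennreal (LINT y|K x. (f y)\<^sup>2)"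
      unfolding kernel_operator_def using elim by (intro ennreal_leI square_integral_le) auto
    also have "\<dots> = (\<integral>\<^sup>+y. ennreal ((f y)\<^sup>2) \<partial>K x)"
      using elim by (intro nn_integral_eq_integral[symmetric]) auto
    finally show ?case .
  qed
  then have "(\<integral>\<^sup>+x. ennreal ((kernel_operator K f x)\<^sup>2) \<partial>M) \<le> (\<integral>\<^sup>+x. (\<integral>\<^sup>+y. ennreal ((f y)\<^sup>2) \<partial>K x) \<partial>M)"
    by (rule nn_integral_mono_AE)
  also have "\<dots> \<le> (\<integral>\<^sup>+x. ennreal ((f x)\<^sup>2) \<partial>M)"
    by (rule nn_integral_kernel_le) measurable
  finally show ?thesis using m f by (auto simp: L2_def)
qed

text \<open>By subinvariance the M-null set where f and g differ is also \<open>K x\<close>-null for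
  almost every x, so the operator respects almost-everywhere classes.\<close>

lemma kernel_operator_cong_AE:
  assumes f: "f \<in> L2 M" and g: "g \<in> L2 M" and eq: "AE x in M. f x = g x"
  shows "AE x in M. kernel_operator K f x = kernel_operator K g x"
proof -
  have fm [measurable]: "f \<in> borel_measurable M" "g \<in> borel_measurable M" using f g by (auto simp: L2_def)
  let ?N = "{x \<in> space M. f x \<noteq> g x}"
  have N: "?N \<in> sets M" by measurable
  have "(\<integral>\<^sup>+x. (\<integral>\<^sup>+y. indicator ?N y \<partial>K x) \<partial>M) \<le> (\<integral>\<^sup>+x. indicator ?N x \<partial>M)"
    by (rule nn_integral_kernel_le) measurable
  also have "\<dots> = 0" using eq N by (simp add: AE_iff_measurable[OF N refl])
  finally have "AE x in M. (\<integral>\<^sup>+y. indicator ?N y \<partial>K x) = 0"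
    by (subst (asm) le_zero_eq, subst (asm) nn_integral_0_iff_AE) auto
  then show ?thesis using AE_space
  proof eventually_elim
    case (elim x)
    have m: "f \<in> borel_measurable (K x)" "g \<in> borel_measurable (K x)"
      using fm by (simp_all add: measurable_K[OF elim(2)])
    have "emeasure (K x) ?N = 0" using elim N sets_K[OF elim(2)] by simp
    moreover have "space (K x) = space M" using sets_K[OF elim(2)] by (rule sets_eq_imp_space_eq)
    ultimately have "AE y in K x. f y = g y"
      using N sets_K[OF elim(2)] by (intro AE_I[of _ _ ?N]) auto
    then show ?case unfolding kernel_operator_def using m by (intro integral_cong_AE) auto
  qed
qed

lemma kernel_operator_linear:
  assumes f: "f \<in> L2 M" and g: "g \<in> L2 M"
  shows "AE x in M. kernel_operator K (\<lambda>y. a * f y + b * g y) x =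
    a * kernel_operator K f x + b * kernel_operator K g x"
  using AE_L2_kernel[OF f] AE_L2_kernel[OF g]
  by eventually_elim (simp add: kernel_operator_def)

lemma L2_linear_operator_kernel: "L2_linear_operator M (kernel_operator K)"
  unfolding L2_linear_operator_def
  using kernel_operator_L2 kernel_operator_cong_AE kernel_operator_linear by blast

text \<open>The bridge between the real inner product and the energies in \<open>ennreal\<close>;
  for nonnegative square integrable functions both are the same finite number.\<close>

lemma ennreal_L2_inner_kernel:
  assumes f: "f \<in> L2 M" "\<And>x. 0 \<le> f x" and g: "g \<in> L2 M" "\<And>x. 0 \<le> g x"
  shows "ennreal (L2_inner M (kernel_operator K g) f) =
    (\<integral>\<^sup>+x. ennreal (f x) * (\<integral>\<^sup>+y. ennreal (g y) \<partial>K x) \<partial>M)"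
proof -
  have nn: "0 \<le> kernel_operator K g x" for x
    unfolding kernel_operator_def using g(2) by simp
  have "ennreal (L2_inner M (kernel_operator K g) f) = (\<integral>\<^sup>+x. ennreal (kernel_operator K g x * f x) \<partial>M)"
    unfolding L2_inner_def
    by (rule nn_integral_eq_integral[symmetric]) (use nn f kernel_operator_L2[OF g(1)] in \<open>auto intro!: L2_integrable_mult\<close>)
  also have "\<dots> = (\<integral>\<^sup>+x. ennreal (f x) * (\<integral>\<^sup>+y. ennreal (g y) \<partial>K x) \<partial>M)"
  proof (rule nn_integral_cong_AE)
    show "AE x in M. ennreal (kernel_operator K g x * f x) = ennreal (f x) * (\<integral>\<^sup>+y. ennreal (g y) \<partial>K x)"
      using AE_L2_kernel[OF g(1)]
    proof eventually_elim
      case (elim x)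
      then have "(\<integral>\<^sup>+y. ennreal (g y) \<partial>K x) = ennreal (kernel_operator K g x)"
        unfolding kernel_operator_def using g(2) by (intro nn_integral_eq_integral) auto
      then show ?case using f(2) nn by (simp add: ennreal_mult mult.commute)
    qed
  qed
  finally show ?thesis .
qed

lemma L2_positive_semidefinite_kernel:
  assumes psd: "\<And>f g. f \<in> borel_measurable M \<Longrightarrow> g \<in> borel_measurable M \<Longrightarrow>
      (\<integral>\<^sup>+x. f x * (\<integral>\<^sup>+y. g y \<partial>K x) \<partial>M) + (\<integral>\<^sup>+x. g x * (\<integral>\<^sup>+y. f y \<partial>K x) \<partial>M) \<le>
      (\<integral>\<^sup>+x. f x * (\<integral>\<^sup>+y. f y \<partial>K x) \<partial>M) + (\<integral>\<^sup>+x. g x * (\<integral>\<^sup>+y. g y \<partial>K x) \<partial>M)"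
  shows "L2_positive_semidefinite M (kernel_operator K)"
  unfolding L2_positive_semidefinite_def
proof
  fix f assume f: "f \<in> L2 M"
  have fm [measurable]: "f \<in> borel_measurable M" using f by (simp add: L2_def)
  define p where "p x = max 0 (f x)" for x
  define n where "n x = max 0 (- f x)" for x
  have [measurable]: "p \<in> borel_measurable M" "n \<in> borel_measurable M"
    unfolding p_def n_def by measurable
  have le: "(\<integral>\<^sup>+x. ennreal ((h x)\<^sup>2) \<partial>M) < \<infinity>" if "\<And>x. (h x)\<^sup>2 \<le> (f x)\<^sup>2" for h :: "'a \<Rightarrow> real"
  proof -
    have "(\<integral>\<^sup>+x. ennreal ((h x)\<^sup>2) \<partial>M) \<le> (\<integral>\<^sup>+x. ennreal ((f x)\<^sup>2) \<partial>M)"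
      by (intro nn_integral_mono ennreal_leI that)
    then show ?thesis using f by (auto simp: L2_def)
  qed
  have p: "p \<in> L2 M" "\<And>x. 0 \<le> p x" and n: "n \<in> L2 M" "\<And>x. 0 \<le> n x"
    using le[of p] le[of n] by (auto simp: L2_def p_def n_def max_def)
  let ?B = "\<lambda>g h. L2_inner M (kernel_operator K g) h"
  have pos: "0 \<le> ?B g h" if "\<And>x. 0 \<le> g x" "\<And>x. 0 \<le> h x" for g h
    unfolding L2_inner_def kernel_operator_def using that by simp
  have "ennreal (?B n p) + ennreal (?B p n) \<le> ennreal (?B p p) + ennreal (?B n n)"
    unfolding ennreal_L2_inner_kernel[OF p n] ennreal_L2_inner_kernel[OF n p]
      ennreal_L2_inner_kernel[OF p p] ennreal_L2_inner_kernel[OF n n]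
    by (rule psd) measurable
  \<comment> \<open>All four inner products are finite and nonnegative, so the inequality passes
    from \<open>ennreal\<close> to the reals, where expanding the form at p - n needs
    subtraction.\<close>
  then have ineq: "?B n p + ?B p n \<le> ?B p p + ?B n n"
    using pos p(2) n(2) by (simp add: ennreal_plus[symmetric] del: ennreal_plus)
  have fpn: "f = (\<lambda>x. 1 * p x + (-1) * n x)" by (auto simp: p_def n_def max_def)
  have i: "integrable M (\<lambda>x. kernel_operator K g x * h x)" if "g \<in> L2 M" "h \<in> L2 M" for g h
    using L2_integrable_mult[OF kernel_operator_L2[OF that(1)] that(2)] .
  have "?B f f = (LINT x|M. (kernel_operator K p x * p x - kernel_operator K n x * p x) -
      (kernel_operator K p x * n x - kernel_operator K n x * n x))"
    unfolding L2_inner_def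
  proof (rule integral_cong_AE)
    have "AE x in M. kernel_operator K f x = 1 * kernel_operator K p x + (-1) * kernel_operator K n x"
      by (subst fpn) (rule kernel_operator_linear[OF p(1) n(1)])
    then show "AE x in M. kernel_operator K f x * f x = (kernel_operator K p x * p x - kernel_operator K n x * p x) -
      (kernel_operator K p x * n x - kernel_operator K n x * n x)"
    proof eventually_elim
      case (elim x)
      have e: "f x = p x - n x" "kernel_operator K f x = kernel_operator K p x - kernel_operator K n x"
        using elim by (simp_all add: p_def n_def max_def)
      show ?case unfolding e by (simp add: algebra_simps)
    qed
    show "(\<lambda>x. kernel_operator K f x * f x) \<in> borel_measurable M" using i[OF f f] by simp
    show "(\<lambda>x. (kernel_operator K p x * p x - kernel_operator K n x * p x) -
      (kernel_operator K p x * n x - kernel_operator K n x * n x)) \<in> borel_measurable M"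
      using i p n by (intro borel_measurable_diff borel_measurable_integrable) auto
  qed
  also have "\<dots> = (?B p p - ?B n p) - (?B p n - ?B n n)"
    unfolding L2_inner_def using i p n by simp
  finally show "0 \<le> ?B f f" using ineq by simp
qed

end

theorem theorem3p1:
  fixes C :: "'a::{real_inner, polish_space} \<Rightarrow> 'a"
    and \<mu>0 :: "'a measure" and \<rho> :: "'a \<Rightarrow> real"
  assumes "nonsingular_covariance_operator C"
    and "centered_gaussian C \<mu>0"
    and "\<And>x. \<rho> x > 0"
    and "lower_semicontinuous \<rho>"
    and "(\<integral>\<^sup>+x. ennreal (\<rho> x) \<partial>\<mu>0) < \<infinity>"
  shows "reversible (target_measure \<mu>0 \<rho>) (ess_transition \<mu>0 \<rho>)
    \<and> L2_linear_operator (target_measure \<mu>0 \<rho>) (kernel_operator (ess_kernel \<mu>0 \<rho>))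
    \<and> L2_positive_semidefinite (target_measure \<mu>0 \<rho>) (kernel_operator (ess_kernel \<mu>0 \<rho>))"
proof -
  have prob: "prob_space \<mu>0" and sets0: "sets \<mu>0 = sets borel"
    using assms(2) by (auto simp: centered_gaussian_def)
  interpret rotation_invariant_slice_sampler \<mu>0 \<rho>
    unfolding rotation_invariant_slice_sampler_def slice_sampler_def rotation_invariant_slice_sampler_axioms_def
    using prob sets0 borel_measurable_lower_semicontinuous[OF assms(4)] assms(3)
      distr_pair_rotation_gaussian[OF assms(1,2)] by blast
  let ?M = "target_measure \<mu>0 \<rho>"
  have sM: "sets ?M = sets borel" by (simp add: target_measure_def sets0)
  have mM: "measurable ?M N = measurable borel N" for N by (rule measurable_cong_sets[OF sM refl])
  interpret symmetric_kernel ?M "ess_kernel \<mu>0 \<rho>"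
  proof
    show "ess_kernel \<mu>0 \<rho> \<in> measurable ?M (subprob_algebra ?M)"
      using measurable_ess_kernel by (simp add: mM subprob_algebra_cong[OF sM])
  qed (rule kernel_energy_commute; simp add: mM)
  have "reversible ?M (ess_transition \<mu>0 \<rho>)"
    unfolding reversible_def
  proof (intro ballI)
    fix A B assume "A \<in> sets ?M" "B \<in> sets ?M"
    then have A: "A \<in> sets borel" and B: "B \<in> sets borel" by (auto simp: sM)
    have "(\<integral>\<^sup>+x\<in>B. ess_transition \<mu>0 \<rho> x A \<partial>?M) =
        (\<integral>\<^sup>+x. indicator B x * (\<integral>\<^sup>+y. indicator A y \<partial>ess_kernel \<mu>0 \<rho> x) \<partial>?M)"
      if "A \<in> sets borel" for A B
      using that by (simp add: emeasure_ess_kernel[OF prob sets0 \<rho>] sets_ess_kernel mult.commute)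
    then show "(\<integral>\<^sup>+x\<in>B. ess_transition \<mu>0 \<rho> x A \<partial>?M) = (\<integral>\<^sup>+x\<in>A. ess_transition \<mu>0 \<rho> x B \<partial>?M)"
      \<comment> \<open>Reversibility is symmetry of the energy tested on indicators.\<close>
      using A B kernel_energy_commute[of "indicator B" "indicator A"] by simp
  qed
  moreover have "L2_positive_semidefinite ?M (kernel_operator (ess_kernel \<mu>0 \<rho>))"
    by (rule L2_positive_semidefinite_kernel, rule kernel_energy_two_mult_le) (simp_all add: mM)
  ultimately show ?thesis using L2_linear_operator_kernel by blast
qed

end
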